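(* Let $R$ be a commutative noetherian local ring of dimension $d$. Suppose that for every commutative noetherian local ring $A$ of dimension $d-1$ and every finitely generated $A$-module $N$ the set $\bigcup_{i\ge 0}\operatorname{Ass}_A(\operatorname{Ext}^i_A(N,A))$ is finite. Then the set $\bigcup_{i\ge 0}\operatorname{Ass}_R(\operatorname{Ext}^i_R(I,R))$ is finite for every ideal $I$ of $R$ of positive grade.
   Context: An ideal $I$ has positive grade if it contains a nonzerodivisor of $R$. *)

theory Defs
  imports "HOL-Algebra.Module" "HOL-Algebra.Ring_Divisibility" "HOL-Library.Extended_Nat"
begin

section \<open>Noetherian local rings and Krull dimension\<close>

definition noetherian_local_ring :: "('a, 'c) ring_scheme \<Rightarrow> bool" where
  "noetherian_local_ring R \<longleftrightarrow> cring R \<and> noetherian_ring R \<and> (\<exists>!P. maximalideal P R)"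

text \<open>The supremum of the lengths of chains of prime ideals. The value for the zero ring is
  \<open>0\<close> instead of \<open>-\<infinity>\<close>; it is only used for local rings, which are nonzero.\<close>

definition krull_dim :: "('a, 'c) ring_scheme \<Rightarrow> enat" where
  "krull_dim R = Sup {enat n |n. \<exists>P :: nat \<Rightarrow> 'a set.
     (\<forall>i\<le>n. primeideal (P i) R) \<and> (\<forall>i<n. P i \<subset> P (Suc i))}"

definition nonzerodivisor :: "('a, 'c) ring_scheme \<Rightarrow> 'a \<Rightarrow> bool" where
  "nonzerodivisor R x \<longleftrightarrow> x \<in> carrier R \<and> (\<forall>r\<in>carrier R. x \<otimes>\<^bsub>R\<^esub> r = \<zero>\<^bsub>R\<^esub> \<longrightarrow> r = \<zero>\<^bsub>R\<^esub>)"

definition positive_grade :: "('a, 'c) ring_scheme \<Rightarrow> 'a set \<Rightarrow> bool" where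
  "positive_grade R I \<longleftrightarrow> (\<exists>x\<in>I. nonzerodivisor R x)"


section \<open>Modules\<close>

text \<open>The record type of modules extends the one of rings; the fields \<open>mult\<close> and \<open>one\<close> of a
  module carry no meaning.\<close>

definition ring_module :: "('a, 'c) ring_scheme \<Rightarrow> ('a, 'a) module" where
  "ring_module R = \<lparr>carrier = carrier R, mult = mult R, one = one R, zero = zero R,
     add = add R, smult = mult R\<rparr>"

definition ideal_module :: "('a, 'c) ring_scheme \<Rightarrow> 'a set \<Rightarrow> ('a, 'a) module" where
  "ideal_module R I = (ring_module R)\<lparr>carrier := I\<rparr>"

definition fin_gen_module :: "('a, 'c) ring_scheme \<Rightarrow> ('a, 'm, 'e) module_scheme \<Rightarrow> bool" where
  "fin_gen_module R M \<longleftrightarrow> (\<exists>S. finite S \<and> S \<subseteq> carrier M \<and>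
     (\<forall>x\<in>carrier M. \<exists>c\<in>S \<rightarrow> carrier R. x = (\<Oplus>\<^bsub>M\<^esub>s\<in>S. c s \<odot>\<^bsub>M\<^esub> s)))"

definition mod_hom ::
    "('a, 'c) ring_scheme \<Rightarrow> ('a, 'm, 'e) module_scheme \<Rightarrow> ('a, 'n, 'f) module_scheme \<Rightarrow> ('m \<Rightarrow> 'n) set" where
  "mod_hom R M N = {f \<in> carrier M \<rightarrow> carrier N.
     (\<forall>x\<in>carrier M. \<forall>y\<in>carrier M. f (x \<oplus>\<^bsub>M\<^esub> y) = f x \<oplus>\<^bsub>N\<^esub> f y) \<and>
     (\<forall>a\<in>carrier R. \<forall>x\<in>carrier M. f (a \<odot>\<^bsub>M\<^esub> x) = a \<odot>\<^bsub>N\<^esub> f x)}"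

text \<open>Homomorphisms are made \<^const>\<open>extensional\<close> so that equality of elements of
  \<open>Hom\<close> is equality of maps on the carrier.\<close>

definition Hom_module ::
    "('a, 'c) ring_scheme \<Rightarrow> ('a, 'm, 'e) module_scheme \<Rightarrow> ('a, 'n, 'f) module_scheme \<Rightarrow> ('a, 'm \<Rightarrow> 'n) module" where
  "Hom_module R M N = \<lparr>carrier = mod_hom R M N \<inter> extensional (carrier M),
     mult = undefined, one = undefined,
     zero = (\<lambda>x\<in>carrier M. \<zero>\<^bsub>N\<^esub>),
     add = (\<lambda>f g. \<lambda>x\<in>carrier M. f x \<oplus>\<^bsub>N\<^esub> g x),
     smult = (\<lambda>a f. \<lambda>x\<in>carrier M. a \<odot>\<^bsub>N\<^esub> f x)\<rparr>"

definition quotient_module :: "('a, 'm, 'e) module_scheme \<Rightarrow> 'm set \<Rightarrow> ('a, 'm set) module" where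
  "quotient_module M H = \<lparr>carrier = a_rcosets\<^bsub>M\<^esub> H,
     mult = undefined, one = undefined,
     zero = H,
     add = set_add M,
     smult = (\<lambda>a X. \<Union>x\<in>X. H +>\<^bsub>M\<^esub> (a \<odot>\<^bsub>M\<^esub> x))\<rparr>"

definition free_module :: "('a, 'c) ring_scheme \<Rightarrow> 'b set \<Rightarrow> ('a, 'b \<Rightarrow> 'a) module" where
  "free_module R B = \<lparr>carrier = {f. (\<forall>b\<in>B. f b \<in> carrier R) \<and> (\<forall>b. b \<notin> B \<longrightarrow> f b = \<zero>\<^bsub>R\<^esub>) \<and>
       finite {b \<in> B. f b \<noteq> \<zero>\<^bsub>R\<^esub>}},
     mult = undefined, one = undefined,
     zero = (\<lambda>b. \<zero>\<^bsub>R\<^esub>),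
     add = (\<lambda>f g b. f b \<oplus>\<^bsub>R\<^esub> g b),
     smult = (\<lambda>a f b. a \<otimes>\<^bsub>R\<^esub> f b)\<rparr>"

definition annihilator :: "('a, 'c) ring_scheme \<Rightarrow> ('a, 'm, 'e) module_scheme \<Rightarrow> 'm \<Rightarrow> 'a set" where
  "annihilator R M x = {r \<in> carrier R. r \<odot>\<^bsub>M\<^esub> x = \<zero>\<^bsub>M\<^esub>}"

definition Ass :: "('a, 'c) ring_scheme \<Rightarrow> ('a, 'm, 'e) module_scheme \<Rightarrow> 'a set set" where
  "Ass R M = {P. primeideal P R \<and> (\<exists>x\<in>carrier M. P = annihilator R M x)}"


section \<open>Free resolutions and Ext\<close>

text \<open>\<open>\<dots> \<rightarrow> F 2 \<rightarrow> F 1 \<rightarrow> F 0 \<rightarrow> N \<rightarrow> 0\<close> is exact, where \<open>F i\<close> is free on \<open>B i\<close>,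
  \<open>\<delta> i\<close> maps \<open>F (i + 1)\<close> to \<open>F i\<close>, and \<open>\<epsilon>\<close> maps \<open>F 0\<close> to \<open>N\<close>.\<close>

definition free_resolution ::
    "('a, 'c) ring_scheme \<Rightarrow> ('a, 'n, 'e) module_scheme \<Rightarrow> (nat \<Rightarrow> 'b set) \<Rightarrow>
      (nat \<Rightarrow> ('b \<Rightarrow> 'a) \<Rightarrow> ('b \<Rightarrow> 'a)) \<Rightarrow> (('b \<Rightarrow> 'a) \<Rightarrow> 'n) \<Rightarrow> bool" where
  "free_resolution R N B \<delta> \<epsilon> \<longleftrightarrow>
     \<epsilon> \<in> mod_hom R (free_module R (B 0)) N \<and>
     \<epsilon> ` carrier (free_module R (B 0)) = carrier N \<and>
     (\<forall>i. \<delta> i \<in> mod_hom R (free_module R (B (Suc i))) (free_module R (B i))) \<and>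
     \<delta> 0 ` carrier (free_module R (B (Suc 0))) =
       {x \<in> carrier (free_module R (B 0)). \<epsilon> x = \<zero>\<^bsub>N\<^esub>} \<and>
     (\<forall>i. \<delta> (Suc i) ` carrier (free_module R (B (Suc (Suc i)))) =
       {x \<in> carrier (free_module R (B (Suc i))). \<delta> i x = \<zero>\<^bsub>free_module R (B i)\<^esub>})"

definition cocycles ::
    "('a, 'c) ring_scheme \<Rightarrow> ('a, 'm, 'e) module_scheme \<Rightarrow> (nat \<Rightarrow> 'b set) \<Rightarrow>
      (nat \<Rightarrow> ('b \<Rightarrow> 'a) \<Rightarrow> ('b \<Rightarrow> 'a)) \<Rightarrow> nat \<Rightarrow> (('b \<Rightarrow> 'a) \<Rightarrow> 'm) set" where
  "cocycles R M B \<delta> i = {f \<in> carrier (Hom_module R (free_module R (B i)) M).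
     \<forall>x\<in>carrier (free_module R (B (Suc i))). f (\<delta> i x) = \<zero>\<^bsub>M\<^esub>}"

fun coboundaries ::
    "('a, 'c) ring_scheme \<Rightarrow> ('a, 'm, 'e) module_scheme \<Rightarrow> (nat \<Rightarrow> 'b set) \<Rightarrow>
      (nat \<Rightarrow> ('b \<Rightarrow> 'a) \<Rightarrow> ('b \<Rightarrow> 'a)) \<Rightarrow> nat \<Rightarrow> (('b \<Rightarrow> 'a) \<Rightarrow> 'm) set" where
  "coboundaries R M B \<delta> 0 = {\<zero>\<^bsub>Hom_module R (free_module R (B 0)) M\<^esub>}"
| "coboundaries R M B \<delta> (Suc i) =
     (\<lambda>g. \<lambda>x\<in>carrier (free_module R (B (Suc i))). g (\<delta> i x)) `
       carrier (Hom_module R (free_module R (B i)) M)"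

definition cohomology_module ::
    "('a, 'c) ring_scheme \<Rightarrow> ('a, 'm, 'e) module_scheme \<Rightarrow> (nat \<Rightarrow> 'b set) \<Rightarrow>
      (nat \<Rightarrow> ('b \<Rightarrow> 'a) \<Rightarrow> ('b \<Rightarrow> 'a)) \<Rightarrow> nat \<Rightarrow> ('a, (('b \<Rightarrow> 'a) \<Rightarrow> 'm) set) module" where
  "cohomology_module R M B \<delta> i = quotient_module
     ((Hom_module R (free_module R (B i)) M)\<lparr>carrier := cocycles R M B \<delta> i\<rparr>)
     (coboundaries R M B \<delta> i)"

text \<open>A type of basis labels that is large enough for a free resolution of an arbitrary module with
  elements in \<open>'n\<close> over a ring with elements in \<open>'a\<close>: generators are labelled by elements of the
  module, syzygies by their finite lists of coefficients (lemma \<open>free_resolution_exists\<close> below).\<close>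

datatype ('a, 'n) label = Gen 'n | Syz "('a \<times> ('a, 'n) label) list"

text \<open>Ext is the cohomology of \<open>Hom(F, M)\<close> for one arbitrarily chosen free resolution \<open>F\<close> of \<open>N\<close>.
  The usual independence of the choice (up to isomorphism) is not built into the definition.\<close>

definition chosen_resolution ::
    "('a, 'c) ring_scheme \<Rightarrow> ('a, 'n, 'e) module_scheme \<Rightarrow>
      (nat \<Rightarrow> ('a, 'n) label set) \<times> (nat \<Rightarrow> (('a, 'n) label \<Rightarrow> 'a) \<Rightarrow> (('a, 'n) label \<Rightarrow> 'a))" where
  "chosen_resolution R N = (SOME (B, \<delta>). \<exists>\<epsilon>. free_resolution R N B \<delta> \<epsilon>)"

definition Ext ::
    "('a, 'c) ring_scheme \<Rightarrow> nat \<Rightarrow> ('a, 'n, 'e) module_scheme \<Rightarrow> ('a, 'm, 'f) module_scheme \<Rightarrow>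
      ('a, ((('a, 'n) label \<Rightarrow> 'a) \<Rightarrow> 'm) set) module" where
  "Ext R i N M = (case chosen_resolution R N of (B, \<delta>) \<Rightarrow> cohomology_module R M B \<delta> i)"


lemma free_module_is_module:
  fixes R :: "('a, 'c) ring_scheme" and B :: "'b set"
  assumes "cring R"
  shows "module R (free_module R B)"
proof -
  interpret cring R by fact
  have fin: "finite {b \<in> B. h b \<noteq> \<zero>\<^bsub>R\<^esub>}"
    if "finite {b \<in> B. f b \<noteq> \<zero>\<^bsub>R\<^esub>}" "finite {b \<in> B. g b \<noteq> \<zero>\<^bsub>R\<^esub>}"
       "\<And>b. b \<in> B \<Longrightarrow> f b = \<zero>\<^bsub>R\<^esub> \<Longrightarrow> g b = \<zero>\<^bsub>R\<^esub> \<Longrightarrow> h b = \<zero>\<^bsub>R\<^esub>" for f g h :: "'b \<Rightarrow> 'a"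
    by (rule finite_subset[of _ "{b \<in> B. f b \<noteq> \<zero>\<^bsub>R\<^esub>} \<union> {b \<in> B. g b \<noteq> \<zero>\<^bsub>R\<^esub>}"]) (use that in auto)
  have cl: "f b \<in> carrier R" if "f \<in> carrier (free_module R B)" for f b
    using that by (cases "b \<in> B") (auto simp: free_module_def)
  show ?thesis
  proof (rule moduleI)
    show "abelian_group (free_module R B)"
    proof (rule abelian_groupI)
      fix f assume f: "f \<in> carrier (free_module R B)"
      show "\<exists>g\<in>carrier (free_module R B). g \<oplus>\<^bsub>free_module R B\<^esub> f = \<zero>\<^bsub>free_module R B\<^esub>"
      proof (rule bexI[of _ "\<lambda>b. \<ominus>\<^bsub>R\<^esub> f b"])
        show "(\<lambda>b. \<ominus>\<^bsub>R\<^esub> f b) \<in> carrier (free_module R B)"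
          using f by (auto simp: free_module_def intro: fin[of f f "\<lambda>b. \<ominus>\<^bsub>R\<^esub> f b"])
        show "(\<lambda>b. \<ominus>\<^bsub>R\<^esub> f b) \<oplus>\<^bsub>free_module R B\<^esub> f = \<zero>\<^bsub>free_module R B\<^esub>"
          using cl[OF f] by (auto simp: free_module_def l_neg)
      qed
    next
      fix f g assume fg: "f \<in> carrier (free_module R B)" "g \<in> carrier (free_module R B)"
      then show "f \<oplus>\<^bsub>free_module R B\<^esub> g \<in> carrier (free_module R B)"
        by (auto simp: free_module_def intro: fin[of f g "\<lambda>b. f b \<oplus>\<^bsub>R\<^esub> g b"])
    next
      fix f g assume fg: "f \<in> carrier (free_module R B)" "g \<in> carrier (free_module R B)"
      show "f \<oplus>\<^bsub>free_module R B\<^esub> g = g \<oplus>\<^bsub>free_module R B\<^esub> f"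
        using cl[OF fg(1)] cl[OF fg(2)] by (auto simp: free_module_def a_comm)
    next
      fix f g h assume fgh: "f \<in> carrier (free_module R B)" "g \<in> carrier (free_module R B)"
        "h \<in> carrier (free_module R B)"
      show "f \<oplus>\<^bsub>free_module R B\<^esub> g \<oplus>\<^bsub>free_module R B\<^esub> h =
          f \<oplus>\<^bsub>free_module R B\<^esub> (g \<oplus>\<^bsub>free_module R B\<^esub> h)"
        using cl[OF fgh(1)] cl[OF fgh(2)] cl[OF fgh(3)] by (auto simp: free_module_def a_assoc)
    next
      fix f assume f: "f \<in> carrier (free_module R B)"
      show "\<zero>\<^bsub>free_module R B\<^esub> \<oplus>\<^bsub>free_module R B\<^esub> f = f"
        using cl[OF f] by (auto simp: free_module_def)
    qed (auto simp: free_module_def)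
  next
    fix a f assume "a \<in> carrier R" and f: "f \<in> carrier (free_module R B)"
    then show "a \<odot>\<^bsub>free_module R B\<^esub> f \<in> carrier (free_module R B)"
      by (auto simp: free_module_def intro: fin[of f f "\<lambda>b. a \<otimes>\<^bsub>R\<^esub> f b"])
  next
    fix a b f assume "a \<in> carrier R" "b \<in> carrier R" and f: "f \<in> carrier (free_module R B)"
    then show "(a \<oplus>\<^bsub>R\<^esub> b) \<odot>\<^bsub>free_module R B\<^esub> f =
        a \<odot>\<^bsub>free_module R B\<^esub> f \<oplus>\<^bsub>free_module R B\<^esub> b \<odot>\<^bsub>free_module R B\<^esub> f"
      using cl[OF f] by (auto simp: free_module_def l_distr)
  next
    fix a f g assume "a \<in> carrier R" and f: "f \<in> carrier (free_module R B)"
      and g: "g \<in> carrier (free_module R B)"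
    then show "a \<odot>\<^bsub>free_module R B\<^esub> (f \<oplus>\<^bsub>free_module R B\<^esub> g) =
        a \<odot>\<^bsub>free_module R B\<^esub> f \<oplus>\<^bsub>free_module R B\<^esub> a \<odot>\<^bsub>free_module R B\<^esub> g"
      using cl[OF f] cl[OF g] by (auto simp: free_module_def r_distr)
  next
    fix a b f assume "a \<in> carrier R" "b \<in> carrier R" and f: "f \<in> carrier (free_module R B)"
    then show "(a \<otimes>\<^bsub>R\<^esub> b) \<odot>\<^bsub>free_module R B\<^esub> f =
        a \<odot>\<^bsub>free_module R B\<^esub> (b \<odot>\<^bsub>free_module R B\<^esub> f)"
      using cl[OF f] by (auto simp: free_module_def m_assoc)
  next
    fix f assume f: "f \<in> carrier (free_module R B)"
    then show "\<one>\<^bsub>R\<^esub> \<odot>\<^bsub>free_module R B\<^esub> f = f"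
      using cl[OF f] by (auto simp: free_module_def)
  qed fact
qed

lemma free_module_cover:
  fixes R :: "('a, 'c) ring_scheme" and M :: "('a, 'm, 'e) module_scheme" and B :: "'b set"
  assumes M: "module R M" and H: "submodule H R M"
    and g: "bij_betw g B H"
  obtains \<phi> where "\<phi> \<in> mod_hom R (free_module R B) M" "\<phi> ` carrier (free_module R B) = H"
proof -
  interpret module R M by fact
  let ?F = "free_module R B"
  define S where "S f = {b \<in> B. f b \<noteq> \<zero>\<^bsub>R\<^esub>}" for f :: "'b \<Rightarrow> 'a"
  define \<phi> where "\<phi> f = (\<Oplus>\<^bsub>M\<^esub>b\<in>S f. f b \<odot>\<^bsub>M\<^esub> g b)" for f
  note HE = submoduleE[OF H]
  have gH: "g b \<in> H" if "b \<in> B" for b using that g by (auto simp: bij_betw_def)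
  have gM: "g b \<in> carrier M" if "b \<in> B" for b using gH[OF that] HE(1) by auto
  have F: "f b \<in> carrier R" "finite (S f)" if "f \<in> carrier ?F" for f b
    using that by (cases "b \<in> B"; auto simp: free_module_def S_def)+
  have ext: "\<phi> f = (\<Oplus>\<^bsub>M\<^esub>b\<in>T. f b \<odot>\<^bsub>M\<^esub> g b)"
    if f: "f \<in> carrier ?F" and T: "finite T" "S f \<subseteq> T" "T \<subseteq> B" for f T
    unfolding \<phi>_def
  proof (rule M.add.finprod_mono_neutral_cong_left)
    show "f b \<odot>\<^bsub>M\<^esub> g b = \<zero>\<^bsub>M\<^esub>" if "b \<in> T - S f" for b
      using that T gM[of b] by (auto simp: S_def)
    show "(\<lambda>b. f b \<odot>\<^bsub>M\<^esub> g b) \<in> T \<rightarrow> carrier M" using T gM F(1)[OF f] by auto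
  qed (use T in auto)
  interpret F: module R ?F by (rule free_module_is_module) (rule R.is_cring)
  have hom: "\<phi> \<in> mod_hom R ?F M"
    unfolding mod_hom_def
  proof (intro CollectI conjI ballI Pi_I)
    fix f assume f: "f \<in> carrier ?F"
    show "\<phi> f \<in> carrier M" unfolding \<phi>_def
      by (rule M.finsum_closed) (use F[OF f] gM in \<open>auto simp: S_def\<close>)
  next
    fix f h assume f: "f \<in> carrier ?F" and h: "h \<in> carrier ?F"
    let ?T = "S f \<union> S h"
    have T: "finite ?T" "?T \<subseteq> B" using F[OF f] F[OF h] by (auto simp: S_def)
    have "\<phi> (f \<oplus>\<^bsub>?F\<^esub> h) = (\<Oplus>\<^bsub>M\<^esub>b\<in>?T. (f \<oplus>\<^bsub>?F\<^esub> h) b \<odot>\<^bsub>M\<^esub> g b)"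
      by (rule ext) (use F.M.a_closed[OF f h] T F(1)[OF f] F(1)[OF h] in \<open>auto simp: S_def free_module_def\<close>)
    also have "\<dots> = (\<Oplus>\<^bsub>M\<^esub>b\<in>?T. f b \<odot>\<^bsub>M\<^esub> g b \<oplus>\<^bsub>M\<^esub> h b \<odot>\<^bsub>M\<^esub> g b)"
      by (rule M.finsum_cong') (use T gM F(1)[OF f] F(1)[OF h] in
          \<open>auto simp: free_module_def smult_l_distr subset_iff\<close>)
    also have "\<dots> = (\<Oplus>\<^bsub>M\<^esub>b\<in>?T. f b \<odot>\<^bsub>M\<^esub> g b) \<oplus>\<^bsub>M\<^esub> (\<Oplus>\<^bsub>M\<^esub>b\<in>?T. h b \<odot>\<^bsub>M\<^esub> g b)"
      by (rule M.finsum_addf) (use T gM F(1)[OF f] F(1)[OF h] in \<open>auto simp: subset_iff\<close>)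
    also have "\<dots> = \<phi> f \<oplus>\<^bsub>M\<^esub> \<phi> h"
      using ext[OF f T(1) _ T(2)] ext[OF h T(1) _ T(2)] by simp
    finally show "\<phi> (f \<oplus>\<^bsub>?F\<^esub> h) = \<phi> f \<oplus>\<^bsub>M\<^esub> \<phi> h" .
  next
    fix a f assume a: "a \<in> carrier R" and f: "f \<in> carrier ?F"
    have sub: "S f \<subseteq> B" by (auto simp: S_def)
    have "\<phi> (a \<odot>\<^bsub>?F\<^esub> f) = (\<Oplus>\<^bsub>M\<^esub>b\<in>S f. (a \<odot>\<^bsub>?F\<^esub> f) b \<odot>\<^bsub>M\<^esub> g b)"
      by (rule ext) (use F.smult_closed[OF a f] a F[OF f] in \<open>auto simp: S_def free_module_def\<close>)
    also have "\<dots> = (\<Oplus>\<^bsub>M\<^esub>b\<in>S f. a \<odot>\<^bsub>M\<^esub> (f b \<odot>\<^bsub>M\<^esub> g b))"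
      by (rule M.finsum_cong') (use a sub gM F(1)[OF f] in
          \<open>auto simp: free_module_def smult_assoc1 subset_iff\<close>)
    also have "\<dots> = a \<odot>\<^bsub>M\<^esub> \<phi> f" unfolding \<phi>_def
      by (rule finsum_smult_ldistr[symmetric]) (use a sub gM F[OF f] in \<open>auto simp: subset_iff\<close>)
    finally show "\<phi> (a \<odot>\<^bsub>?F\<^esub> f) = a \<odot>\<^bsub>M\<^esub> \<phi> f" .
  qed
  have sum_in: "(\<Oplus>\<^bsub>M\<^esub>b\<in>T. k b) \<in> H" if "finite T" "k \<in> T \<rightarrow> H" for T and k :: "'b \<Rightarrow> 'm"
    using that
  proof (induction T)
    case empty
    show ?case using HE(2,3,5) HE(1) by (metis M.finsum_empty M.r_neg equals0I subsetD)
  next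
    case (insert b T)
    then have "k \<in> T \<rightarrow> carrier M" "k b \<in> carrier M" using HE(1) by auto
    then show ?case using insert HE(5) by (simp add: Pi_iff)
  qed
  have "\<phi> ` carrier ?F = H"
  proof (intro equalityI subsetI)
    fix y assume "y \<in> \<phi> ` carrier ?F"
    then obtain f where f: "f \<in> carrier ?F" and y: "y = \<phi> f" by auto
    show "y \<in> H" unfolding y \<phi>_def
      by (rule sum_in) (use F[OF f] HE(4) gH in \<open>auto simp: S_def\<close>)
  next
    fix y assume y: "y \<in> H"
    then obtain b where b: "b \<in> B" "g b = y" using g by (auto simp: bij_betw_def)
    let ?f = "\<lambda>c. if c = b then \<one>\<^bsub>R\<^esub> else \<zero>\<^bsub>R\<^esub>"
    have f: "?f \<in> carrier ?F" using b by (auto simp: free_module_def)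
    have "\<phi> ?f = (\<Oplus>\<^bsub>M\<^esub>c\<in>{b}. ?f c \<odot>\<^bsub>M\<^esub> g c)"
      by (rule ext[OF f]) (use b in \<open>auto simp: S_def\<close>)
    also have "\<dots> = y" using b gM[OF b(1)] by simp
    finally show "y \<in> \<phi> ` carrier ?F" using f by blast
  qed
  with hom that show ?thesis by blast
qed

lemma mod_hom_kernel_submodule:
  assumes M: "module R M" and N: "module R N" and f: "f \<in> mod_hom R M N"
  shows "submodule {x \<in> carrier M. f x = \<zero>\<^bsub>N\<^esub>} R M"
proof -
  interpret M: module R M by fact
  interpret N: module R N by fact
  have cl: "f x \<in> carrier N" if "x \<in> carrier M" for x using f that by (auto simp: mod_hom_def)
  have add: "f (x \<oplus>\<^bsub>M\<^esub> y) = f x \<oplus>\<^bsub>N\<^esub> f y" if "x \<in> carrier M" "y \<in> carrier M" for x y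
    using f that by (auto simp: mod_hom_def)
  have sm: "f (a \<odot>\<^bsub>M\<^esub> x) = a \<odot>\<^bsub>N\<^esub> f x" if "a \<in> carrier R" "x \<in> carrier M" for a x
    using f that by (auto simp: mod_hom_def)
  have z: "f \<zero>\<^bsub>M\<^esub> = \<zero>\<^bsub>N\<^esub>"
    using sm[of "\<zero>\<^bsub>R\<^esub>" "\<zero>\<^bsub>M\<^esub>"] cl[of "\<zero>\<^bsub>M\<^esub>"] by simp
  show ?thesis
  proof (rule M.submoduleI)
    fix a assume a: "a \<in> {x \<in> carrier M. f x = \<zero>\<^bsub>N\<^esub>}"
    then have "f (\<ominus>\<^bsub>M\<^esub> a) \<oplus>\<^bsub>N\<^esub> f a = \<zero>\<^bsub>N\<^esub>"
      using add[of "\<ominus>\<^bsub>M\<^esub> a" a] z by (simp add: M.M.l_neg)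
    with a cl[of "\<ominus>\<^bsub>M\<^esub> a"] show "\<ominus>\<^bsub>M\<^esub> a \<in> {x \<in> carrier M. f x = \<zero>\<^bsub>N\<^esub>}" by simp
  qed (use z add sm in auto)
qed

lemma inj_on_free_module_label:
  fixes R :: "('a, 'c) ring_scheme"
  obtains code :: "(('a, 'n) label \<Rightarrow> 'a) \<Rightarrow> ('a, 'n) label"
  where "inj_on code (carrier (free_module R B))"
proof -
  let ?F = "carrier (free_module R B)"
  define S where "S f = (\<lambda>b. (f b, b)) ` {b \<in> B. f b \<noteq> \<zero>\<^bsub>R\<^esub>}" for f :: "('a, 'n) label \<Rightarrow> 'a"
  have "\<exists>xs. set xs = S f" if "f \<in> ?F" for f
    by (rule finite_list) (use that in \<open>auto simp: S_def free_module_def\<close>)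
  then obtain l where l: "set (l f) = S f" if "f \<in> ?F" for f by metis
  have "inj_on (\<lambda>f. Syz (l f)) ?F"
  proof (rule inj_onI)
    fix f g assume f: "f \<in> ?F" and g: "g \<in> ?F" and "Syz (l f) = Syz (l g)"
    then have eq: "S f = S g" using l[OF f] l[OF g] by simp
    have S: "(h b, b) \<in> S h' \<longleftrightarrow> b \<in> B \<and> h' b \<noteq> \<zero>\<^bsub>R\<^esub> \<and> h b = h' b" for h h' b
      by (auto simp: S_def)
    show "f = g"
    proof (rule ext)
      fix b
      show "f b = g b"
      proof (cases "b \<in> B")
        case True
        with S[of f b f] S[of f b g] S[of g b g] S[of g b f] eq show ?thesis by metis
      next
        case False
        with f g show ?thesis by (simp add: free_module_def)
      qed
    qed
  qed
  with that show ?thesis by blast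
qed

lemma free_resolution_exists:
  fixes R :: "('a, 'c) ring_scheme" and N :: "('a, 'n, 'e) module_scheme"
  assumes N: "module R N"
  obtains B :: "nat \<Rightarrow> ('a, 'n) label set" and \<delta> \<epsilon> where "free_resolution R N B \<delta> \<epsilon>"
proof -
  interpret N: module R N by fact
  note mod = free_module_is_module[OF N.R.is_cring]
  let ?F = "\<lambda>B :: ('a, 'n) label set. free_module R B"
  define ker where "ker B B' d = {x \<in> carrier (?F B). d x = \<zero>\<^bsub>?F B'\<^esub>}"
    for B B' and d :: "(('a, 'n) label \<Rightarrow> 'a) \<Rightarrow> (('a, 'n) label \<Rightarrow> 'a)"
  have cover: "\<exists>B' \<phi>. \<phi> \<in> mod_hom R (?F B') (?F B) \<and> \<phi> ` carrier (?F B') = H"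
    if H: "submodule H R (?F B)" for H B
  proof -
    obtain code :: "(('a, 'n) label \<Rightarrow> 'a) \<Rightarrow> ('a, 'n) label"
      where "inj_on code (carrier (?F B))" by (rule inj_on_free_module_label)
    moreover have "H \<subseteq> carrier (?F B)" by (rule module.submoduleE(1)[OF mod H])
    ultimately have "bij_betw (inv_into H code) (code ` H) H"
      by (metis bij_betw_imageI bij_betw_inv_into inj_on_subset)
    from free_module_cover[OF mod H this] show ?thesis by metis
  qed
  have "bij_betw (inv_into (carrier N) Gen) (Gen ` carrier N) (carrier N)"
    by (intro bij_betw_inv_into) (auto simp: bij_betw_def inj_on_def)
  from free_module_cover[OF N N.carrier_is_submodule this]
  obtain \<epsilon> where \<epsilon>: "\<epsilon> \<in> mod_hom R (?F (Gen ` carrier N)) N"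
    "\<epsilon> ` carrier (?F (Gen ` carrier N)) = carrier N" by blast
  let ?B0 = "Gen ` carrier N :: ('a, 'n) label set"
  obtain B1 d0 where d0: "d0 \<in> mod_hom R (?F B1) (?F ?B0)"
    "d0 ` carrier (?F B1) = {x \<in> carrier (?F ?B0). \<epsilon> x = \<zero>\<^bsub>N\<^esub>}"
    using cover[OF mod_hom_kernel_submodule[OF mod N \<epsilon>(1)]] by blast
  define P where "P = (\<lambda>n :: nat. \<lambda>(B, B', d). d \<in> mod_hom R (?F B') (?F B) \<and>
    (n = 0 \<longrightarrow> B = ?B0 \<and> d ` carrier (?F B') = {x \<in> carrier (?F ?B0). \<epsilon> x = \<zero>\<^bsub>N\<^esub>}))"
  define Q where "Q = (\<lambda>n :: nat. \<lambda>(B, B', d) (C, C', e). C = B' \<and>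
    e ` carrier (?F C') = {x \<in> carrier (?F B'). d x = \<zero>\<^bsub>?F B\<^esub>})"
  have "\<exists>T. \<forall>n. P n (T n) \<and> Q n (T n) (T (Suc n))"
  proof (rule dependent_nat_choice)
    show "\<exists>x. P 0 x" using d0 by (auto simp: P_def)
  next
    fix x n assume "P n x"
    moreover obtain B B' d where x: "x = (B, B', d)" by (cases x)
    ultimately have "d \<in> mod_hom R (?F B') (?F B)" by (simp add: P_def)
    from cover[OF mod_hom_kernel_submodule[OF mod mod this]] obtain C' e where
      "e \<in> mod_hom R (?F C') (?F B')"
      "e ` carrier (?F C') = {x \<in> carrier (?F B'). d x = \<zero>\<^bsub>?F B\<^esub>}" by blast
    then show "\<exists>y. P (Suc n) y \<and> Q n x y" by (intro exI[of _ "(B', C', e)"]) (simp add: P_def Q_def x)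
  qed
  then obtain T where T: "P n (T n)" "Q n (T n) (T (Suc n))" for n by blast
  define B where "B n = fst (T n)" for n
  define \<delta> where "\<delta> n = snd (snd (T n))" for n
  have TB: "T n = (B n, B (Suc n), \<delta> n)" for n
    using T(2)[of n] by (auto simp: Q_def B_def \<delta>_def split: prod.splits)
  have "\<delta> n \<in> mod_hom R (?F (B (Suc n))) (?F (B n))" for n
    using T(1)[of n] by (simp add: TB P_def)
  moreover have "B 0 = ?B0"
    "\<delta> 0 ` carrier (?F (B (Suc 0))) = {x \<in> carrier (?F ?B0). \<epsilon> x = \<zero>\<^bsub>N\<^esub>}"
    using T(1)[of 0] by (simp_all add: TB P_def)
  moreover have "\<delta> (Suc n) ` carrier (?F (B (Suc (Suc n)))) =
      {x \<in> carrier (?F (B (Suc n))). \<delta> n x = \<zero>\<^bsub>?F (B n)\<^esub>}" for n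
    using T(2)[of n] by (simp add: TB Q_def)
  ultimately have "free_resolution R N B \<delta> \<epsilon>"
    unfolding free_resolution_def using \<epsilon> by simp
  with that show ?thesis by blast
qed

text \<open>HOL cannot quantify over types inside a statement. A hypothesis on all rings \<open>A\<close> and all finitely
  generated \<open>A\<close>-modules is therefore stated for rings with elements in the type \<open>'a\<close> that also hosts
  the ring under study, and for modules with elements in \<open>(nat \<Rightarrow> 'a) set\<close>. The latter is no loss: up to
  isomorphism every finitely generated \<open>A\<close>-module is a quotient of some \<open>A\<^sup>n\<close>, and so consists of
  cosets in \<open>nat \<Rightarrow> 'a\<close>. The former plays the role of a universe: carriers are arbitrary subsets of
  \<open>'a\<close>, and \<open>'a\<close> is arbitrary.\<close>

end

theory Submission
  imports Defs
begin

text \<open>Let \<open>x \<in> I\<close> be a nonzerodivisor. Evaluation at \<open>x\<close> embeds \<open>Hom(I, R)\<close> into \<open>R\<close>, so only \<open>Ext\<^sup>i(I, R)\<close>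
  with \<open>i \<ge> 1\<close> matters. Every \<open>y \<in> I\<close> acts on \<open>I\<close> through the free module \<open>R\<close>, hence annihilates
  \<open>Ext\<^sup>i(I, R)\<close>; in particular all of them vanish if \<open>I = R\<close>. Otherwise put \<open>A = R/xR\<close>, a local ring of dimension
  \<open>d - 1\<close> by Krull's principal ideal theorem. As \<open>x\<close> annihilates \<open>Ext\<^sup>i(I, R)\<close>, the long exact sequence of
  \<open>0 \<rightarrow> R \<rightarrow> R \<rightarrow> A \<rightarrow> 0\<close> embeds it into \<open>Ext\<^sup>i(I, A)\<close>, and this is \<open>Ext\<^sub>A(I/xI, A)\<close> in degree \<open>i\<close> because a free
  resolution of \<open>I\<close> reduces modulo \<open>x\<close> to one of \<open>I/xI\<close>. So the associated primes of \<open>Ext\<^sup>i(I, R)\<close> are among the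
  finitely many preimages of those of \<open>Ext\<^sub>A(I/xI, A)\<close>.\<close>

section \<open>Commutative algebra of noetherian rings\<close>

text \<open>Two features of the statement shape the proof. \<open>Ext\<close> refers to one
  arbitrarily chosen resolution, and the hypothesis speaks only of rings carried by
  \<open>'a\<close> and modules carried by \<open>(nat \<Rightarrow> 'a) set\<close>. Hence R/xR
  lives on representatives inside R, and resolutions are compared only through \<open>Ass\<close>, a
  set of subsets of the ring, so that bases with labels of different types cause no conflict.
  Annihilators are all that matters: the class of a cocycle f has annihilator {r. rf is a
  coboundary}, and embeddings of cohomology modules are replaced by equalities of such sets, with no
  connecting homomorphism. The dimension formula has two halves. A prime chain of R/xR pulls back to
  primes containing x and can be prolonged downwards; a longest chain of R can be bent to pass
  through x at the cost of one link. Localisations are avoided: an ideal of \<open>R_Q\<close> is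
  represented by its preimage in R, an ideal closed under division by elements outside Q. Finiteness
  is transported at the end by injectivity of P \<mapsto> P \<inter> A on ideals containing
  x.\<close>

locale noetherian_cring = noetherian_ring + cring

section \<open>Ideals of a commutative ring and the ideals I + Rg\<close>

lemma (in cring) ideal_cringI:
  assumes "I \<subseteq> carrier R" "\<zero> \<in> I" "\<And>a b. a \<in> I \<Longrightarrow> b \<in> I \<Longrightarrow> a \<oplus> b \<in> I"
    "\<And>a r. a \<in> I \<Longrightarrow> r \<in> carrier R \<Longrightarrow> r \<otimes> a \<in> I"
  shows "ideal I R"
proof (rule idealI[OF ring_axioms])
  show "subgroup I (add_monoid R)"
  proof (rule add.subgroupI)
    fix a assume "a \<in> I"
    then have "(\<ominus> \<one>) \<otimes> a \<in> I" "a \<in> carrier R" using assms by auto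
    then show "\<ominus> a \<in> I" by (simp add: l_minus)
  qed (use assms in auto)
  show "a \<otimes> r \<in> I" if "a \<in> I" "r \<in> carrier R" for a r
    using that assms(1) assms(4)[OF that] m_comm[of a r] by auto
qed (use assms in auto)

lemma (in ring) ideal_minus_closed:
  assumes "ideal I R" "a \<in> I" "b \<in> I"
  shows "a \<ominus> b \<in> I"
proof -
  interpret I: ideal I R by fact
  show ?thesis using assms unfolding a_minus_def by blast
qed

text \<open>The set is I + Rg. It is kept as an explicit set of sums because later arguments read
  off the coefficients c of two members and cross-multiply them.\<close>

lemma (in cring) sum_principal_ideal:
  assumes "ideal I R" "g \<in> carrier R"
  shows "ideal {u \<oplus> c \<otimes> g |u c. u \<in> I \<and> c \<in> carrier R} R"
proof -
  interpret I: ideal I R by fact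
  have IR: "u \<in> carrier R" if "u \<in> I" for u using that I.Icarr by blast
  have mem: "z \<in> {u \<oplus> c \<otimes> g |u c. u \<in> I \<and> c \<in> carrier R}"
    if "z = u \<oplus> c \<otimes> g" "u \<in> I" "c \<in> carrier R" for z u c using that by auto
  show ?thesis
  proof (rule ideal_cringI)
    have "\<zero> = \<zero> \<oplus> \<zero> \<otimes> g" using assms by simp
    then show "\<zero> \<in> {u \<oplus> c \<otimes> g |u c. u \<in> I \<and> c \<in> carrier R}" by (rule mem) auto
  next
    fix a b assume "a \<in> {u \<oplus> c \<otimes> g |u c. u \<in> I \<and> c \<in> carrier R}"
      "b \<in> {u \<oplus> c \<otimes> g |u c. u \<in> I \<and> c \<in> carrier R}"
    then obtain u c v e where *: "a = u \<oplus> c \<otimes> g" "u \<in> I" "c \<in> carrier R"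
      "b = v \<oplus> e \<otimes> g" "v \<in> I" "e \<in> carrier R" by blast
    have "a \<oplus> b = (u \<oplus> v) \<oplus> (c \<oplus> e) \<otimes> g"
      using * IR assms(2) by (simp add: l_distr a_ac)
    then show "a \<oplus> b \<in> {u \<oplus> c \<otimes> g |u c. u \<in> I \<and> c \<in> carrier R}"
      by (rule mem) (use * in auto)
  next
    fix a r assume "a \<in> {u \<oplus> c \<otimes> g |u c. u \<in> I \<and> c \<in> carrier R}" and r: "r \<in> carrier R"
    then obtain u c where *: "a = u \<oplus> c \<otimes> g" "u \<in> I" "c \<in> carrier R" by blast
    have "r \<otimes> a = r \<otimes> u \<oplus> (r \<otimes> c) \<otimes> g"
      using * IR assms(2) r by (simp add: r_distr m_assoc)
    then show "r \<otimes> a \<in> {u \<oplus> c \<otimes> g |u c. u \<in> I \<and> c \<in> carrier R}"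
      by (rule mem) (use * r I.I_l_closed in auto)
  qed (use IR assms in auto)
qed

lemma (in cring) subset_sum_principal:
  assumes "I \<subseteq> carrier R" "g \<in> carrier R"
  shows "I \<subseteq> {u \<oplus> c \<otimes> g |u c. u \<in> I \<and> c \<in> carrier R}"
proof
  fix u assume u: "u \<in> I"
  then have "u = u \<oplus> \<zero> \<otimes> g" using assms by auto
  with u show "u \<in> {u \<oplus> c \<otimes> g |u c. u \<in> I \<and> c \<in> carrier R}"
    by (intro CollectI exI[of _ u] exI[of _ \<zero>]) simp
qed

lemma (in cring) generator_in_sum_principal:
  assumes "ideal I R" "g \<in> carrier R"
  shows "g \<in> {u \<oplus> c \<otimes> g |u c. u \<in> I \<and> c \<in> carrier R}"
proof -
  have "g = \<zero> \<oplus> \<one> \<otimes> g" using assms by simp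
  moreover have "\<zero> \<in> I" using additive_subgroup.zero_closed[OF ideal.axioms(1)[OF assms(1)]] .
  ultimately show ?thesis by (intro CollectI exI[of _ \<zero>] exI[of _ \<one>]) simp
qed

section \<open>Colon ideals and associated primes of a noetherian ring\<close>

lemma (in cring) colon_ideal:
  assumes "ideal I R" "g \<in> carrier R"
  shows "ideal {r \<in> carrier R. r \<otimes> g \<in> I} R"
proof -
  interpret I: ideal I R by fact
  show ?thesis
    by (rule ideal_cringI) (use assms(2) I.I_l_closed in \<open>auto simp: l_distr m_assoc\<close>)
qed

text \<open>Noetherian induction in its maximal-element form. Zorn's lemma applies to an arbitrary
  property because the union of a nonempty chain of ideals is a member of the chain; the property
  need not pass to unions.\<close>

lemma (in noetherian_ring) maximal_ideal_such_that:
  assumes "\<P> I" "\<And>J. \<P> J \<Longrightarrow> ideal J R"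
  obtains M where "\<P> M" "\<And>J. \<P> J \<Longrightarrow> M \<subseteq> J \<Longrightarrow> J = M"
proof -
  have "\<exists>M\<in>Collect \<P>. \<forall>J\<in>Collect \<P>. M \<subseteq> J \<longrightarrow> J = M"
  proof (rule subset_Zorn)
    fix C assume C: "subset.chain (Collect \<P>) C"
    show "\<exists>U\<in>Collect \<P>. \<forall>X\<in>C. X \<subseteq> U"
    proof (cases "C = {}")
      case True
      then show ?thesis using assms by blast
    next
      case False
      have "subset.chain {I. ideal I R} C"
        using C assms(2) by (auto simp: pred_on.chain_def)
      from ideal_chain_is_trivial[OF False this] show ?thesis
        using C by (auto simp: pred_on.chain_def)
    qed
  qed
  with that show ?thesis by blast
qed

text \<open>Among the annihilators (I : g) of nonzero classes of R/I a maximal one is prime: if ab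
  kills g modulo I and a does not, then ag is again a nonzero class, its annihilator contains (I :
  g) and hence equals it, and b belongs to it.\<close>

lemma (in noetherian_cring) associated_prime_exists:
  assumes "ideal I R" "I \<noteq> carrier R"
  obtains g where "g \<in> carrier R - I" "primeideal {r \<in> carrier R. r \<otimes> g \<in> I} R"
proof -
  interpret I: ideal I R by fact
  let ?c = "\<lambda>g. {r \<in> carrier R. r \<otimes> g \<in> I}"
  obtain h where "h \<in> carrier R - I" using assms I.a_subset by blast
  then have "\<exists>g\<in>carrier R - I. ?c h = ?c g" by blast
  then obtain M where "\<exists>g\<in>carrier R - I. M = ?c g"
    and max': "\<And>J. \<exists>g\<in>carrier R - I. J = ?c g \<Longrightarrow> M \<subseteq> J \<Longrightarrow> J = M"
    by (rule maximal_ideal_such_that[of "\<lambda>J. \<exists>g\<in>carrier R - I. J = ?c g"])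
      (use colon_ideal[OF assms(1)] in auto)
  then obtain g where g: "g \<in> carrier R - I" and M: "M = ?c g" by blast
  have max: "?c g' = ?c g" if "g' \<in> carrier R - I" "?c g \<subseteq> ?c g'" for g'
    using max'[of "?c g'"] that unfolding M by blast
  have "primeideal (?c g) R"
  proof (rule primeidealI)
    show "ideal (?c g) R" using g assms colon_ideal by blast
    have "\<one> \<notin> ?c g" using g by simp
    then show "carrier R \<noteq> ?c g" using one_closed by metis
    fix a b assume ab: "a \<in> carrier R" "b \<in> carrier R" "a \<otimes> b \<in> ?c g"
    show "a \<in> ?c g \<or> b \<in> ?c g"
    proof (cases "a \<otimes> g \<in> I")
      case False
      have "?c g \<subseteq> ?c (a \<otimes> g)"
      proof
        fix r assume r: "r \<in> ?c g"
        then have "r \<otimes> (a \<otimes> g) = a \<otimes> (r \<otimes> g)" using ab g by (simp add: m_lcomm)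
        then show "r \<in> ?c (a \<otimes> g)" using r ab(1) I.I_l_closed[of "r \<otimes> g" a] by simp
      qed
      then have "?c (a \<otimes> g) = ?c g" using max[of "a \<otimes> g"] False g ab by blast
      moreover have "b \<in> ?c (a \<otimes> g)" using ab g by (auto simp: m_ac)
      ultimately show ?thesis by blast
    qed (use ab in blast)
  qed (rule is_cring)
  with g that show ?thesis by blast
qed

text \<open>Take J maximal among the ideals with finitely many associated primes. If J \<noteq> R,
  adjoining some g whose annihilator modulo J is a prime Q makes (J + Rg)/J isomorphic to R/Q, and
  the inclusion Ass(J + Rg) \<subseteq> Ass J \<union> {Q} contradicts the choice of J. This takes
  the place of a prime filtration.\<close>

lemma (in noetherian_cring) finite_Ass_ring_module:
  "finite (Ass R (ring_module R))"
proof -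
  define AP where "AP J = {P. primeideal P R \<and> (\<exists>y\<in>J. P = {r \<in> carrier R. r \<otimes> y = \<zero>})}" for J
  have "ideal {\<zero>} R" by (rule zeroideal)
  \<comment> \<open>The zero ideal starts the induction: the only annihilator that occurs is the
    whole ring.\<close>
  moreover have "AP {\<zero>} \<subseteq> {carrier R}" by (auto simp: AP_def)
  then have "finite (AP {\<zero>})" using finite_subset by blast
  ultimately have "ideal {\<zero>} R \<and> finite (AP {\<zero>})" by simp
  then obtain J where J: "ideal J R" "finite (AP J)"
    and max: "\<And>J'. ideal J' R \<Longrightarrow> finite (AP J') \<Longrightarrow> J \<subseteq> J' \<Longrightarrow> J' = J"
    by (rule maximal_ideal_such_that) auto
  interpret J: ideal J R by fact
  have "J = carrier R"
  proof (rule ccontr)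
    assume "J \<noteq> carrier R"
    then obtain g where g: "g \<in> carrier R - J" "primeideal {r \<in> carrier R. r \<otimes> g \<in> J} R"
      using associated_prime_exists J by blast
    define Q where "Q = {r \<in> carrier R. r \<otimes> g \<in> J}"
    interpret Q: primeideal Q R using g Q_def by simp
    let ?J' = "{u \<oplus> c \<otimes> g |u c. u \<in> J \<and> c \<in> carrier R}"
    have "AP ?J' \<subseteq> insert Q (AP J)"
    proof
      fix P assume "P \<in> AP ?J'"
      then obtain u c where P: "primeideal P R" "u \<in> J" "c \<in> carrier R"
        "P = {r \<in> carrier R. r \<otimes> (u \<oplus> c \<otimes> g) = \<zero>}" by (auto simp: AP_def)
      interpret P: primeideal P R by fact
      define y where "y = u \<oplus> c \<otimes> g"
      have uR: "u \<in> carrier R" using P(2) J.Icarr by blast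
      have gR: "g \<in> carrier R" using g by blast
      note cR = P(3)
      have yR: "y \<in> carrier R" unfolding y_def using cR uR gR by simp
      note Py = P(4)[folded y_def]
      show "P \<in> insert Q (AP J)"
      \<comment> \<open>The dichotomy is whether Ry, a copy of R/P, meets J outside zero. If by
        \<in> J with b \<notin> P, primeness of P gives by the annihilator P, so P is associated to
        J. Otherwise y has annihilator P modulo J as well, and a nonzero class in R/Q has
        annihilator Q, so P = Q.\<close>
      proof (cases "\<exists>b\<in>carrier R - P. b \<otimes> y \<in> J")
        case True
        then obtain b where b: "b \<in> carrier R" "b \<notin> P" "b \<otimes> y \<in> J" by blast
        have "r \<otimes> (b \<otimes> y) = \<zero> \<longleftrightarrow> r \<in> P" if r: "r \<in> carrier R" for r
        proof -
          have "r \<otimes> (b \<otimes> y) = \<zero> \<longleftrightarrow> r \<otimes> b \<in> P" unfolding Py using r b yR by (auto simp: m_assoc)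
          also have "\<dots> \<longleftrightarrow> r \<in> P" using P.I_prime[of r b] r b P.I_r_closed by blast
          finally show ?thesis .
        qed
        then have "P = {r \<in> carrier R. r \<otimes> (b \<otimes> y) = \<zero>}" using P.Icarr by blast
        then show ?thesis using b P(1) unfolding AP_def by blast
      next
        case False
        have J_iff: "r \<otimes> y \<in> J \<longleftrightarrow> r \<otimes> c \<in> Q" if r: "r \<in> carrier R" for r
        proof -
          have e: "r \<otimes> y = r \<otimes> u \<oplus> r \<otimes> c \<otimes> g" unfolding y_def using r cR uR gR by (simp add: r_distr m_assoc)
          have ru: "r \<otimes> u \<in> J" using r P(2) J.I_l_closed by blast
          have rcg: "r \<otimes> c \<otimes> g \<in> carrier R" using r cR gR by simp
          have "r \<otimes> c \<otimes> g = r \<otimes> y \<ominus> r \<otimes> u"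
            unfolding e using ru rcg J.Icarr[OF ru] by algebra
          then have "r \<otimes> y \<in> J \<longleftrightarrow> r \<otimes> c \<otimes> g \<in> J"
            using e ru J.a_closed ideal_minus_closed[OF J(1)] by metis
          moreover have "r \<otimes> c \<in> carrier R" using r cR by simp
          ultimately show ?thesis unfolding Q_def by blast
        qed
        have one: "\<one> \<in> carrier R - P" using P.I_notcarr P.one_imp_carrier by blast
        then have "y \<notin> J" using False yR by (metis l_one)
        then have "c \<notin> Q" using J_iff[of \<one>] P(3) yR by simp
        have "r \<in> P \<longleftrightarrow> r \<in> Q" if r: "r \<in> carrier R" for r
        proof -
          have "r \<in> P \<longleftrightarrow> r \<otimes> y \<in> J" 
          proof
            assume "r \<in> P"
            then have "r \<otimes> y = \<zero>" unfolding Py by blast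
            then show "r \<otimes> y \<in> J" by simp
          qed (use False r in blast)
          also have "\<dots> \<longleftrightarrow> r \<in> Q" using J_iff[OF r] \<open>c \<notin> Q\<close> Q.I_prime[of r c] P(3) r Q.I_r_closed by blast
          finally show ?thesis .
        qed
        then have "P = Q" using P.Icarr Q.Icarr by blast
        then show ?thesis by simp
      qed
    qed
    then have "finite (AP ?J')" using J(2) finite_subset by blast
    moreover have "ideal ?J' R" using sum_principal_ideal J g by blast
    moreover have "J \<subseteq> ?J'" by (rule subset_sum_principal) (use g J.Icarr in auto)
    ultimately have "?J' = J" using max by blast
    moreover have "g \<in> ?J'" by (rule generator_in_sum_principal) (use J g in auto)
    ultimately show False using g by blast
  qed
  then have "Ass R (ring_module R) \<subseteq> AP J"
    by (auto simp: Ass_def AP_def annihilator_def ring_module_def)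
  then show ?thesis using J finite_subset by blast
qed

section \<open>Localisation at a prime, expressed by saturated ideals\<close>

text \<open>The preimage in \<open>R\<close> of the ideal that \<open>U\<close> generates in the localisation at \<open>Q\<close>.\<close>

definition saturation :: "('a, 'c) ring_scheme \<Rightarrow> 'a set \<Rightarrow> 'a set \<Rightarrow> 'a set" where
  "saturation R Q U = {r \<in> carrier R. \<exists>t\<in>carrier R - Q. t \<otimes>\<^bsub>R\<^esub> r \<in> U}"

lemma saturationI: "r \<in> carrier R \<Longrightarrow> t \<in> carrier R - Q \<Longrightarrow> t \<otimes>\<^bsub>R\<^esub> r \<in> U \<Longrightarrow> r \<in> saturation R Q U"
  by (auto simp: saturation_def)

lemma saturationE:
  assumes "r \<in> saturation R Q U"
  obtains t where "r \<in> carrier R" "t \<in> carrier R" "t \<notin> Q" "t \<otimes>\<^bsub>R\<^esub> r \<in> U"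
  using assms by (auto simp: saturation_def)

lemma (in cring) saturation_ideal:
  assumes "primeideal Q R" "ideal U R"
  shows "ideal (saturation R Q U) R"
proof -
  interpret Q: primeideal Q R by fact
  interpret U: ideal U R by fact
  have one: "\<one> \<in> carrier R - Q" using Q.I_notcarr Q.one_imp_carrier by blast
  show ?thesis
  proof (rule ideal_cringI)
    show "\<zero> \<in> saturation R Q U" using one by (intro saturationI[of _ _ \<one>]) auto
  next
    fix a b assume "a \<in> saturation R Q U" "b \<in> saturation R Q U"
    then obtain s t where *: "a \<in> carrier R" "s \<in> carrier R" "s \<notin> Q" "s \<otimes> a \<in> U"
      "b \<in> carrier R" "t \<in> carrier R" "t \<notin> Q" "t \<otimes> b \<in> U" by (elim saturationE)
    have "(s \<otimes> t) \<otimes> (a \<oplus> b) = t \<otimes> (s \<otimes> a) \<oplus> s \<otimes> (t \<otimes> b)" using * by algebra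
    then have "(s \<otimes> t) \<otimes> (a \<oplus> b) \<in> U" using * U.I_l_closed by simp
    moreover have "s \<otimes> t \<in> carrier R - Q" using * Q.I_prime by blast
    ultimately show "a \<oplus> b \<in> saturation R Q U" using * by (intro saturationI[of _ _ "s \<otimes> t"]) auto
  next
    fix a r assume "a \<in> saturation R Q U" and r: "r \<in> carrier R"
    then obtain s where *: "a \<in> carrier R" "s \<in> carrier R" "s \<notin> Q" "s \<otimes> a \<in> U" by (elim saturationE)
    have "s \<otimes> (r \<otimes> a) = r \<otimes> (s \<otimes> a)" using * r by algebra
    then have "s \<otimes> (r \<otimes> a) \<in> U" using * U.I_l_closed r by simp
    then show "r \<otimes> a \<in> saturation R Q U" using * r by (intro saturationI[of _ _ s]) auto
  qed (auto simp: saturation_def)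
qed

lemma (in cring) subset_saturation:
  assumes "primeideal Q R" "U \<subseteq> carrier R"
  shows "U \<subseteq> saturation R Q U"
proof -
  interpret Q: primeideal Q R by fact
  have one: "\<one> \<in> carrier R - Q" using Q.I_notcarr Q.one_imp_carrier by blast
  then show ?thesis using assms(2) by (auto intro!: saturationI[OF _ one])
qed

lemma (in cring) saturation_saturated:
  assumes "primeideal Q R" "t \<in> carrier R - Q" "r \<in> carrier R" "t \<otimes> r \<in> saturation R Q U"
  shows "r \<in> saturation R Q U"
proof -
  interpret Q: primeideal Q R by fact
  from assms(4) obtain s where s: "s \<in> carrier R" "s \<notin> Q" "s \<otimes> (t \<otimes> r) \<in> U" by (elim saturationE)
  then have "(s \<otimes> t) \<otimes> r \<in> U" using assms by (simp add: m_assoc)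
  moreover have "s \<otimes> t \<in> carrier R - Q" using s assms Q.I_prime by blast
  ultimately show ?thesis using assms saturationI by metis
qed

lemma saturation_mono: "U \<subseteq> V \<Longrightarrow> saturation R Q U \<subseteq> saturation R Q V"
  by (auto simp: saturation_def)

text \<open>W is the kernel of R \<rightarrow> \<open>R_Q\<close>, and the prime is an associated
  prime T = (W : g) of R/W. It lies in Q since W is closed under division by elements outside Q. It
  misses x because t(xg) = 0 forces tg = 0, which for t \<notin> Q would put g into W.\<close>

lemma (in noetherian_cring) prime_below_nonzerodivisor:
  assumes Q: "primeideal Q R" and x: "nonzerodivisor R x" "x \<in> Q"
  obtains P where "primeideal P R" "P \<subset> Q"
proof -
  interpret Q: primeideal Q R by fact
  let ?W = "saturation R Q {\<zero>}"
  have xR: "x \<in> carrier R" and nzd: "\<And>r. r \<in> carrier R \<Longrightarrow> x \<otimes> r = \<zero> \<Longrightarrow> r = \<zero>"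
    using x by (auto simp: nonzerodivisor_def)
  have W: "ideal ?W R" by (rule saturation_ideal[OF Q zeroideal])
  have "\<one> \<notin> ?W" using Q.zero_closed by (auto simp: saturation_def)
  then have "?W \<noteq> carrier R" by auto
  then obtain g where g: "g \<in> carrier R - ?W" and T: "primeideal {r \<in> carrier R. r \<otimes> g \<in> ?W} R"
    using associated_prime_exists[OF W] by blast
  let ?T = "{r \<in> carrier R. r \<otimes> g \<in> ?W}"
  have "?T \<subseteq> Q" using g saturation_saturated[OF Q, of _ g "{\<zero>}"] by blast
  moreover have "x \<notin> ?T"
  proof
    assume "x \<in> ?T"
    then obtain t where t: "t \<in> carrier R" "t \<notin> Q" "t \<otimes> (x \<otimes> g) = \<zero>" by (auto elim: saturationE)
    then have "x \<otimes> (t \<otimes> g) = \<zero>" using xR g by (simp add: m_lcomm)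
    then have "t \<otimes> g = \<zero>" using nzd t g by blast
    then show False using g t by (auto simp: saturation_def)
  qed
  ultimately show ?thesis using that[OF T] x by blast
qed

lemma (in noetherian_ring) maximalideal_above:
  assumes "ideal I R" "I \<noteq> carrier R"
  obtains M where "maximalideal M R" "I \<subseteq> M"
proof -
  let ?p = "\<lambda>J. ideal J R \<and> I \<subseteq> J \<and> J \<noteq> carrier R"
  obtain M where M: "?p M" and max: "\<And>J. ?p J \<Longrightarrow> M \<subseteq> J \<Longrightarrow> J = M"
    by (rule maximal_ideal_such_that[of ?p I]) (use assms in auto)
  have "maximalideal M R"
  proof (rule maximalidealI)
    fix J assume J: "ideal J R" "M \<subseteq> J" "J \<subseteq> carrier R"
    show "J = M \<or> J = carrier R"
      using max[of J] J M by (cases "J = carrier R") auto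
  qed (use M in auto)
  with M that show ?thesis by blast
qed


section \<open>Krull's principal ideal theorem\<close>

text \<open>The local ring at a prime \<open>M\<close> that is minimal over \<open>a\<close> is artinian modulo \<open>a\<close>; ideals
  of the localisation appear as ideals of \<open>R\<close> that are saturated with respect to \<open>M\<close>.\<close>

lemma (in noetherian_cring) saturated_chain_stabilizes:
  assumes M: "primeideal M R" and a: "ideal a R"
    and min: "\<And>T. primeideal T R \<Longrightarrow> a \<subseteq> T \<Longrightarrow> T \<subseteq> M \<Longrightarrow> T = M"
    and J: "\<And>n. ideal (J n) R" "\<And>n. a \<subseteq> J n" "antimono J"
      "\<And>n s r. s \<in> carrier R - M \<Longrightarrow> r \<in> carrier R \<Longrightarrow> s \<otimes> r \<in> J n \<Longrightarrow> r \<in> J n"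
  obtains n :: nat where "J (Suc n) = J n"
proof -
  interpret M: primeideal M R by fact
  \<comment> \<open>The induction runs over ideals U containing a such that the chain of the J n
    \<inter> U becomes stationary; a itself qualifies, as it lies in every J n. Once the saturation
    of a maximal such U is the whole ring, the chain itself is stationary.\<close>
  define P where "P U \<longleftrightarrow> ideal U R \<and> a \<subseteq> U \<and> (\<exists>n. \<forall>k\<ge>n. J n \<inter> U \<subseteq> J k)" for U
  have JR: "J n \<subseteq> carrier R" for n using ideal.Icarr[OF J(1)] by blast
  have Jmono: "J k \<subseteq> J n" if "n \<le> k" for n k using J(3) that by (rule antimonoD)
  have "P a" unfolding P_def using a J(2) by blast
  then obtain U where U: "P U" and max: "\<And>V. P V \<Longrightarrow> U \<subseteq> V \<Longrightarrow> V = U"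
    by (rule maximal_ideal_such_that) (auto simp: P_def)
  then have Ui: "ideal U R" and aU: "a \<subseteq> U" by (auto simp: P_def)
  from U obtain n where n: "\<And>k. k \<ge> n \<Longrightarrow> J n \<inter> U \<subseteq> J k" by (auto simp: P_def)
  interpret U: ideal U R by fact
  let ?S = "saturation R M U"
  interpret S: ideal ?S R by (rule saturation_ideal[OF M Ui])
  have US: "U \<subseteq> ?S" by (rule subset_saturation[OF M U.a_subset])
  \<comment> \<open>Saturating U costs nothing, because every J k is saturated.\<close>
  have nS: "J n \<inter> ?S \<subseteq> J k" if k: "k \<ge> n" for k
  proof
    fix r assume r: "r \<in> J n \<inter> ?S"
    then obtain t where t: "r \<in> carrier R" "t \<in> carrier R" "t \<notin> M" "t \<otimes> r \<in> U"
      by (blast elim: saturationE)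
    then have "t \<otimes> r \<in> J k" using n[OF k] r ideal.I_l_closed[OF J(1), of r n t] by blast
    then show "r \<in> J k" using J(4) t by blast
  qed
  have "?S = carrier R"
  proof (rule ccontr)
    assume "?S \<noteq> carrier R"
    then obtain g where g: "g \<in> carrier R - ?S" and T: "primeideal {r \<in> carrier R. r \<otimes> g \<in> ?S} R"
      using associated_prime_exists[OF S.is_ideal] by blast
    have gR: "g \<in> carrier R" using g by blast
    \<comment> \<open>The prime (S : g) contains a and lies in M, so minimality of M over a makes it
      M. Hence S + Rg exceeds S, after localising at M, by a simple module only.\<close>
    have "{r \<in> carrier R. r \<otimes> g \<in> ?S} = M"
    proof (rule min[OF T])
      show "a \<subseteq> {r \<in> carrier R. r \<otimes> g \<in> ?S}"
        using aU US U.a_subset S.I_r_closed gR by blast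
      show "{r \<in> carrier R. r \<otimes> g \<in> ?S} \<subseteq> M"
        using saturation_saturated[OF M, of _ g U] g by blast
    qed
    then have Mg: "c \<otimes> g \<in> ?S" if "c \<in> M" for c using that by blast
    let ?V = "{u \<oplus> c \<otimes> g |u c. u \<in> U \<and> c \<in> carrier R}"
    have "\<exists>m. \<forall>k\<ge>m. J m \<inter> ?V \<subseteq> J k"
    \<comment> \<open>Modulo S the ideals J m \<inter> V shrink inside what becomes, at M, a
      one-dimensional space over the residue field. Either one of them falls into S, and
      stationarity is inherited from \<open>nS\<close>, or none with m \<ge> n does, and then each J
      k with k \<ge> n still contains J n \<inter> V.\<close>
    proof (cases "\<exists>m\<ge>n. J m \<inter> ?V \<subseteq> ?S")
      case True
      then obtain m where m: "m \<ge> n" "J m \<inter> ?V \<subseteq> ?S" by blast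
      have "J m \<inter> ?V \<subseteq> J k" if "k \<ge> m" for k
        using m nS[of k] that Jmono[OF m(1)] by fastforce
      then show ?thesis by blast
    next
      case False
      have "J n \<inter> ?V \<subseteq> J k" if k: "k \<ge> n" for k
      proof
        fix r assume "r \<in> J n \<inter> ?V"
        then obtain v e where r: "r \<in> J n" "r = v \<oplus> e \<otimes> g" "v \<in> U" "e \<in> carrier R" by blast
        from False k obtain h where h: "h \<in> J k" "h \<in> ?V" "h \<notin> ?S" by blast
        then obtain u c where uc: "h = u \<oplus> c \<otimes> g" "u \<in> U" "c \<in> carrier R" by blast
        have cM: "c \<notin> M"
        proof
          assume "c \<in> M"
          then have "u \<oplus> c \<otimes> g \<in> ?S" using Mg US uc(2) S.a_closed by blast
          then show False using h(3) uc(1) by simp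
        qed
        have uR: "u \<in> carrier R" and vR: "v \<in> carrier R" using uc r U.Icarr by blast+
        have hJ: "e \<otimes> h \<in> J k" using h(1) r(4) ideal.I_l_closed[OF J(1)] by blast
        have rJ: "c \<otimes> r \<in> J n" using r(1) uc(3) ideal.I_l_closed[OF J(1)] by blast
        \<comment> \<open>Multiplying r and h by each other's coefficient cancels g, so the
          difference lies in U and in J n, hence in J k. This puts cr into J k, and c \<notin> M can
          be divided out.\<close>
        have eq: "c \<otimes> r \<ominus> e \<otimes> h = c \<otimes> v \<ominus> e \<otimes> u"
          unfolding r(2) uc(1) using uR vR uc(3) r(4) gR by algebra
        have "c \<otimes> r \<ominus> e \<otimes> h \<in> J n"
          using rJ hJ Jmono[OF k] ideal_minus_closed[OF J(1)] by blast
        moreover have "c \<otimes> v \<ominus> e \<otimes> u \<in> U"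
          by (rule ideal_minus_closed[OF Ui]; rule U.I_l_closed) (fact r(3) uc(3) uc(2) r(4))+
        ultimately have "c \<otimes> r \<ominus> e \<otimes> h \<in> J k" using n[OF k] eq by auto
        then have "(c \<otimes> r \<ominus> e \<otimes> h) \<oplus> e \<otimes> h \<in> J k"
          using hJ additive_subgroup.a_closed[OF ideal.axioms(1)[OF J(1)]] by blast
        moreover have "(c \<otimes> r \<ominus> e \<otimes> h) \<oplus> e \<otimes> h = c \<otimes> r"
          using subsetD[OF JR rJ] subsetD[OF JR hJ] by algebra
        ultimately have "c \<otimes> r \<in> J k" by simp
        then show "r \<in> J k" using J(4)[of c r k] uc(3) cM r(1) JR by blast
      qed
      then show ?thesis by blast
    qed
    moreover have "ideal ?V R" by (rule sum_principal_ideal[OF Ui gR])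
    moreover have UV: "U \<subseteq> ?V" by (rule subset_sum_principal) (use gR U.Icarr in auto)
    ultimately have "P ?V" using aU by (auto simp: P_def)
    then have "?V = U" using max UV by blast
    moreover have "g \<in> ?V" by (rule generator_in_sum_principal[OF Ui gR])
    ultimately show False using g US by blast
  qed
  then have "J n \<subseteq> J (Suc n)" using nS[of "Suc n"] JR[of n] by auto
  then show ?thesis using that[of n] Jmono[of n "Suc n"] by auto
qed

text \<open>Nakayama's lemma for K/L localised at M: \<open>step\<close> says that K = L + xK there.
  If K \<noteq> L, a maximal saturated ideal H with L \<subseteq> H \<subset> K makes K/H simple
  after localisation, so that xK \<subseteq> H; then \<open>step\<close> gives K \<subseteq> H, a
  contradiction.\<close>

lemma (in noetherian_cring) saturated_nakayama:
  assumes M: "primeideal M R" and x: "x \<in> M"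
    and K: "ideal K R" and L: "ideal L R" "L \<subseteq> K"
    and satK: "\<And>s r. s \<in> carrier R - M \<Longrightarrow> r \<in> carrier R \<Longrightarrow> s \<otimes> r \<in> K \<Longrightarrow> r \<in> K"
    and satL: "\<And>s r. s \<in> carrier R - M \<Longrightarrow> r \<in> carrier R \<Longrightarrow> s \<otimes> r \<in> L \<Longrightarrow> r \<in> L"
    and step: "\<And>r. r \<in> K \<Longrightarrow> \<exists>s\<in>carrier R - M. \<exists>l\<in>L. \<exists>c\<in>K. s \<otimes> r = l \<oplus> x \<otimes> c"
  shows "K = L"
proof (rule ccontr)
  assume "K \<noteq> L"
  interpret M: primeideal M R by fact
  interpret K: ideal K R by fact
  define P where "P H \<longleftrightarrow> ideal H R \<and> L \<subseteq> H \<and> H \<subset> K \<and>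
    (\<forall>s\<in>carrier R - M. \<forall>r\<in>carrier R. s \<otimes> r \<in> H \<longrightarrow> r \<in> H)" for H
  have "P L" using L satL \<open>K \<noteq> L\<close> by (auto simp: P_def)
  then obtain H where PH: "P H" and max: "\<And>V. P V \<Longrightarrow> H \<subseteq> V \<Longrightarrow> V = H"
    by (rule maximal_ideal_such_that) (auto simp: P_def)
  from PH have H: "ideal H R" "L \<subseteq> H" "H \<subset> K"
    and Hsat: "\<And>s r. s \<in> carrier R - M \<Longrightarrow> r \<in> carrier R \<Longrightarrow> s \<otimes> r \<in> H \<Longrightarrow> r \<in> H"
    by (auto simp: P_def)
  interpret H: ideal H R by fact
  have xR: "x \<in> carrier R" using x M.Icarr by blast
  have xH: "x \<otimes> k \<in> H" if k: "k \<in> K" for k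
  proof (rule ccontr)
    assume xk: "x \<otimes> k \<notin> H"
    have kR: "k \<in> carrier R" using k K.Icarr by blast
    have xkR: "x \<otimes> k \<in> carrier R" using xR kR by simp
    let ?V = "{u \<oplus> c \<otimes> (x \<otimes> k) |u c. u \<in> H \<and> c \<in> carrier R}"
    have V: "ideal ?V R" by (rule sum_principal_ideal[OF H(1) xkR])
    let ?W = "saturation R M ?V \<inter> K"
    have W: "ideal ?W R" by (rule i_intersect[OF saturation_ideal[OF M V] K])
    have VW: "?V \<subseteq> saturation R M ?V" by (rule subset_saturation[OF M]) (use ideal.Icarr[OF V] in blast)
    have "H \<subseteq> ?V" by (rule subset_sum_principal) (use xkR H.Icarr in auto)
    then have HW: "H \<subseteq> ?W" using VW H(3) by blast
    have "x \<otimes> k \<in> ?V" by (rule generator_in_sum_principal[OF H(1) xkR])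
    then have xkW: "x \<otimes> k \<in> ?W" using VW k xR K.I_l_closed by blast
    \<comment> \<open>By maximality of H, adjoining xk and saturating recovers all of K, in
      particular k itself.\<close>
    have "?W = K"
    proof (rule ccontr)
      assume "?W \<noteq> K"
      have "r \<in> ?W" if s: "s \<in> carrier R - M" "r \<in> carrier R" "s \<otimes> r \<in> ?W" for s r
        using saturation_saturated[OF M s(1,2)] satK[OF s(1,2)] s(3) by blast
      then have "P ?W" using W H HW \<open>?W \<noteq> K\<close> unfolding P_def by blast
      then show False using max HW xk xkW by blast
    qed
    then have "k \<in> saturation R M ?V" using k by blast
    then obtain t where t: "t \<in> carrier R" "t \<notin> M" "t \<otimes> k \<in> ?V" by (elim saturationE) blast
    then obtain u c where uc: "t \<otimes> k = u \<oplus> c \<otimes> (x \<otimes> k)" "u \<in> H" "c \<in> carrier R" by blast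
    have uR: "u \<in> carrier R" using uc H.Icarr by blast
    have "(t \<ominus> c \<otimes> x) \<otimes> k = t \<otimes> k \<ominus> c \<otimes> (x \<otimes> k)" using t uc(3) xR kR by algebra
    also have "\<dots> = u" unfolding uc(1) using uR uc(3) xkR by algebra
    finally have "(t \<ominus> c \<otimes> x) \<otimes> k \<in> H" using uc by simp
    \<comment> \<open>In the local ring at M this element is the unit t(1 - cx/t), since t is
      outside M while x is in M.\<close>
    moreover have "t \<ominus> c \<otimes> x \<notin> M"
    proof
      assume "t \<ominus> c \<otimes> x \<in> M"
      then have "(t \<ominus> c \<otimes> x) \<oplus> c \<otimes> x \<in> M" using M.I_l_closed[OF x uc(3)] M.a_closed by blast
      moreover have "(t \<ominus> c \<otimes> x) \<oplus> c \<otimes> x = t" using t uc(3) xR by algebra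
      ultimately show False using t by simp
    qed
    ultimately have "k \<in> H" using Hsat[of "t \<ominus> c \<otimes> x" k] t(1) uc(3) xR kR by blast
    then show False using xk H.I_l_closed xR by blast
  qed
  have "K \<subseteq> H"
  proof
    fix r assume r: "r \<in> K"
    then obtain s l c where *: "s \<in> carrier R - M" "l \<in> L" "c \<in> K" "s \<otimes> r = l \<oplus> x \<otimes> c"
      using step by blast
    then have "s \<otimes> r \<in> H" using xH H(2) H.a_closed by auto
    then show "r \<in> H" using Hsat * r K.Icarr by blast
  qed
  then show False using H by blast
qed

text \<open>The principal ideal theorem for the domain R/P, in contrapositive form. If no such T
  exists, M is minimal over P + xR, and P \<subset> Q \<subset> M is then refuted by the symbolic
  power argument. Instead of powers of Q, only those of one y \<in> Q - P are used: two consecutive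
  ideals P + (y^n), saturated at Q, turn out to coincide, which is absurd in the localisation of R/P
  at Q, where y is a nonzero non-unit of a domain.\<close>

lemma (in noetherian_cring) krull_principal_ideal:
  assumes P: "primeideal P R" and Q: "primeideal Q R" and M: "primeideal M R"
    and PQ: "P \<subset> Q" and QM: "Q \<subseteq> M" and x: "x \<in> M" "x \<notin> Q"
  obtains T where "primeideal T R" "P \<subset> T" "x \<in> T" "T \<subset> M"
proof (rule ccontr)
  assume no: "\<not> thesis"
  note thesis = that
  interpret P: primeideal P R by fact
  interpret Q: primeideal Q R by fact
  interpret M: primeideal M R by fact
  have xR: "x \<in> carrier R" using x M.Icarr by blast
  have min: "T = M" if T: "primeideal T R" "P \<subseteq> T" "x \<in> T" "T \<subseteq> M" for T
  proof (rule ccontr)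
    assume "T \<noteq> M"
    moreover have "P \<noteq> T" using T x PQ by blast
    ultimately show False using thesis T no by blast
  qed
  obtain y where y: "y \<in> Q" "y \<notin> P" using PQ by blast
  have yR: "y \<in> carrier R" using y Q.Icarr by blast
  define B where "B n = {u \<oplus> c \<otimes> (y [^] n) |u c. u \<in> P \<and> c \<in> carrier R}" for n :: nat
  have B: "ideal (B n) R" for n
    unfolding B_def by (rule sum_principal_ideal[OF P.is_ideal]) (use yR in simp)
  have BR: "B n \<subseteq> carrier R" for n using ideal.Icarr[OF B] by blast
  have Bmono: "B (Suc n) \<subseteq> B n" for n
  proof
    fix r assume "r \<in> B (Suc n)"
    then obtain u c where "r = u \<oplus> c \<otimes> (y [^] Suc n)" "u \<in> P" "c \<in> carrier R"
      by (auto simp: B_def)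
    then have "r = u \<oplus> (c \<otimes> y) \<otimes> (y [^] n)" "u \<in> P" "c \<otimes> y \<in> carrier R"
      using yR by (simp_all add: m_assoc nat_pow_comm m_comm[of y])
    then show "r \<in> B n" unfolding B_def by blast
  qed
  have PB: "P \<subseteq> B n" for n
    unfolding B_def by (rule subset_sum_principal) (use yR P.Icarr in auto)
  \<comment> \<open>These play the role of the symbolic powers of \<open>Q\<close>; dividing by \<open>x \<notin> Q\<close> preserves them.\<close>
  define K where "K n = saturation R Q (B n)" for n
  have K: "ideal (K n) R" for n unfolding K_def by (rule saturation_ideal[OF Q B])
  have KR: "K n \<subseteq> carrier R" for n using ideal.Icarr[OF K] by blast
  have Kmono: "K (Suc n) \<subseteq> K n" for n unfolding K_def by (rule saturation_mono[OF Bmono])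
  have Ksat: "r \<in> K n" if "s \<in> carrier R - Q" "r \<in> carrier R" "s \<otimes> r \<in> K n" for n s r
    using saturation_saturated[OF Q] that unfolding K_def by blast
  define D where "D n = {u \<oplus> c \<otimes> x |u c. u \<in> K n \<and> c \<in> carrier R}" for n
  have D: "ideal (D n) R" for n unfolding D_def by (rule sum_principal_ideal[OF K xR])
  have DR: "D n \<subseteq> carrier R" for n using ideal.Icarr[OF D] by blast
  have Dmono: "D (Suc n) \<subseteq> D n" for n unfolding D_def using Kmono by blast
  have DK: "K n \<subseteq> D n" for n unfolding D_def by (rule subset_sum_principal[OF KR xR])
  define J where "J n = saturation R M (D n)" for n
  have Ji: "ideal (J n) R" for n unfolding J_def by (rule saturation_ideal[OF M D])
  have DJ: "D n \<subseteq> J n" for n unfolding J_def by (rule subset_saturation[OF M DR])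
  have PK: "P \<subseteq> K n" for n unfolding K_def using PB subset_saturation[OF Q BR] by blast
  define a where "a = {u \<oplus> c \<otimes> x |u c. u \<in> P \<and> c \<in> carrier R}"
  have a: "ideal a R" unfolding a_def by (rule sum_principal_ideal[OF P.is_ideal xR])
  have Pa: "P \<subseteq> a" unfolding a_def by (rule subset_sum_principal) (use xR P.Icarr in auto)
  have xa: "x \<in> a" unfolding a_def by (rule generator_in_sum_principal[OF P.is_ideal xR])
  \<comment> \<open>M is minimal over a = P + xR, so two consecutive ideals among the K n + xR,
    saturated at M, coincide.\<close>
  obtain n where n: "J (Suc n) = J n"
  proof (rule saturated_chain_stabilizes[OF M a])
    show "T = M" if "primeideal T R" "a \<subseteq> T" "T \<subseteq> M" for T
      using min[OF that(1)] that Pa xa by blast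
    show "ideal (J n) R" for n by (rule Ji)
    show "a \<subseteq> J n" for n
    proof -
      have "a \<subseteq> D n" unfolding a_def D_def using PK by blast
      then show ?thesis using DJ by blast
    qed
    show "antimono J"
      unfolding antimono_iff_le_Suc J_def using saturation_mono[OF Dmono] by blast
    show "r \<in> J n" if "s \<in> carrier R - M" "r \<in> carrier R" "s \<otimes> r \<in> J n" for n s r
      using saturation_saturated[OF M] that unfolding J_def by blast
  qed
  have "K n = K (Suc n)"
  proof (rule saturated_nakayama[OF M x(1) K K Kmono])
    show "r \<in> K n" if "s \<in> carrier R - M" "r \<in> carrier R" "s \<otimes> r \<in> K n" for s r
      using Ksat[of s r n] that QM by blast
    show "r \<in> K (Suc n)" if "s \<in> carrier R - M" "r \<in> carrier R" "s \<otimes> r \<in> K (Suc n)" for s r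
      using Ksat[of s r "Suc n"] that QM by blast
  next
    fix r assume r: "r \<in> K n"
    then have "r \<in> J (Suc n)" using DK DJ n by blast
    then obtain s where s: "s \<in> carrier R" "s \<notin> M" "s \<otimes> r \<in> D (Suc n)"
      unfolding J_def by (elim saturationE)
    then obtain l c where lc: "s \<otimes> r = l \<oplus> c \<otimes> x" "l \<in> K (Suc n)" "c \<in> carrier R"
      unfolding D_def by blast
    have lR: "l \<in> carrier R" using lc KR by blast
    \<comment> \<open>The multiple xc = sr - l lies in K n, and x \<notin> Q can be divided out, so
      c is itself in K n. This turns K n \<subseteq> K (Suc n) + xR, read at M, into the relation
      with xK n that Nakayama's lemma requires.\<close>
    have "x \<otimes> c = s \<otimes> r \<ominus> l" unfolding lc(1) using lR lc(3) xR by algebra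
    moreover have "s \<otimes> r \<ominus> l \<in> K n"
      by (rule ideal_minus_closed[OF K]) (use ideal.I_l_closed[OF K r s(1)] lc(2) Kmono in auto)
    ultimately have "c \<in> K n" using Ksat[of x c n] x(2) xR lc(3) by simp
    moreover have "s \<otimes> r = l \<oplus> x \<otimes> c" using lc xR by (simp add: m_comm)
    ultimately show "\<exists>s\<in>carrier R - M. \<exists>l\<in>K (Suc n). \<exists>c\<in>K n. s \<otimes> r = l \<oplus> x \<otimes> c"
      using s lc(2) by blast
  qed
  moreover have "y [^] n \<in> K n"
  proof -
    have "y [^] n \<in> B n" unfolding B_def by (rule generator_in_sum_principal[OF P.is_ideal]) (use yR in simp)
    then show ?thesis unfolding K_def using subset_saturation[OF Q BR] by blast
  qed
  ultimately obtain t where t: "t \<in> carrier R" "t \<notin> Q" "t \<otimes> y [^] n \<in> B (Suc n)"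
    unfolding K_def by (blast elim: saturationE)
  then obtain u c where uc: "t \<otimes> y [^] n = u \<oplus> c \<otimes> (y [^] Suc n)" "u \<in> P" "c \<in> carrier R"
    by (auto simp: B_def)
  have yn: "y [^] n \<in> carrier R" using yR by simp
  have uR: "u \<in> carrier R" using uc P.Icarr by blast
  \<comment> \<open>From t y^n \<in> P + (y^(n+1)) the element (t - cy) y^n falls into P. No power
    of y is in P, so t - cy is, and since P and y lie in Q this contradicts t \<notin> Q.\<close>
  have "(t \<ominus> c \<otimes> y) \<otimes> y [^] n = t \<otimes> y [^] n \<ominus> c \<otimes> (y [^] n \<otimes> y)"
    using t(1) uc(3) yR yn by algebra
  also have "\<dots> = u" using uc(1) uR uc(3) yR yn by (simp add: minus_eq a_assoc r_neg)
  finally have in_P: "(t \<ominus> c \<otimes> y) \<otimes> y [^] n \<in> P" using uc by simp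
  have "y [^] k \<notin> P" for k :: nat
  proof (induction k)
    case 0
    then show ?case using P.I_notcarr P.one_imp_carrier by auto
  next
    case (Suc k)
    then show ?case using P.I_prime[of "y [^] k" y] yR y by auto
  qed
  then have "t \<ominus> c \<otimes> y \<in> P" using in_P P.I_prime[of "t \<ominus> c \<otimes> y" "y [^] n"] t(1) uc(3) yR by auto
  then have "(t \<ominus> c \<otimes> y) \<oplus> c \<otimes> y \<in> Q"
    using PQ Q.I_l_closed[OF y(1) uc(3)] Q.a_closed by blast
  moreover have "(t \<ominus> c \<otimes> y) \<oplus> c \<otimes> y = t" using t(1) uc(3) yR by algebra
  ultimately show False using t(2) by simp
qed

text \<open>A prime T between P n and P (Suc (Suc n)) that contains x takes the place of P (Suc n);
  repeating this downwards puts x into ever smaller members. In the end P 0, which need not contain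
  x, is given up: a chain of length n + 1 with x at the top yields one of length n with x
  everywhere.\<close>

lemma (in noetherian_cring) prime_chain_through:
  assumes "\<And>i. i \<le> Suc n \<Longrightarrow> primeideal (P i) R" "\<And>i. i < Suc n \<Longrightarrow> P i \<subset> P (Suc i)" "x \<in> P (Suc n)"
  obtains Q :: "nat \<Rightarrow> 'a set" where "\<And>i. i \<le> n \<Longrightarrow> primeideal (Q i) R" "\<And>i. i < n \<Longrightarrow> Q i \<subset> Q (Suc i)"
    "x \<in> Q 0"
proof -
  \<comment> \<open>The clause Q n = P (Suc n) keeps the top member fixed, so that in the induction
    the old top can be put back above the modified chain.\<close>
  have "\<exists>Q :: nat \<Rightarrow> 'a set. (\<forall>i\<le>n. primeideal (Q i) R) \<and> (\<forall>i<n. Q i \<subset> Q (Suc i)) \<and> x \<in> Q 0 \<and> Q n = P (Suc n)"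
    using assms
  proof (induction n arbitrary: P)
    case 0
    then show ?case by (intro exI[of _ "\<lambda>_. P (Suc 0)"]) auto
  next
    case (Suc n)
    obtain T where T: "primeideal T R" "P n \<subset> T" "x \<in> T" "T \<subset> P (Suc (Suc n))"
    proof (cases "x \<in> P (Suc n)")
      case True
      with Suc.prems(1)[of "Suc n"] Suc.prems(2)[of n] Suc.prems(2)[of "Suc n"] that show ?thesis by simp
    next
      case False
      with krull_principal_ideal[of "P n" "P (Suc n)" "P (Suc (Suc n))" x] Suc.prems(1)[of n]
        Suc.prems(1)[of "Suc n"] Suc.prems(1)[of "Suc (Suc n)"] Suc.prems(2)[of n]
        Suc.prems(2)[of "Suc n"] Suc.prems(3) that show ?thesis by auto
    qed
    let ?P = "P(Suc n := T)"
    have "\<exists>Q :: nat \<Rightarrow> 'a set. (\<forall>i\<le>n. primeideal (Q i) R) \<and> (\<forall>i<n. Q i \<subset> Q (Suc i)) \<and> x \<in> Q 0 \<and> Q n = ?P (Suc n)"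
    proof (rule Suc.IH[of ?P])
      show "primeideal (?P i) R" if "i \<le> Suc n" for i using that T Suc.prems(1)[of i] by auto
      show "?P i \<subset> ?P (Suc i)" if "i < Suc n" for i
        using that T Suc.prems(2)[of i] by (cases "i = n") auto
      show "x \<in> ?P (Suc n)" using T by simp
    qed
    then obtain Q where Q: "\<forall>i\<le>n. primeideal (Q i) R" "\<forall>i<n. Q i \<subset> Q (Suc i)" "x \<in> Q 0" "Q n = T"
      by auto
    show ?case
    proof (intro exI[of _ "Q(Suc n := P (Suc (Suc n)))"] conjI allI impI)
      fix i
      show "primeideal ((Q(Suc n := P (Suc (Suc n)))) i) R" if "i \<le> Suc n"
        using that Q(1) Suc.prems(1) by (cases "i = Suc n") auto
      show "(Q(Suc n := P (Suc (Suc n)))) i \<subset> (Q(Suc n := P (Suc (Suc n)))) (Suc i)" if "i < Suc n"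
        using that Q T by (cases "i = n") auto
    qed (use Q in auto)
  qed
  with that show ?thesis by blast
qed


section \<open>Free modules and cohomology\<close>

lemma mod_homI:
  assumes "\<And>x. x \<in> carrier M \<Longrightarrow> f x \<in> carrier N"
    "\<And>x y. x \<in> carrier M \<Longrightarrow> y \<in> carrier M \<Longrightarrow> f (x \<oplus>\<^bsub>M\<^esub> y) = f x \<oplus>\<^bsub>N\<^esub> f y"
    "\<And>a x. a \<in> carrier R \<Longrightarrow> x \<in> carrier M \<Longrightarrow> f (a \<odot>\<^bsub>M\<^esub> x) = a \<odot>\<^bsub>N\<^esub> f x"
  shows "f \<in> mod_hom R M N"
  using assms by (auto simp: mod_hom_def)

lemma mod_homD:
  assumes "f \<in> mod_hom R M N"
  shows "x \<in> carrier M \<Longrightarrow> f x \<in> carrier N"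
    "x \<in> carrier M \<Longrightarrow> y \<in> carrier M \<Longrightarrow> f (x \<oplus>\<^bsub>M\<^esub> y) = f x \<oplus>\<^bsub>N\<^esub> f y"
    "a \<in> carrier R \<Longrightarrow> x \<in> carrier M \<Longrightarrow> f (a \<odot>\<^bsub>M\<^esub> x) = a \<odot>\<^bsub>N\<^esub> f x"
  using assms by (auto simp: mod_hom_def)

lemma mod_hom_zero:
  assumes "module R M" "module R N" "f \<in> mod_hom R M N"
  shows "f \<zero>\<^bsub>M\<^esub> = \<zero>\<^bsub>N\<^esub>"
proof -
  interpret M: module R M by fact
  interpret N: module R N by fact
  show ?thesis
    using mod_homD(3)[OF assms(3), of "\<zero>\<^bsub>R\<^esub>" "\<zero>\<^bsub>M\<^esub>"] mod_homD(1)[OF assms(3), of "\<zero>\<^bsub>M\<^esub>"] by simp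
qed

lemma mod_hom_minus:
  assumes M: "module R M" and N: "module R N" and f: "f \<in> mod_hom R M N"
    and "x \<in> carrier M" "y \<in> carrier M"
  shows "f (x \<ominus>\<^bsub>M\<^esub> y) = f x \<ominus>\<^bsub>N\<^esub> f y"
proof -
  interpret M: module R M by fact
  interpret N: module R N by fact
  have "\<ominus>\<^bsub>M\<^esub> y = (\<ominus>\<^bsub>R\<^esub> \<one>\<^bsub>R\<^esub>) \<odot>\<^bsub>M\<^esub> y" using assms by (simp add: M.smult_l_minus)
  moreover have "(\<ominus>\<^bsub>R\<^esub> \<one>\<^bsub>R\<^esub>) \<odot>\<^bsub>N\<^esub> f y = \<ominus>\<^bsub>N\<^esub> f y"
    using assms mod_homD(1)[OF f] by (simp add: N.smult_l_minus)
  ultimately show ?thesis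
    using assms mod_homD[OF f] by (simp add: a_minus_def)
qed

lemma mod_hom_compose:
  assumes "f \<in> mod_hom R L M" "g \<in> mod_hom R M N"
  shows "(\<lambda>x. g (f x)) \<in> mod_hom R L N"
  using assms by (auto simp: mod_hom_def Pi_iff)

lemma mod_hom_cong:
  assumes "module R M" "f \<in> mod_hom R M N" "\<And>x. x \<in> carrier M \<Longrightarrow> g x = f x"
  shows "g \<in> mod_hom R M N"
proof -
  interpret module R M by fact
  show ?thesis using assms by (auto simp: mod_hom_def Pi_iff)
qed

lemma mod_hom_add:
  assumes N: "module R N" and f: "f \<in> mod_hom R M N" and g: "g \<in> mod_hom R M N"
  shows "(\<lambda>x. f x \<oplus>\<^bsub>N\<^esub> g x) \<in> mod_hom R M N"
proof -
  interpret N: module R N by fact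
  show ?thesis
    by (rule mod_homI) (simp_all add: mod_homD[OF f] mod_homD[OF g] N.smult_r_distr N.M.a_ac)
qed

lemma mod_hom_smult:
  assumes N: "module R N" and f: "f \<in> mod_hom R M N" and a: "a \<in> carrier R"
  shows "(\<lambda>x. a \<odot>\<^bsub>N\<^esub> f x) \<in> mod_hom R M N"
proof -
  interpret N: module R N by fact
  show ?thesis
    by (rule mod_homI)
      (simp_all add: mod_homD[OF f] a N.smult_r_distr N.R.m_comm flip: N.smult_assoc1)
qed

lemma mod_hom_diff:
  assumes N: "module R N" and f: "f \<in> mod_hom R M N" and g: "g \<in> mod_hom R M N"
  shows "(\<lambda>x. f x \<ominus>\<^bsub>N\<^esub> g x) \<in> mod_hom R M N"
proof -
  interpret N: module R N by fact
  show ?thesis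
    by (rule mod_homI)
      (simp_all add: mod_homD[OF f] mod_homD[OF g] N.smult_r_distr N.M.a_ac a_minus_def
        N.M.minus_add N.smult_r_minus)
qed

lemma mod_hom_id: "(\<lambda>x. x) \<in> mod_hom R M M"
  by (auto simp: mod_hom_def)

section \<open>Free modules: bases and projectivity\<close>

definition unit_vector :: "('a, 'c) ring_scheme \<Rightarrow> 'b \<Rightarrow> 'b \<Rightarrow> 'a" where
  "unit_vector R b = (\<lambda>c. if c = b then \<one>\<^bsub>R\<^esub> else \<zero>\<^bsub>R\<^esub>)"

lemma (in cring) unit_vector_closed: "b \<in> B \<Longrightarrow> unit_vector R b \<in> carrier (free_module R B)"
  by (auto simp: unit_vector_def free_module_def)

text \<open>Induction on the support: one coordinate at a time is split off as a multiple of a unit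
  vector.\<close>

lemma free_module_hom_eq:
  assumes M: "module R M" and f: "f \<in> mod_hom R (free_module R B) M"
    and g: "g \<in> mod_hom R (free_module R B) M"
    and eq: "\<And>b. b \<in> B \<Longrightarrow> f (unit_vector R b) = g (unit_vector R b)"
    and y: "y \<in> carrier (free_module R B)"
  shows "f y = g y"
proof -
  interpret M: module R M by fact
  interpret F: module R "free_module R B" by (rule free_module_is_module[OF M.R.is_cring])
  have "finite S \<Longrightarrow> y \<in> carrier (free_module R B) \<Longrightarrow> {b \<in> B. y b \<noteq> \<zero>\<^bsub>R\<^esub>} = S \<Longrightarrow> f y = g y" for S y
  proof (induction S arbitrary: y rule: finite_induct)
    case empty
    then have "y = \<zero>\<^bsub>free_module R B\<^esub>" by (auto simp: free_module_def)
    then show ?case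
      using mod_hom_zero[OF F.module_axioms M f] mod_hom_zero[OF F.module_axioms M g] by simp
  next
    case (insert b S)
    define z where "z = y(b := \<zero>\<^bsub>R\<^esub>)"
    have b: "b \<in> B" and yb: "y b \<in> carrier R" using insert by (auto simp: free_module_def)
    have supp: "{c \<in> B. z c \<noteq> \<zero>\<^bsub>R\<^esub>} = S" using insert(2,5) by (auto simp: z_def)
    have z: "z \<in> carrier (free_module R B)"
      using insert(4) supp insert(1) by (auto simp: free_module_def z_def)
    have yR: "y c \<in> carrier R" for c using insert(4) by (cases "c \<in> B") (auto simp: free_module_def)
    have e: "unit_vector R b \<in> carrier (free_module R B)" using b by (rule M.R.unit_vector_closed)
    have dec: "y = z \<oplus>\<^bsub>free_module R B\<^esub> (y b \<odot>\<^bsub>free_module R B\<^esub> unit_vector R b)"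
      using yR by (auto simp: free_module_def unit_vector_def z_def)
    have "h y = h z \<oplus>\<^bsub>M\<^esub> y b \<odot>\<^bsub>M\<^esub> h (unit_vector R b)" if h: "h \<in> mod_hom R (free_module R B) M" for h
      by (subst dec) (use z e yb mod_homD[OF h] in simp)
    from this[OF f] this[OF g] show ?case using eq[OF b] insert.IH[OF z supp] by simp
  qed
  moreover have "finite {b \<in> B. y b \<noteq> \<zero>\<^bsub>R\<^esub>}" using y by (simp add: free_module_def)
  ultimately show ?thesis using y by blast
qed

text \<open>The sum formula covers every finite T that contains the support. Sums for two vectors
  can thus be taken over a common index set, and a finite basis may be summed over as a
  whole.\<close>

lemma free_module_universal:
  assumes M: "module R M" and q: "\<And>b. b \<in> B \<Longrightarrow> q b \<in> carrier M"
  obtains \<phi> where "\<phi> \<in> mod_hom R (free_module R B) M" "\<And>b. b \<in> B \<Longrightarrow> \<phi> (unit_vector R b) = q b"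
    "\<And>f T. f \<in> carrier (free_module R B) \<Longrightarrow> finite T \<Longrightarrow> T \<subseteq> B \<Longrightarrow> (\<And>b. b \<notin> T \<Longrightarrow> f b = \<zero>\<^bsub>R\<^esub>) \<Longrightarrow>
      \<phi> f = (\<Oplus>\<^bsub>M\<^esub>b\<in>T. f b \<odot>\<^bsub>M\<^esub> q b)"
proof -
  interpret module R M by fact
  interpret F: module R "free_module R B" by (rule free_module_is_module[OF R.is_cring])
  let ?F = "free_module R B"
  define \<phi> where "\<phi> f = (\<Oplus>\<^bsub>M\<^esub>b\<in>{b \<in> B. f b \<noteq> \<zero>\<^bsub>R\<^esub>}. f b \<odot>\<^bsub>M\<^esub> q b)" for f
  have F: "f b \<in> carrier R" if "f \<in> carrier ?F" for f b
    using that by (cases "b \<in> B") (auto simp: free_module_def)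
  have \<phi>: "\<phi> f = (\<Oplus>\<^bsub>M\<^esub>b\<in>T. f b \<odot>\<^bsub>M\<^esub> q b)"
    if "f \<in> carrier ?F" "finite T" "T \<subseteq> B" "\<And>b. b \<notin> T \<Longrightarrow> f b = \<zero>\<^bsub>R\<^esub>" for f T
    unfolding \<phi>_def
    by (rule M.add.finprod_mono_neutral_cong_left) (use that F[OF that(1)] q in auto)
  have fin: "finite {b \<in> B. f b \<noteq> \<zero>\<^bsub>R\<^esub>}" "\<And>b. b \<notin> {b \<in> B. f b \<noteq> \<zero>\<^bsub>R\<^esub>} \<Longrightarrow> f b = \<zero>\<^bsub>R\<^esub>"
    if "f \<in> carrier ?F" for f
    using that by (auto simp: free_module_def)
  have hom: "\<phi> \<in> mod_hom R ?F M"
  proof (rule mod_homI)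
    fix f assume f: "f \<in> carrier ?F"
    show "\<phi> f \<in> carrier M" unfolding \<phi>_def
      by (rule M.finsum_closed) (use F[OF f] q in auto)
    fix g assume g: "g \<in> carrier ?F"
    let ?T = "{b \<in> B. f b \<noteq> \<zero>\<^bsub>R\<^esub>} \<union> {b \<in> B. g b \<noteq> \<zero>\<^bsub>R\<^esub>}"
    have T: "finite ?T" "?T \<subseteq> B" using fin(1)[OF f] fin(1)[OF g] by auto
    have T0: "f b = \<zero>\<^bsub>R\<^esub>" "g b = \<zero>\<^bsub>R\<^esub>" if "b \<notin> ?T" for b
      using that f g by (auto simp: free_module_def)
    have "\<phi> (f \<oplus>\<^bsub>?F\<^esub> g) = (\<Oplus>\<^bsub>M\<^esub>b\<in>?T. (f \<oplus>\<^bsub>?F\<^esub> g) b \<odot>\<^bsub>M\<^esub> q b)"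
    proof (rule \<phi>[OF F.M.a_closed[OF f g] T])
      show "(f \<oplus>\<^bsub>?F\<^esub> g) b = \<zero>\<^bsub>R\<^esub>" if "b \<notin> ?T" for b
        using T0[OF that] by (simp add: free_module_def)
    qed
    also have "\<dots> = (\<Oplus>\<^bsub>M\<^esub>b\<in>?T. f b \<odot>\<^bsub>M\<^esub> q b \<oplus>\<^bsub>M\<^esub> g b \<odot>\<^bsub>M\<^esub> q b)"
    proof (rule M.finsum_cong')
      show "(f \<oplus>\<^bsub>?F\<^esub> g) b \<odot>\<^bsub>M\<^esub> q b = f b \<odot>\<^bsub>M\<^esub> q b \<oplus>\<^bsub>M\<^esub> g b \<odot>\<^bsub>M\<^esub> q b" if "b \<in> ?T" for b
        using q[of b] T(2) that F[OF f] F[OF g] by (auto simp: free_module_def smult_l_distr)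
    qed (use T q F[OF f] F[OF g] in auto)
    also have "\<dots> = (\<Oplus>\<^bsub>M\<^esub>b\<in>?T. f b \<odot>\<^bsub>M\<^esub> q b) \<oplus>\<^bsub>M\<^esub> (\<Oplus>\<^bsub>M\<^esub>b\<in>?T. g b \<odot>\<^bsub>M\<^esub> q b)"
      by (rule M.finsum_addf) (use T q F[OF f] F[OF g] in auto)
    also have "\<dots> = \<phi> f \<oplus>\<^bsub>M\<^esub> \<phi> g"
      using \<phi>[OF f T T0(1)] \<phi>[OF g T T0(2)] by simp
    finally show "\<phi> (f \<oplus>\<^bsub>?F\<^esub> g) = \<phi> f \<oplus>\<^bsub>M\<^esub> \<phi> g" .
  next
    fix a f assume a: "a \<in> carrier R" and f: "f \<in> carrier ?F"
    let ?T = "{b \<in> B. f b \<noteq> \<zero>\<^bsub>R\<^esub>}"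
    have "\<phi> (a \<odot>\<^bsub>?F\<^esub> f) = (\<Oplus>\<^bsub>M\<^esub>b\<in>?T. (a \<odot>\<^bsub>?F\<^esub> f) b \<odot>\<^bsub>M\<^esub> q b)"
    proof (rule \<phi>[OF F.smult_closed[OF a f] fin(1)[OF f]])
      show "(a \<odot>\<^bsub>?F\<^esub> f) b = \<zero>\<^bsub>R\<^esub>" if "b \<notin> ?T" for b
        using fin(2)[OF f that] a by (simp add: free_module_def)
    qed auto
    also have "\<dots> = (\<Oplus>\<^bsub>M\<^esub>b\<in>?T. a \<odot>\<^bsub>M\<^esub> (f b \<odot>\<^bsub>M\<^esub> q b))"
    proof (rule M.finsum_cong')
      show "(a \<odot>\<^bsub>?F\<^esub> f) b \<odot>\<^bsub>M\<^esub> q b = a \<odot>\<^bsub>M\<^esub> (f b \<odot>\<^bsub>M\<^esub> q b)" if "b \<in> ?T" for b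
        using q[of b] that F[OF f] a by (auto simp: free_module_def smult_assoc1)
    qed (use q F[OF f] a in auto)
    also have "\<dots> = a \<odot>\<^bsub>M\<^esub> \<phi> f" unfolding \<phi>_def
      by (rule finsum_smult_ldistr[symmetric]) (use a fin(1)[OF f] q F[OF f] in auto)
    finally show "\<phi> (a \<odot>\<^bsub>?F\<^esub> f) = a \<odot>\<^bsub>M\<^esub> \<phi> f" .
  qed
  have "\<phi> (unit_vector R b) = q b" if b: "b \<in> B" for b
  proof -
    have "\<phi> (unit_vector R b) = (\<Oplus>\<^bsub>M\<^esub>c\<in>{b}. unit_vector R b c \<odot>\<^bsub>M\<^esub> q c)"
      by (rule \<phi>[OF R.unit_vector_closed[OF b]]) (use b in \<open>auto simp: unit_vector_def\<close>)
    then show ?thesis using q[OF b] by (simp add: unit_vector_def)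
  qed
  with hom \<phi> that show ?thesis by blast
qed

text \<open>Free modules are projective: preimages under d are chosen for the unit vectors only and
  extended linearly.\<close>

lemma free_module_lift:
  assumes M: "module R M" and Q: "module R Q" and g: "g \<in> mod_hom R (free_module R B) M"
    and d: "d \<in> mod_hom R Q M" and im: "\<And>y. y \<in> carrier (free_module R B) \<Longrightarrow> g y \<in> d ` carrier Q"
  obtains h where "h \<in> mod_hom R (free_module R B) Q"
    "\<And>y. y \<in> carrier (free_module R B) \<Longrightarrow> d (h y) = g y"
proof -
  interpret M: module R M by fact
  have "\<exists>u. u \<in> carrier Q \<and> d u = g (unit_vector R b)" if "b \<in> B" for b
    using im[OF M.R.unit_vector_closed[OF that]] by (metis imageE)
  then obtain q where q: "\<And>b. b \<in> B \<Longrightarrow> q b \<in> carrier Q" "\<And>b. b \<in> B \<Longrightarrow> d (q b) = g (unit_vector R b)"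
    by metis
  obtain h where h: "h \<in> mod_hom R (free_module R B) Q" "\<And>b. b \<in> B \<Longrightarrow> h (unit_vector R b) = q b"
    using free_module_universal[where q = q and B = B, OF Q q(1)] by metis
  have "d (h y) = g y" if "y \<in> carrier (free_module R B)" for y
    by (rule free_module_hom_eq[OF M mod_hom_compose[OF h(1) d] g _ that]) (simp add: h(2) q(2))
  with h(1) that show ?thesis by blast
qed

section \<open>Comparison of free resolutions\<close>

lemma free_resolutionD:
  assumes "free_resolution R N B \<delta> \<epsilon>"
  shows "\<epsilon> \<in> mod_hom R (free_module R (B 0)) N"
    "n \<in> carrier N \<Longrightarrow> \<exists>y\<in>carrier (free_module R (B 0)). \<epsilon> y = n"
    "\<delta> i \<in> mod_hom R (free_module R (B (Suc i))) (free_module R (B i))"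
    "y \<in> carrier (free_module R (B (Suc 0))) \<Longrightarrow> \<epsilon> (\<delta> 0 y) = \<zero>\<^bsub>N\<^esub>"
    "y \<in> carrier (free_module R (B (Suc (Suc i)))) \<Longrightarrow> \<delta> i (\<delta> (Suc i) y) = \<zero>\<^bsub>free_module R (B i)\<^esub>"
    "x \<in> carrier (free_module R (B 0)) \<Longrightarrow> \<epsilon> x = \<zero>\<^bsub>N\<^esub> \<Longrightarrow> x \<in> \<delta> 0 ` carrier (free_module R (B (Suc 0)))"
    "x \<in> carrier (free_module R (B (Suc i))) \<Longrightarrow> \<delta> i x = \<zero>\<^bsub>free_module R (B i)\<^esub> \<Longrightarrow>
      x \<in> \<delta> (Suc i) ` carrier (free_module R (B (Suc (Suc i))))"
proof -
  have "\<epsilon> ` carrier (free_module R (B 0)) = carrier N" using assms by (simp add: free_resolution_def)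
  then show "n \<in> carrier N \<Longrightarrow> \<exists>y\<in>carrier (free_module R (B 0)). \<epsilon> y = n" by (metis imageE)
qed (use assms in \<open>unfold free_resolution_def, blast+\<close>)

text \<open>The comparison theorem for the identity of N: exactness of the second resolution and
  projectivity of the terms of the first produce the lifts degree by degree. The label types of the
  two bases may differ.\<close>

lemma resolution_chain_map:
  assumes N: "module R N" and F: "free_resolution R N B \<delta> \<epsilon>" and G: "free_resolution R N C \<gamma> \<eta>"
  obtains \<psi> where "\<And>i. \<psi> i \<in> mod_hom R (free_module R (B i)) (free_module R (C i))"
    "\<And>y. y \<in> carrier (free_module R (B 0)) \<Longrightarrow> \<eta> (\<psi> 0 y) = \<epsilon> y"
    "\<And>i y. y \<in> carrier (free_module R (B (Suc i))) \<Longrightarrow> \<gamma> i (\<psi> (Suc i) y) = \<psi> i (\<delta> i y)"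
proof -
  interpret N: module R N by fact
  note mod = free_module_is_module[OF N.R.is_cring]
  let ?F = "\<lambda>i. free_module R (B i)" and ?G = "\<lambda>i. free_module R (C i)"
  note \<delta> = free_resolutionD(3)[OF F] and \<gamma> = free_resolutionD(3)[OF G]
  \<comment> \<open>The predicate includes solvability of the next lifting problem: f carries
    boundaries to boundaries. The choice in degree i + 1 then depends on that in degree i alone, as
    \<open>dependent_nat_choice\<close> demands.\<close>
  define P where "P i f \<longleftrightarrow> f \<in> mod_hom R (?F i) (?G i) \<and>
    (i = 0 \<longrightarrow> (\<forall>y\<in>carrier (?F 0). \<eta> (f y) = \<epsilon> y)) \<and>
    (\<forall>y\<in>carrier (?F (Suc i)). f (\<delta> i y) \<in> \<gamma> i ` carrier (?G (Suc i)))" for i f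
  define Q where "Q i f g \<longleftrightarrow> (\<forall>y\<in>carrier (?F (Suc i)). \<gamma> i (g y) = f (\<delta> i y))" for i f g
  have "\<exists>\<psi>. \<forall>n. P n (\<psi> n) \<and> Q n (\<psi> n) (\<psi> (Suc n))"
  proof (rule dependent_nat_choice)
    have "\<epsilon> y \<in> \<eta> ` carrier (?G 0)" if "y \<in> carrier (?F 0)" for y
      using free_resolutionD(2)[OF G mod_homD(1)[OF free_resolutionD(1)[OF F] that]] by (metis imageI)
    then obtain f where f: "f \<in> mod_hom R (?F 0) (?G 0)" "\<And>y. y \<in> carrier (?F 0) \<Longrightarrow> \<eta> (f y) = \<epsilon> y"
      using free_module_lift[OF N mod free_resolutionD(1)[OF F] free_resolutionD(1)[OF G]] by metis
    have "f (\<delta> 0 y) \<in> \<gamma> 0 ` carrier (?G (Suc 0))" if y: "y \<in> carrier (?F (Suc 0))" for y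
      by (rule free_resolutionD(6)[OF G mod_homD(1)[OF f(1) mod_homD(1)[OF \<delta> y]]])
        (simp add: f(2) mod_homD(1)[OF \<delta> y] free_resolutionD(4)[OF F y])
    with f show "\<exists>f. P 0 f" unfolding P_def by blast
  next
    fix f i assume "P i f"
    then have f: "f \<in> mod_hom R (?F i) (?G i)"
      "\<And>y. y \<in> carrier (?F (Suc i)) \<Longrightarrow> f (\<delta> i y) \<in> \<gamma> i ` carrier (?G (Suc i))" by (auto simp: P_def)
    obtain g where g: "g \<in> mod_hom R (?F (Suc i)) (?G (Suc i))"
      "\<And>y. y \<in> carrier (?F (Suc i)) \<Longrightarrow> \<gamma> i (g y) = f (\<delta> i y)"
      using free_module_lift[OF mod mod mod_hom_compose[OF \<delta> f(1)] \<gamma> f(2)] by metis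
    have "g (\<delta> (Suc i) y) \<in> \<gamma> (Suc i) ` carrier (?G (Suc (Suc i)))"
      if y: "y \<in> carrier (?F (Suc (Suc i)))" for y
      by (rule free_resolutionD(7)[OF G mod_homD(1)[OF g(1) mod_homD(1)[OF \<delta> y]]])
        (simp add: g(2)[OF mod_homD(1)[OF \<delta> y]] free_resolutionD(5)[OF F y] mod_hom_zero[OF mod mod f(1)])
    with g show "\<exists>g. P (Suc i) g \<and> Q i f g" unfolding P_def Q_def by blast
  qed
  then obtain \<psi> where "\<And>n. P n (\<psi> n)" "\<And>n. Q n (\<psi> n) (\<psi> (Suc n))" by blast
  then show ?thesis using that[of \<psi>] unfolding P_def Q_def by blast
qed

text \<open>A chain map between free resolutions that covers the zero map is null-homotopic:
  exactness of the second resolution supplies preimages, freeness of the first turns them into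
  homomorphisms. It is applied to id - \<psi>\<phi> and to the difference of two lifts of a
  multiplication map.\<close>

lemma chain_map_null_homotopic:
  assumes N: "module R N" and F: "free_resolution R L B \<delta> \<epsilon>" and G: "free_resolution R N C \<gamma> \<eta>"
    and \<theta>: "\<And>i. \<theta> i \<in> mod_hom R (free_module R (B i)) (free_module R (C i))"
      "\<And>y. y \<in> carrier (free_module R (B 0)) \<Longrightarrow> \<eta> (\<theta> 0 y) = \<zero>\<^bsub>N\<^esub>"
      "\<And>i y. y \<in> carrier (free_module R (B (Suc i))) \<Longrightarrow> \<gamma> i (\<theta> (Suc i) y) = \<theta> i (\<delta> i y)"
  obtains s where "\<And>i. s i \<in> mod_hom R (free_module R (B i)) (free_module R (C (Suc i)))"
    "\<And>y. y \<in> carrier (free_module R (B 0)) \<Longrightarrow> \<theta> 0 y = \<gamma> 0 (s 0 y)"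
    "\<And>i y. y \<in> carrier (free_module R (B (Suc i))) \<Longrightarrow>
      \<theta> (Suc i) y = \<gamma> (Suc i) (s (Suc i) y) \<oplus>\<^bsub>free_module R (C (Suc i))\<^esub> s i (\<delta> i y)"
proof -
  interpret N: module R N by fact
  note mod = free_module_is_module[OF N.R.is_cring]
  let ?F = "\<lambda>i. free_module R (B i)" and ?G = "\<lambda>i. free_module R (C i)"
  note \<delta> = free_resolutionD(3)[OF F] and \<gamma> = free_resolutionD(3)[OF G]
  interpret G: module R "?G i" for i by (rule mod)
  have neg0: "\<ominus>\<^bsub>?G i\<^esub> \<zero>\<^bsub>?G i\<^esub> = \<zero>\<^bsub>?G i\<^esub>" for i by (rule G.M.minus_equality) auto
  \<comment> \<open>Again the invariant makes the next lifting problem solvable: \<theta> -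
    s\<delta> takes values in the cycles, that is, in the image of \<gamma>.\<close>
  define P where "P i f \<longleftrightarrow> f \<in> mod_hom R (?F i) (?G (Suc i)) \<and>
    (i = 0 \<longrightarrow> (\<forall>y\<in>carrier (?F 0). \<theta> 0 y = \<gamma> 0 (f y))) \<and>
    (\<forall>y\<in>carrier (?F (Suc i)). \<theta> (Suc i) y \<ominus>\<^bsub>?G (Suc i)\<^esub> f (\<delta> i y) \<in> \<gamma> (Suc i) ` carrier (?G (Suc (Suc i))))" for i f
  define Q where "Q i f g \<longleftrightarrow> (\<forall>y\<in>carrier (?F (Suc i)).
    \<gamma> (Suc i) (g y) = \<theta> (Suc i) y \<ominus>\<^bsub>?G (Suc i)\<^esub> f (\<delta> i y))" for i f g
  have "\<exists>s. \<forall>n. P n (s n) \<and> Q n (s n) (s (Suc n))"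
  proof (rule dependent_nat_choice)
    have "\<theta> 0 y \<in> \<gamma> 0 ` carrier (?G (Suc 0))" if "y \<in> carrier (?F 0)" for y
      using free_resolutionD(6)[OF G mod_homD(1)[OF \<theta>(1) that]] \<theta>(2)[OF that] by blast
    then obtain f where f: "f \<in> mod_hom R (?F 0) (?G (Suc 0))"
      "\<And>y. y \<in> carrier (?F 0) \<Longrightarrow> \<gamma> 0 (f y) = \<theta> 0 y"
      using free_module_lift[OF mod mod \<theta>(1) \<gamma>] by metis
    have "\<theta> (Suc 0) y \<ominus>\<^bsub>?G (Suc 0)\<^esub> f (\<delta> 0 y) \<in> \<gamma> (Suc 0) ` carrier (?G (Suc (Suc 0)))"
      if y: "y \<in> carrier (?F (Suc 0))" for y
    proof (rule free_resolutionD(7)[OF G])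
      note dy = mod_homD(1)[OF \<delta> y]
      note c = mod_homD(1)[OF \<theta>(1) y] mod_homD(1)[OF f(1) dy]
      show "\<theta> (Suc 0) y \<ominus>\<^bsub>?G (Suc 0)\<^esub> f (\<delta> 0 y) \<in> carrier (?G (Suc 0))" using c by simp
      show "\<gamma> 0 (\<theta> (Suc 0) y \<ominus>\<^bsub>?G (Suc 0)\<^esub> f (\<delta> 0 y)) = \<zero>\<^bsub>?G 0\<^esub>"
        using mod_homD(1)[OF \<theta>(1) dy]
        unfolding mod_hom_minus[OF mod mod \<gamma> c] \<theta>(3)[OF y] f(2)[OF dy] by (simp add: a_minus_def G.M.r_neg)
    qed
    with f show "\<exists>f. P 0 f" unfolding P_def by metis
  next
    fix f i assume "P i f"
    then have f: "f \<in> mod_hom R (?F i) (?G (Suc i))"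
      "\<And>y. y \<in> carrier (?F (Suc i)) \<Longrightarrow> \<theta> (Suc i) y \<ominus>\<^bsub>?G (Suc i)\<^esub> f (\<delta> i y) \<in> \<gamma> (Suc i) ` carrier (?G (Suc (Suc i)))"
      by (auto simp: P_def)
    obtain g where g: "g \<in> mod_hom R (?F (Suc i)) (?G (Suc (Suc i)))"
      "\<And>y. y \<in> carrier (?F (Suc i)) \<Longrightarrow> \<gamma> (Suc i) (g y) = \<theta> (Suc i) y \<ominus>\<^bsub>?G (Suc i)\<^esub> f (\<delta> i y)"
      using free_module_lift[OF mod mod mod_hom_diff[OF mod \<theta>(1) mod_hom_compose[OF \<delta> f(1)]] \<gamma> f(2)] by metis
    have "\<theta> (Suc (Suc i)) y \<ominus>\<^bsub>?G (Suc (Suc i))\<^esub> g (\<delta> (Suc i) y) \<in> \<gamma> (Suc (Suc i)) ` carrier (?G (Suc (Suc (Suc i))))"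
      if y: "y \<in> carrier (?F (Suc (Suc i)))" for y
    proof (rule free_resolutionD(7)[OF G])
      note dy = mod_homD(1)[OF \<delta> y]
      note c = mod_homD(1)[OF \<theta>(1) y] mod_homD(1)[OF g(1) dy]
      show "\<theta> (Suc (Suc i)) y \<ominus>\<^bsub>?G (Suc (Suc i))\<^esub> g (\<delta> (Suc i) y) \<in> carrier (?G (Suc (Suc i)))" using c by simp
      show "\<gamma> (Suc i) (\<theta> (Suc (Suc i)) y \<ominus>\<^bsub>?G (Suc (Suc i))\<^esub> g (\<delta> (Suc i) y)) = \<zero>\<^bsub>?G (Suc i)\<^esub>"
        using mod_homD(1)[OF \<theta>(1) dy]
        unfolding mod_hom_minus[OF mod mod \<gamma> c] \<theta>(3)[OF y] g(2)[OF dy]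
        by (simp add: free_resolutionD(5)[OF F y] mod_hom_zero[OF mod mod f(1)] a_minus_def G.M.r_neg neg0)
    qed
    with g show "\<exists>g. P (Suc i) g \<and> Q i f g" unfolding P_def Q_def by (intro exI[of _ g]) blast
  qed
  then obtain s where s: "\<And>n. P n (s n)" "\<And>n. Q n (s n) (s (Suc n))" by blast
  show ?thesis
  proof (rule that[of s])
    show h: "s i \<in> mod_hom R (?F i) (?G (Suc i))" for i using s(1)[of i] by (simp add: P_def)
    show "\<theta> 0 y = \<gamma> 0 (s 0 y)" if "y \<in> carrier (?F 0)" for y using s(1)[of 0] that by (simp add: P_def)
    show "\<theta> (Suc i) y = \<gamma> (Suc i) (s (Suc i) y) \<oplus>\<^bsub>?G (Suc i)\<^esub> s i (\<delta> i y)"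
      if y: "y \<in> carrier (?F (Suc i))" for i y
    proof -
      have "\<gamma> (Suc i) (s (Suc i) y) = \<theta> (Suc i) y \<ominus>\<^bsub>?G (Suc i)\<^esub> s i (\<delta> i y)"
        using s(2)[of i] y by (simp add: Q_def)
      then show ?thesis
        using mod_homD(1)[OF \<theta>(1) y] mod_homD(1)[OF h mod_homD(1)[OF \<delta> y]]
        by (simp add: a_minus_def G.M.a_assoc G.M.l_neg)
    qed
  qed
qed


section \<open>Annihilators of cohomology classes\<close>

text \<open>The annihilator of the coset of x is (H : x). In this form membership in H replaces
  computation with cosets.\<close>

lemma Ass_quotient_module:
  assumes M: "module R M" and H: "submodule H R M"
  shows "Ass R (quotient_module M H) =
    {P. primeideal P R \<and> (\<exists>x\<in>carrier M. P = {r \<in> carrier R. r \<odot>\<^bsub>M\<^esub> x \<in> H})}"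
proof -
  interpret M: module R M by fact
  note HE = M.submoduleE[OF H]
  interpret H: abelian_subgroup H M
    by (rule abelian_subgroupI3[OF additive_subgroupI M.abelian_group_axioms])
      (rule submodule.axioms(1)[OF H])
  have sm: "r \<odot>\<^bsub>quotient_module M H\<^esub> (H +>\<^bsub>M\<^esub> x) = H +>\<^bsub>M\<^esub> (r \<odot>\<^bsub>M\<^esub> x)"
    if r: "r \<in> carrier R" and x: "x \<in> carrier M" for r x
  proof -
    have "H +>\<^bsub>M\<^esub> (r \<odot>\<^bsub>M\<^esub> y) = H +>\<^bsub>M\<^esub> (r \<odot>\<^bsub>M\<^esub> x)" if "y \<in> H +>\<^bsub>M\<^esub> x" for y
    proof -
      from that obtain h where h: "h \<in> H" "y = h \<oplus>\<^bsub>M\<^esub> x" by (auto simp: a_r_coset_def')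
      then have "r \<odot>\<^bsub>M\<^esub> y = r \<odot>\<^bsub>M\<^esub> h \<oplus>\<^bsub>M\<^esub> r \<odot>\<^bsub>M\<^esub> x" using HE(1) r x by (auto simp: M.smult_r_distr)
      then have "r \<odot>\<^bsub>M\<^esub> y \<in> H +>\<^bsub>M\<^esub> (r \<odot>\<^bsub>M\<^esub> x)"
        using HE(4)[OF r h(1)] by (auto simp: a_r_coset_def')
      from H.a_repr_independence'[OF this] show ?thesis using r x by simp
    qed
    moreover have "H +>\<^bsub>M\<^esub> x \<noteq> {}" using H.a_rcos_self x by blast
    ultimately have "(\<Union>y\<in>H +>\<^bsub>M\<^esub> x. H +>\<^bsub>M\<^esub> (r \<odot>\<^bsub>M\<^esub> y)) = H +>\<^bsub>M\<^esub> (r \<odot>\<^bsub>M\<^esub> x)"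
      by (intro SUP_eq_const)
    then show ?thesis by (simp add: quotient_module_def)
  qed
  have mem: "H +>\<^bsub>M\<^esub> z = H \<longleftrightarrow> z \<in> H" if "z \<in> carrier M" for z
    using H.a_rcos_self[OF that] H.a_rcos_const by blast
  have "\<zero>\<^bsub>quotient_module M H\<^esub> = H" by (simp add: quotient_module_def)
  then have ann: "annihilator R (quotient_module M H) (H +>\<^bsub>M\<^esub> x) = {r \<in> carrier R. r \<odot>\<^bsub>M\<^esub> x \<in> H}"
    if "x \<in> carrier M" for x
    by (simp add: annihilator_def sm mem that cong: conj_cong)
  have "carrier (quotient_module M H) = (\<lambda>x. H +>\<^bsub>M\<^esub> x) ` carrier M"
    by (auto simp: quotient_module_def A_RCOSETS_def' a_r_coset_def')
  then show ?thesis by (auto simp: Ass_def ann)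
qed

lemma Hom_module_is_module:
  fixes M :: "('a, 'm, 'e) module_scheme" and N :: "('a, 'n, 'f) module_scheme"
  assumes M: "module R M" and N: "module R N"
  shows "module R (Hom_module R M N)"
proof -
  interpret M: module R M by fact
  interpret N: module R N by fact
  let ?H = "Hom_module R M N"
  have ext: "restrict f (carrier M) \<in> carrier ?H" if "f \<in> mod_hom R M N" for f
    using mod_hom_cong[OF M that, of "restrict f (carrier M)"] by (simp add: Hom_module_def)
  have hom: "f \<in> mod_hom R M N" if "f \<in> carrier ?H" for f using that by (simp add: Hom_module_def)
  have cl: "f x \<in> carrier N" if "f \<in> carrier ?H" "x \<in> carrier M" for f x
    using mod_homD(1)[OF hom] that by blast
  have eqI: "f = g" if "f \<in> extensional (carrier M)" "g \<in> extensional (carrier M)"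
    "\<And>x. x \<in> carrier M \<Longrightarrow> f x = g x" for f g :: "'m \<Rightarrow> 'n"
    using that by (rule extensionalityI)
  have exH: "f \<in> extensional (carrier M)" if "f \<in> carrier ?H" for f using that by (simp add: Hom_module_def)
  have addH: "f \<oplus>\<^bsub>?H\<^esub> g = (\<lambda>x\<in>carrier M. f x \<oplus>\<^bsub>N\<^esub> g x)" for f g by (simp add: Hom_module_def)
  have smH: "a \<odot>\<^bsub>?H\<^esub> g = (\<lambda>x\<in>carrier M. a \<odot>\<^bsub>N\<^esub> g x)" for a g by (simp add: Hom_module_def)
  have zH: "\<zero>\<^bsub>?H\<^esub> = (\<lambda>x\<in>carrier M. \<zero>\<^bsub>N\<^esub>)" by (simp add: Hom_module_def)
  have z: "(\<lambda>x. \<zero>\<^bsub>N\<^esub>) \<in> mod_hom R M N" by (rule mod_homI) auto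
  have add_cl: "f \<oplus>\<^bsub>?H\<^esub> g \<in> carrier ?H" if "f \<in> carrier ?H" "g \<in> carrier ?H" for f g
    unfolding addH by (rule ext[OF mod_hom_add[OF N hom[OF that(1)] hom[OF that(2)]]])
  have sm_cl: "a \<odot>\<^bsub>?H\<^esub> f \<in> carrier ?H" if "a \<in> carrier R" "f \<in> carrier ?H" for a f
    unfolding smH by (rule ext[OF mod_hom_smult[OF N hom[OF that(2)] that(1)]])
  have z_cl: "\<zero>\<^bsub>?H\<^esub> \<in> carrier ?H" unfolding zH by (rule ext[OF z])
  show ?thesis
  proof (rule moduleI)
    show "abelian_group ?H"
    proof (rule abelian_groupI)
      fix f assume f: "f \<in> carrier ?H"
      show "\<exists>g\<in>carrier ?H. g \<oplus>\<^bsub>?H\<^esub> f = \<zero>\<^bsub>?H\<^esub>"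
      proof (rule bexI[of _ "(\<ominus>\<^bsub>R\<^esub> \<one>\<^bsub>R\<^esub>) \<odot>\<^bsub>?H\<^esub> f"])
        show "(\<ominus>\<^bsub>R\<^esub> \<one>\<^bsub>R\<^esub>) \<odot>\<^bsub>?H\<^esub> f \<oplus>\<^bsub>?H\<^esub> f = \<zero>\<^bsub>?H\<^esub>" unfolding addH smH zH
          by (rule eqI) (auto simp: cl[OF f] N.smult_l_minus N.M.l_neg)
      qed (use f sm_cl in simp)
    qed ((rule add_cl z_cl; assumption?) | (auto simp: addH zH cl exH N.M.a_ac intro!: eqI))+
  qed ((rule sm_cl M.R.is_cring; assumption?) |
      (auto simp: addH smH cl exH N.smult_l_distr N.smult_r_distr N.smult_assoc1 intro!: eqI))+
qed

text \<open>A description of coboundaries that does not require maps to be extensional.\<close>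

definition is_coboundary ::
    "('a, 'c) ring_scheme \<Rightarrow> ('a, 'm, 'e) module_scheme \<Rightarrow> (nat \<Rightarrow> 'b set) \<Rightarrow>
      (nat \<Rightarrow> ('b \<Rightarrow> 'a) \<Rightarrow> ('b \<Rightarrow> 'a)) \<Rightarrow> nat \<Rightarrow> (('b \<Rightarrow> 'a) \<Rightarrow> 'm) \<Rightarrow> bool" where
  "is_coboundary R M B \<delta> i f \<longleftrightarrow> (case i of
     0 \<Rightarrow> \<forall>y\<in>carrier (free_module R (B 0)). f y = \<zero>\<^bsub>M\<^esub>
   | Suc j \<Rightarrow> \<exists>k\<in>mod_hom R (free_module R (B j)) M. \<forall>y\<in>carrier (free_module R (B (Suc j))). f y = k (\<delta> j y))"

lemma is_coboundary_0:
  "is_coboundary R M B \<delta> 0 f \<longleftrightarrow> (\<forall>y\<in>carrier (free_module R (B 0)). f y = \<zero>\<^bsub>M\<^esub>)"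
  by (simp add: is_coboundary_def)

lemma is_coboundary_Suc:
  "is_coboundary R M B \<delta> (Suc j) f \<longleftrightarrow>
    (\<exists>k\<in>mod_hom R (free_module R (B j)) M. \<forall>y\<in>carrier (free_module R (B (Suc j))). f y = k (\<delta> j y))"
  by (simp add: is_coboundary_def)

lemma is_coboundary_cong:
  assumes "\<And>y. y \<in> carrier (free_module R (B i)) \<Longrightarrow> f y = g y"
  shows "is_coboundary R M B \<delta> i f \<longleftrightarrow> is_coboundary R M B \<delta> i g"
  using assms by (auto simp: is_coboundary_def split: nat.split)

lemma is_coboundary_add:
  assumes M: "module R M" and f: "is_coboundary R M B \<delta> i f" and g: "is_coboundary R M B \<delta> i g"
  shows "is_coboundary R M B \<delta> i (\<lambda>y. f y \<oplus>\<^bsub>M\<^esub> g y)"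
proof -
  interpret M: module R M by fact
  show ?thesis
  proof (cases i)
    case 0
    with f g show ?thesis by (simp add: is_coboundary_0)
  next
    case (Suc j)
    with f g obtain k l where "k \<in> mod_hom R (free_module R (B j)) M" "l \<in> mod_hom R (free_module R (B j)) M"
      "\<forall>y\<in>carrier (free_module R (B (Suc j))). f y = k (\<delta> j y)"
      "\<forall>y\<in>carrier (free_module R (B (Suc j))). g y = l (\<delta> j y)" by (auto simp: is_coboundary_Suc)
    then show ?thesis unfolding Suc is_coboundary_Suc
      by (intro bexI[of _ "\<lambda>y. k y \<oplus>\<^bsub>M\<^esub> l y"] mod_hom_add[OF M]) auto
  qed
qed

lemma is_coboundary_smult:
  assumes M: "module R M" and f: "is_coboundary R M B \<delta> i f" and a: "a \<in> carrier R"
  shows "is_coboundary R M B \<delta> i (\<lambda>y. a \<odot>\<^bsub>M\<^esub> f y)"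
proof -
  interpret M: module R M by fact
  show ?thesis
  proof (cases i)
    case 0
    with f a show ?thesis by (simp add: is_coboundary_0)
  next
    case (Suc j)
    with f obtain k where "k \<in> mod_hom R (free_module R (B j)) M"
      "\<forall>y\<in>carrier (free_module R (B (Suc j))). f y = k (\<delta> j y)" by (auto simp: is_coboundary_Suc)
    then show ?thesis unfolding Suc is_coboundary_Suc
      by (intro bexI[of _ "\<lambda>y. a \<odot>\<^bsub>M\<^esub> k y"] mod_hom_smult[OF M _ a]) auto
  qed
qed

text \<open>Restricting a homomorphism to the carrier makes it an element of
  \<open>Hom_module\<close> without changing its composite with \<delta>, which maps into that
  carrier.\<close>

lemma coboundaries_iff:
  assumes M: "module R M" and \<delta>: "\<And>i. \<delta> i \<in> mod_hom R (free_module R (B (Suc i))) (free_module R (B i))"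
  shows "f \<in> coboundaries R M B \<delta> i \<longleftrightarrow>
    f \<in> extensional (carrier (free_module R (B i))) \<and> is_coboundary R M B \<delta> i f"
proof -
  interpret M: module R M by fact
  show ?thesis
  proof (cases i)
    case 0
    have "f = (\<lambda>x\<in>carrier (free_module R (B 0)). \<zero>\<^bsub>M\<^esub>) \<longleftrightarrow>
      f \<in> extensional (carrier (free_module R (B 0))) \<and> (\<forall>y\<in>carrier (free_module R (B 0)). f y = \<zero>\<^bsub>M\<^esub>)"
      by (auto intro!: extensionalityI[of f "carrier (free_module R (B 0))"])
    then show ?thesis unfolding 0 is_coboundary_0 by (simp add: Hom_module_def)
  next
    case (Suc j)
    let ?F = "carrier (free_module R (B j))" and ?F' = "carrier (free_module R (B (Suc j)))"
    have mod: "module R (free_module R (B j))" by (rule free_module_is_module[OF M.R.is_cring])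
    show ?thesis
    proof
      assume "f \<in> coboundaries R M B \<delta> i"
      then show "f \<in> extensional (carrier (free_module R (B i))) \<and> is_coboundary R M B \<delta> i f"
        unfolding Suc is_coboundary_Suc by (auto simp: Hom_module_def)
    next
      assume "f \<in> extensional (carrier (free_module R (B i))) \<and> is_coboundary R M B \<delta> i f"
      then obtain k where f: "f \<in> extensional ?F'" and k: "k \<in> mod_hom R (free_module R (B j)) M"
        "\<And>y. y \<in> ?F' \<Longrightarrow> f y = k (\<delta> j y)" unfolding Suc is_coboundary_Suc by blast
      have "restrict k ?F \<in> carrier (Hom_module R (free_module R (B j)) M)"
        using mod_hom_cong[OF mod k(1), of "restrict k ?F"] by (simp add: Hom_module_def)
      moreover have "f = (\<lambda>x\<in>?F'. restrict k ?F (\<delta> j x))"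
        by (rule extensionalityI[OF f]) (use k(2) mod_homD(1)[OF \<delta>] in auto)
      ultimately show "f \<in> coboundaries R M B \<delta> i"
        unfolding Suc coboundaries.simps by (intro image_eqI[where x = "restrict k ?F"])
    qed
  qed
qed

text \<open>Each class is represented by an ordinary homomorphism f, and r kills it exactly if rf is
  a coboundary. This description, free of \<open>extensional\<close> and of quotient modules, is
  what all later statements on Ass of Ext unfold.\<close>

lemma Ass_cohomology_module:
  fixes M :: "('a, 'm, 'e) module_scheme" and B :: "nat \<Rightarrow> 'b set"
  assumes M: "module R M" and F: "free_resolution R N B \<delta> \<epsilon>"
  shows "Ass R (cohomology_module R M B \<delta> i) = {P. primeideal P R \<and>
    (\<exists>f\<in>mod_hom R (free_module R (B i)) M. (\<forall>y\<in>carrier (free_module R (B (Suc i))). f (\<delta> i y) = \<zero>\<^bsub>M\<^esub>) \<and>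
      P = {r \<in> carrier R. is_coboundary R M B \<delta> i (\<lambda>y. r \<odot>\<^bsub>M\<^esub> f y)})}"
proof -
  interpret M: module R M by fact
  note mod = free_module_is_module[OF M.R.is_cring]
  note \<delta> = free_resolutionD(3)[OF F]
  let ?F = "free_module R (B i)" and ?F' = "free_module R (B (Suc i))"
  let ?H = "Hom_module R ?F M"
  let ?Z = "cocycles R M B \<delta> i" and ?C = "coboundaries R M B \<delta> i"
  interpret H: module R ?H by (rule Hom_module_is_module[OF mod M])
  interpret F: module R ?F by (rule mod)
  have addH: "f \<oplus>\<^bsub>?H\<^esub> g = (\<lambda>x\<in>carrier ?F. f x \<oplus>\<^bsub>M\<^esub> g x)" for f g by (simp add: Hom_module_def)
  have smH: "a \<odot>\<^bsub>?H\<^esub> g = (\<lambda>x\<in>carrier ?F. a \<odot>\<^bsub>M\<^esub> g x)" for a g by (simp add: Hom_module_def)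
  have zH: "\<zero>\<^bsub>?H\<^esub> = (\<lambda>x\<in>carrier ?F. \<zero>\<^bsub>M\<^esub>)" by (simp add: Hom_module_def)
  \<comment> \<open>Closure under negation follows from closure under multiplication by -1.\<close>
  have submodI: "submodule S R L" if L: "module R L" and S: "S \<subseteq> carrier L" "\<zero>\<^bsub>L\<^esub> \<in> S"
    "\<And>a b. a \<in> S \<Longrightarrow> b \<in> S \<Longrightarrow> a \<oplus>\<^bsub>L\<^esub> b \<in> S"
    "\<And>r a. r \<in> carrier R \<Longrightarrow> a \<in> S \<Longrightarrow> r \<odot>\<^bsub>L\<^esub> a \<in> S" for S and L :: "('a, ('b \<Rightarrow> 'a) \<Rightarrow> 'm) module"
  proof -
    interpret L: module R L by (rule L)
    have "\<ominus>\<^bsub>L\<^esub> a \<in> S" if a: "a \<in> S" for a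
    proof -
      have "(\<ominus>\<^bsub>R\<^esub> \<one>\<^bsub>R\<^esub>) \<odot>\<^bsub>L\<^esub> a \<in> S" using S(4) a by simp
      then show ?thesis using S(1) a by (auto simp: L.smult_l_minus)
    qed
    then show ?thesis using S by (intro L.submoduleI)
  qed
  have Zsub: "submodule ?Z R ?H"
  proof (rule submodI[OF H.module_axioms])
    show "\<zero>\<^bsub>?H\<^esub> \<in> ?Z" using H.M.zero_closed mod_homD(1)[OF \<delta>] by (auto simp: cocycles_def zH)
    show "f \<oplus>\<^bsub>?H\<^esub> g \<in> ?Z" if "f \<in> ?Z" "g \<in> ?Z" for f g
      using that H.M.a_closed[of f g] mod_homD(1)[OF \<delta>] by (auto simp: cocycles_def addH)
    show "r \<odot>\<^bsub>?H\<^esub> f \<in> ?Z" if "r \<in> carrier R" "f \<in> ?Z" for r f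
      using that H.smult_closed[of r f] mod_homD(1)[OF \<delta>] by (auto simp: cocycles_def smH)
  qed (auto simp: cocycles_def)
  let ?ZM = "?H\<lparr>carrier := ?Z\<rparr>"
  have ZM: "module R ?ZM" by (rule submodule.submodule_is_module[OF Zsub H.module_axioms])
  have C: "f \<in> ?C \<longleftrightarrow> f \<in> extensional (carrier ?F) \<and> is_coboundary R M B \<delta> i f" for f
    by (rule coboundaries_iff[OF M]) (rule \<delta>)
  have Csub: "submodule ?C R ?ZM"
  proof (rule submodI[OF ZM])
    show "?C \<subseteq> carrier ?ZM"
    proof
      fix f assume "f \<in> ?C"
      then have f: "f \<in> extensional (carrier ?F)" "is_coboundary R M B \<delta> i f" by (simp_all add: C)
      have "f \<in> mod_hom R ?F M \<and> (\<forall>y\<in>carrier ?F'. f (\<delta> i y) = \<zero>\<^bsub>M\<^esub>)"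
      proof (cases i)
        case 0
        then have f0: "f y = \<zero>\<^bsub>M\<^esub>" if "y \<in> carrier ?F" for y using f(2) that by (simp add: is_coboundary_0)
        then have "f \<in> mod_hom R ?F M" by (intro mod_homI) simp_all
        then show ?thesis using f0 mod_homD(1)[OF \<delta>] by blast
      next
        case (Suc j)
        then obtain k where k: "k \<in> mod_hom R (free_module R (B j)) M" "\<And>y. y \<in> carrier ?F \<Longrightarrow> f y = k (\<delta> j y)"
          using f(2) by (auto simp: is_coboundary_Suc)
        have "f \<in> mod_hom R ?F M"
          by (rule mod_hom_cong[OF mod mod_hom_compose[OF _ k(1), of "\<delta> j"] k(2)]) (use \<delta>[of j] Suc in simp)
        moreover have "f (\<delta> i y) = \<zero>\<^bsub>M\<^esub>" if "y \<in> carrier ?F'" for y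
          using k(2)[OF mod_homD(1)[OF \<delta> that]] free_resolutionD(5)[OF F, of y j] that Suc
            mod_hom_zero[OF mod M k(1)] by simp
        ultimately show ?thesis by blast
      qed
      with f(1) show "f \<in> carrier ?ZM" by (simp add: cocycles_def Hom_module_def)
    qed
    have "is_coboundary R M B \<delta> i (\<lambda>y. \<zero>\<^bsub>M\<^esub>)"
    proof (cases i)
      case (Suc j)
      have "(\<lambda>y. \<zero>\<^bsub>M\<^esub>) \<in> mod_hom R (free_module R (B j)) M" by (rule mod_homI) auto
      then show ?thesis unfolding Suc is_coboundary_Suc by (rule rev_bexI) simp
    qed (simp add: is_coboundary_0)
    then show "\<zero>\<^bsub>?ZM\<^esub> \<in> ?C"
      using is_coboundary_cong[of R B i "\<lambda>x\<in>carrier ?F. \<zero>\<^bsub>M\<^esub>" "\<lambda>y. \<zero>\<^bsub>M\<^esub>" M \<delta>] by (simp add: C zH)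
    show "f \<oplus>\<^bsub>?ZM\<^esub> g \<in> ?C" if "f \<in> ?C" "g \<in> ?C" for f g
      using that is_coboundary_add[OF M, of B \<delta> i f g]
        is_coboundary_cong[of R B i "\<lambda>x\<in>carrier ?F. f x \<oplus>\<^bsub>M\<^esub> g x" "\<lambda>y. f y \<oplus>\<^bsub>M\<^esub> g y" M \<delta>] by (simp add: C addH)
    show "r \<odot>\<^bsub>?ZM\<^esub> f \<in> ?C" if "r \<in> carrier R" "f \<in> ?C" for r f
      using that is_coboundary_smult[OF M, of B \<delta> i f r]
        is_coboundary_cong[of R B i "\<lambda>x\<in>carrier ?F. r \<odot>\<^bsub>M\<^esub> f x" "\<lambda>y. r \<odot>\<^bsub>M\<^esub> f y" M \<delta>] by (simp add: C smH)
  qed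
  have ann: "r \<odot>\<^bsub>?ZM\<^esub> f \<in> ?C \<longleftrightarrow> is_coboundary R M B \<delta> i (\<lambda>y. r \<odot>\<^bsub>M\<^esub> f y)" for r f
    using is_coboundary_cong[of R B i "\<lambda>x\<in>carrier ?F. r \<odot>\<^bsub>M\<^esub> f x" "\<lambda>y. r \<odot>\<^bsub>M\<^esub> f y" M \<delta>] by (simp add: C smH)
  show ?thesis
  proof (intro Set.set_eqI iffI)
    fix P assume "P \<in> Ass R (cohomology_module R M B \<delta> i)"
    then obtain f where "primeideal P R" "f \<in> ?Z" "P = {r \<in> carrier R. is_coboundary R M B \<delta> i (\<lambda>y. r \<odot>\<^bsub>M\<^esub> f y)}"
      unfolding cohomology_module_def Ass_quotient_module[OF ZM Csub] ann by auto
    moreover have "f \<in> mod_hom R ?F M \<and> (\<forall>y\<in>carrier ?F'. f (\<delta> i y) = \<zero>\<^bsub>M\<^esub>)"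
      using \<open>f \<in> ?Z\<close> by (simp add: cocycles_def Hom_module_def)
    ultimately show "P \<in> {P. primeideal P R \<and> (\<exists>f\<in>mod_hom R ?F M. (\<forall>y\<in>carrier ?F'. f (\<delta> i y) = \<zero>\<^bsub>M\<^esub>) \<and>
      P = {r \<in> carrier R. is_coboundary R M B \<delta> i (\<lambda>y. r \<odot>\<^bsub>M\<^esub> f y)})}" by blast
  next
    fix P assume "P \<in> {P. primeideal P R \<and> (\<exists>f\<in>mod_hom R ?F M. (\<forall>y\<in>carrier ?F'. f (\<delta> i y) = \<zero>\<^bsub>M\<^esub>) \<and>
      P = {r \<in> carrier R. is_coboundary R M B \<delta> i (\<lambda>y. r \<odot>\<^bsub>M\<^esub> f y)})}"
    then obtain f where f: "primeideal P R" "f \<in> mod_hom R ?F M" "\<And>y. y \<in> carrier ?F' \<Longrightarrow> f (\<delta> i y) = \<zero>\<^bsub>M\<^esub>"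
      "P = {r \<in> carrier R. is_coboundary R M B \<delta> i (\<lambda>y. r \<odot>\<^bsub>M\<^esub> f y)}" by blast
    let ?g = "restrict f (carrier ?F)"
    have "?g \<in> mod_hom R ?F M" by (rule mod_hom_cong[OF mod f(2)]) simp
    then have "?g \<in> ?Z" using f(3) mod_homD(1)[OF \<delta>] by (simp add: cocycles_def Hom_module_def)
    moreover have "P = {r \<in> carrier R. r \<odot>\<^bsub>?ZM\<^esub> ?g \<in> ?C}"
      unfolding ann f(4)
      using is_coboundary_cong[of R B i "\<lambda>y. r \<odot>\<^bsub>M\<^esub> f y" "\<lambda>y. r \<odot>\<^bsub>M\<^esub> ?g y" M \<delta> for r] by simp
    ultimately show "P \<in> Ass R (cohomology_module R M B \<delta> i)"
      unfolding cohomology_module_def Ass_quotient_module[OF ZM Csub] using f(1) by auto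
  qed
qed


section \<open>Independence of the resolution and annihilators of Ext\<close>

text \<open>A cocycle f on the first resolution is pulled back to f\<psi> along a chain map \<psi>
  covering the identity. Both classes have the same annihilator, because \<psi>\<phi> is homotopic
  to the identity for a chain map \<phi> in the other direction. An inclusion is enough, as the two
  resolutions can exchange roles.\<close>

lemma Ass_cohomology_resolution_independent:
  assumes N: "module R N" and M: "module R M"
    and F: "free_resolution R N B \<delta> \<epsilon>" and G: "free_resolution R N C \<gamma> \<eta>"
  shows "Ass R (cohomology_module R M B \<delta> i) \<subseteq> Ass R (cohomology_module R M C \<gamma> i)"
proof
  fix P assume "P \<in> Ass R (cohomology_module R M B \<delta> i)"
  interpret N: module R N by fact
  interpret M: module R M by fact
  note mod = free_module_is_module[OF N.R.is_cring]
  let ?F = "\<lambda>i. free_module R (B i)" and ?G = "\<lambda>i. free_module R (C i)"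
  note \<delta> = free_resolutionD(3)[OF F] and \<gamma> = free_resolutionD(3)[OF G]
  interpret F: module R "?F j" for j by (rule mod)
  from \<open>P \<in> _\<close> have P: "primeideal P R" by (simp add: Ass_def)
  from \<open>P \<in> _\<close> have "\<exists>f\<in>mod_hom R (?F i) M. (\<forall>y\<in>carrier (?F (Suc i)). f (\<delta> i y) = \<zero>\<^bsub>M\<^esub>) \<and>
      P = {r \<in> carrier R. is_coboundary R M B \<delta> i (\<lambda>y. r \<odot>\<^bsub>M\<^esub> f y)}"
    unfolding Ass_cohomology_module[OF M F] by (elim CollectE conjE)
  then obtain f where f: "f \<in> mod_hom R (?F i) M"
    and f': "(\<forall>y\<in>carrier (?F (Suc i)). f (\<delta> i y) = \<zero>\<^bsub>M\<^esub>) \<and>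
      P = {r \<in> carrier R. is_coboundary R M B \<delta> i (\<lambda>y. r \<odot>\<^bsub>M\<^esub> f y)}" by (rule bexE)
  note f0' = conjunct1[OF f'] and Pf = conjunct2[OF f']
  have f0: "f (\<delta> i y) = \<zero>\<^bsub>M\<^esub>" if "y \<in> carrier (?F (Suc i))" for y using f0' that by blast
  obtain \<psi> where \<psi>: "\<And>i. \<psi> i \<in> mod_hom R (?G i) (?F i)"
    "\<And>y. y \<in> carrier (?G 0) \<Longrightarrow> \<epsilon> (\<psi> 0 y) = \<eta> y"
    "\<And>i y. y \<in> carrier (?G (Suc i)) \<Longrightarrow> \<delta> i (\<psi> (Suc i) y) = \<psi> i (\<gamma> i y)"
    using resolution_chain_map[OF N G F] by metis
  obtain \<phi> where \<phi>: "\<And>i. \<phi> i \<in> mod_hom R (?F i) (?G i)"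
    "\<And>y. y \<in> carrier (?F 0) \<Longrightarrow> \<eta> (\<phi> 0 y) = \<epsilon> y"
    "\<And>i y. y \<in> carrier (?F (Suc i)) \<Longrightarrow> \<gamma> i (\<phi> (Suc i) y) = \<phi> i (\<delta> i y)"
    using resolution_chain_map[OF N F G] by metis
  \<comment> \<open>This is id - \<psi>\<phi>, which covers the zero map of N and is therefore
    null-homotopic.\<close>
  define \<theta> where "\<theta> i y = y \<ominus>\<^bsub>?F i\<^esub> \<psi> i (\<phi> i y)" for i y
  note \<psi>\<phi> = mod_hom_compose[OF \<phi>(1) \<psi>(1)]
  have \<theta>: "\<theta> i \<in> mod_hom R (?F i) (?F i)" for i
    unfolding \<theta>_def by (rule mod_hom_diff[OF mod mod_hom_id \<psi>\<phi>])
  have \<theta>0: "\<epsilon> (\<theta> 0 y) = \<zero>\<^bsub>N\<^esub>" if y: "y \<in> carrier (?F 0)" for y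
    unfolding \<theta>_def mod_hom_minus[OF mod N free_resolutionD(1)[OF F] y mod_homD(1)[OF \<psi>\<phi> y]]
      \<psi>(2)[OF mod_homD(1)[OF \<phi>(1) y]] \<phi>(2)[OF y]
    using mod_homD(1)[OF free_resolutionD(1)[OF F] y] by (simp add: a_minus_def N.M.r_neg)
  have \<theta>S: "\<delta> i (\<theta> (Suc i) y) = \<theta> i (\<delta> i y)" if y: "y \<in> carrier (?F (Suc i))" for i y
    unfolding \<theta>_def mod_hom_minus[OF mod mod \<delta> y mod_homD(1)[OF \<psi>\<phi> y]]
      \<psi>(3)[OF mod_homD(1)[OF \<phi>(1) y]] \<phi>(3)[OF y] ..
  obtain s where s: "\<And>i. s i \<in> mod_hom R (?F i) (?F (Suc i))"
    "\<And>y. y \<in> carrier (?F 0) \<Longrightarrow> \<theta> 0 y = \<delta> 0 (s 0 y)"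
    "\<And>i y. y \<in> carrier (?F (Suc i)) \<Longrightarrow> \<theta> (Suc i) y = \<delta> (Suc i) (s (Suc i) y) \<oplus>\<^bsub>?F (Suc i)\<^esub> s i (\<delta> i y)"
    using chain_map_null_homotopic[OF N F F \<theta> \<theta>0 \<theta>S] by metis
  let ?g = "\<lambda>y. f (\<psi> i y)"
  have g: "?g \<in> mod_hom R (?G i) M" by (rule mod_hom_compose[OF \<psi>(1) f])
  have g0: "?g (\<gamma> i y) = \<zero>\<^bsub>M\<^esub>" if y: "y \<in> carrier (?G (Suc i))" for y
    using f0[OF mod_homD(1)[OF \<psi>(1) y]] \<psi>(3)[OF y] by simp
  have dec: "f y = ?g (\<phi> i y) \<oplus>\<^bsub>M\<^esub> f (\<theta> i y)" if y: "y \<in> carrier (?F i)" for y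
    using mod_homD(1)[OF f y] mod_homD(1)[OF f mod_homD(1)[OF \<psi>\<phi> y]]
    unfolding \<theta>_def mod_hom_minus[OF mod M f y mod_homD(1)[OF \<psi>\<phi> y]]
    by (simp add: a_minus_def M.M.a_lcomm M.M.r_neg)
  have "is_coboundary R M B \<delta> i (\<lambda>y. r \<odot>\<^bsub>M\<^esub> f y) \<longleftrightarrow> is_coboundary R M C \<gamma> i (\<lambda>y. r \<odot>\<^bsub>M\<^esub> ?g y)"
    if r: "r \<in> carrier R" for r
  proof (cases i)
    case 0
    \<comment> \<open>In degree 0 the homotopy formula has the single term \<delta>s, which the
      cocycle f annihilates, so f and f\<psi>\<phi> are equal.\<close>
    have f\<theta>: "f (\<theta> i y) = \<zero>\<^bsub>M\<^esub>" if y: "y \<in> carrier (?F i)" for y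
      using s(2)[of y] f0[of "s 0 y"] mod_homD(1)[OF s(1), of y 0] y 0 by simp
    have "r \<odot>\<^bsub>M\<^esub> f y = r \<odot>\<^bsub>M\<^esub> ?g (\<phi> i y)" if y: "y \<in> carrier (?F i)" for y
      using dec[OF y] f\<theta>[OF y] mod_homD(1)[OF g mod_homD(1)[OF \<phi>(1) y]] by simp
    then show ?thesis
      using mod_homD(1)[OF \<phi>(1)] mod_homD(1)[OF \<psi>(1)] unfolding 0 is_coboundary_0 by metis
  next
    case (Suc j)
    show ?thesis unfolding Suc is_coboundary_Suc
    proof
      assume "\<exists>k\<in>mod_hom R (?F j) M. \<forall>y\<in>carrier (?F (Suc j)). r \<odot>\<^bsub>M\<^esub> f y = k (\<delta> j y)"
      then obtain k where k: "k \<in> mod_hom R (?F j) M"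
        "\<And>y. y \<in> carrier (?F (Suc j)) \<Longrightarrow> r \<odot>\<^bsub>M\<^esub> f y = k (\<delta> j y)" by blast
      show "\<exists>k\<in>mod_hom R (?G j) M. \<forall>y\<in>carrier (?G (Suc j)). r \<odot>\<^bsub>M\<^esub> f (\<psi> (Suc j) y) = k (\<gamma> j y)"
        by (rule bexI[OF _ mod_hom_compose[OF \<psi>(1) k(1)]])
          (use k(2) mod_homD(1)[OF \<psi>(1)] \<psi>(3) in simp)
    next
      assume "\<exists>k\<in>mod_hom R (?G j) M. \<forall>y\<in>carrier (?G (Suc j)). r \<odot>\<^bsub>M\<^esub> f (\<psi> (Suc j) y) = k (\<gamma> j y)"
      then obtain k where k: "k \<in> mod_hom R (?G j) M"
        "\<And>y. y \<in> carrier (?G (Suc j)) \<Longrightarrow> r \<odot>\<^bsub>M\<^esub> f (\<psi> (Suc j) y) = k (\<gamma> j y)" by blast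
      have f': "f \<in> mod_hom R (?F (Suc j)) M" using f Suc by simp
      \<comment> \<open>A primitive of rf on the first resolution: f = f\<psi>\<phi> + f\<theta>,
        and f\<theta> = fs\<delta> as f kills boundaries, so k\<phi> + rfs has coboundary
        rf.\<close>
      note h = mod_hom_add[OF M mod_hom_compose[OF \<phi>(1) k(1)]
          mod_hom_smult[OF M mod_hom_compose[OF s(1) f'] r]]
      show "\<exists>k\<in>mod_hom R (?F j) M. \<forall>y\<in>carrier (?F (Suc j)). r \<odot>\<^bsub>M\<^esub> f y = k (\<delta> j y)"
      proof (rule bexI[OF _ h], rule ballI)
        fix y assume y: "y \<in> carrier (?F (Suc j))"
        note dy = mod_homD(1)[OF \<delta> y]
        note sy = mod_homD(1)[OF s(1) y] and sdy = mod_homD(1)[OF s(1) dy]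
        have "f (\<theta> (Suc j) y) = f (\<delta> (Suc j) (s (Suc j) y)) \<oplus>\<^bsub>M\<^esub> f (s j (\<delta> j y))"
          unfolding s(3)[OF y] by (rule mod_homD(2)[OF f' mod_homD(1)[OF \<delta> sy] sdy])
        also have "\<dots> = f (s j (\<delta> j y))"
          using f0[of "s (Suc j) y"] sy Suc mod_homD(1)[OF f' sdy] by simp
        finally have f\<theta>: "f (\<theta> (Suc j) y) = f (s j (\<delta> j y))" .
        note \<phi>y = mod_homD(1)[OF \<phi>(1) y]
        have gy: "f (\<psi> (Suc j) (\<phi> (Suc j) y)) \<in> carrier M" using mod_homD(1)[OF f' mod_homD(1)[OF \<psi>\<phi> y]] .
        have "r \<odot>\<^bsub>M\<^esub> f y = r \<odot>\<^bsub>M\<^esub> f (\<psi> (Suc j) (\<phi> (Suc j) y)) \<oplus>\<^bsub>M\<^esub> r \<odot>\<^bsub>M\<^esub> f (s j (\<delta> j y))"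
          using dec[of y] y Suc f\<theta> M.smult_r_distr[OF r gy mod_homD(1)[OF f' sdy]] by simp
        then show "r \<odot>\<^bsub>M\<^esub> f y = k (\<phi> j (\<delta> j y)) \<oplus>\<^bsub>M\<^esub> r \<odot>\<^bsub>M\<^esub> f (s j (\<delta> j y))"
          unfolding k(2)[OF \<phi>y] \<phi>(3)[OF y] .
      qed
    qed
  qed
  then have Pg: "P = {r \<in> carrier R. is_coboundary R M C \<gamma> i (\<lambda>y. r \<odot>\<^bsub>M\<^esub> ?g y)}" using Pf by blast
  show "P \<in> Ass R (cohomology_module R M C \<gamma> i)"
    unfolding Ass_cohomology_module[OF M G] by (intro CollectI conjI P bexI[OF _ g] ballI g0 Pg) assumption
qed

text \<open>Existence of a resolution gives the \<open>SOME\<close> in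
  \<open>chosen_resolution\<close> its meaning. One and the same resolution serves every degree
  i.\<close>

lemma Ext_eq_cohomology:
  fixes N :: "('a, 'n, 'e) module_scheme"
  assumes "module R N"
  obtains B :: "nat \<Rightarrow> ('a, 'n) label set" and \<delta> \<epsilon>
  where "free_resolution R N B \<delta> \<epsilon>" "\<And>i. Ext R i N M = cohomology_module R M B \<delta> i"
proof -
  obtain C :: "nat \<Rightarrow> ('a, 'n) label set" and \<gamma> \<eta> where "free_resolution R N C \<gamma> \<eta>"
    by (rule free_resolution_exists[OF assms])
  then have "\<exists>p. (case p of (C, \<gamma>) \<Rightarrow> \<exists>\<eta>. free_resolution R N (C :: nat \<Rightarrow> ('a, 'n) label set) \<gamma> \<eta>)"
    by (intro exI[of _ "(C, \<gamma>)"]) auto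
  from someI_ex[OF this, folded chosen_resolution_def] obtain C \<gamma> \<eta>
    where C: "chosen_resolution R N = (C, \<gamma>)" "free_resolution R N C \<gamma> \<eta>"
    by (cases "chosen_resolution R N") auto
  show ?thesis by (rule that[OF C(2)]) (simp add: Ext_def C(1))
qed

lemma Ass_cohomology_subset_Ass_Ext:
  assumes N: "module R N" and M: "module R M" and F: "free_resolution R N B \<delta> \<epsilon>"
  shows "Ass R (cohomology_module R M B \<delta> i) \<subseteq> Ass R (Ext R i N M)"
  by (rule Ext_eq_cohomology[OF N, of M])
    (simp add: Ass_cohomology_resolution_independent[OF N M F])

section \<open>Ideals as modules, and their cohomology in degree zero and in positive
  degrees\<close>

lemma ring_module_is_module:
  assumes "cring R"
  shows "module R (ring_module R)"
proof -
  interpret cring R by fact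
  show ?thesis
    by (rule moduleI[OF is_cring], rule abelian_groupI)
      (auto simp: ring_module_def a_assoc a_comm m_assoc l_distr r_distr a_lcomm intro: bexI[of _ "\<ominus>\<^bsub>R\<^esub> _"] l_neg)
qed

lemma ideal_module_is_module:
  assumes "cring R" "ideal I R"
  shows "module R (ideal_module R I)"
proof -
  interpret cring R by fact
  interpret I: ideal I R by fact
  show ?thesis
  proof (rule moduleI[OF is_cring], rule abelian_groupI)
    fix x assume "x \<in> carrier (ideal_module R I)"
    then show "\<exists>y\<in>carrier (ideal_module R I). y \<oplus>\<^bsub>ideal_module R I\<^esub> x = \<zero>\<^bsub>ideal_module R I\<^esub>"
      by (intro bexI[of _ "\<ominus>\<^bsub>R\<^esub> x"]) (auto simp: ideal_module_def ring_module_def l_neg I.Icarr)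
  qed (auto simp: ideal_module_def ring_module_def I.Icarr I.I_l_closed I.I_r_closed
      a_ac m_assoc l_distr r_distr)
qed

lemma ideal_module_simps [simp]:
  "carrier (ideal_module R I) = I" "\<zero>\<^bsub>ideal_module R I\<^esub> = \<zero>\<^bsub>R\<^esub>"
  "x \<oplus>\<^bsub>ideal_module R I\<^esub> y = x \<oplus>\<^bsub>R\<^esub> y" "a \<odot>\<^bsub>ideal_module R I\<^esub> y = a \<otimes>\<^bsub>R\<^esub> y"
  by (simp_all add: ideal_module_def ring_module_def)

lemma ring_module_simps [simp]:
  "carrier (ring_module R) = carrier R" "\<zero>\<^bsub>ring_module R\<^esub> = \<zero>\<^bsub>R\<^esub>"
  "x \<oplus>\<^bsub>ring_module R\<^esub> y = x \<oplus>\<^bsub>R\<^esub> y" "a \<odot>\<^bsub>ring_module R\<^esub> y = a \<otimes>\<^bsub>R\<^esub> y"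
  by (simp_all add: ring_module_def)

text \<open>Multiplication by \<open>y \<in> I\<close> on \<open>I\<close> factors through the free module \<open>R\<close>.\<close>

lemma ideal_annihilates_higher_cohomology:
  assumes I: "cring R" "ideal I R" and M: "module R M" and F: "free_resolution R (ideal_module R I) B \<delta> \<epsilon>"
    and y: "y \<in> I" and f: "f \<in> mod_hom R (free_module R (B (Suc i))) M"
    and f0: "\<And>v. v \<in> carrier (free_module R (B (Suc (Suc i)))) \<Longrightarrow> f (\<delta> (Suc i) v) = \<zero>\<^bsub>M\<^esub>"
  shows "is_coboundary R M B \<delta> (Suc i) (\<lambda>v. y \<odot>\<^bsub>M\<^esub> f v)"
proof -
  interpret cring R by fact
  interpret I: ideal I R by fact
  interpret M: module R M by fact
  note mod = free_module_is_module[OF is_cring]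
  note IM = ideal_module_is_module[OF I]
  let ?F = "\<lambda>i. free_module R (B i)"
  interpret F: module R "?F j" for j by (rule mod)
  note \<delta> = free_resolutionD(3)[OF F] and \<epsilon> = free_resolutionD(1)[OF F]
  have yR: "y \<in> carrier R" using y I.Icarr by blast
  obtain u where u: "u \<in> carrier (?F 0)" "\<epsilon> u = y" using free_resolutionD(2)[OF F, of y] y by auto
  have \<epsilon>R: "\<epsilon> v \<in> carrier R" if "v \<in> carrier (?F 0)" for v
    using mod_homD(1)[OF \<epsilon> that] I.Icarr by simp
  \<comment> \<open>The map \<epsilon> followed by r \<mapsto> ru, the passage through the free
    module R. It covers multiplication by y on I, because \<epsilon>(\<epsilon>(v)u) =
    \<epsilon>(v)y.\<close>
  have \<tau>: "(\<lambda>v. \<epsilon> v \<odot>\<^bsub>?F 0\<^esub> u) \<in> mod_hom R (?F 0) (?F 0)"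
    by (rule mod_homI)
      (simp_all add: \<epsilon>R u mod_homD(2,3)[OF \<epsilon>] F.smult_l_distr F.smult_assoc1)
  \<comment> \<open>Multiplication by y on the resolution, and \<tau> extended by zero to higher
    degrees, both cover multiplication by y on I; their difference covers zero. It is a chain map
    since \<tau>\<delta> = 0, and above degree 0 it is multiplication by y.\<close>
  define \<theta> where "\<theta> i v = (if i = 0 then y \<odot>\<^bsub>?F i\<^esub> v \<ominus>\<^bsub>?F i\<^esub> \<epsilon> v \<odot>\<^bsub>?F i\<^esub> u else y \<odot>\<^bsub>?F i\<^esub> v)" for i v
  note ysm = mod_hom_smult[OF mod mod_hom_id yR]
  have \<theta>: "\<theta> i \<in> mod_hom R (?F i) (?F i)" for i
    using mod_hom_diff[OF mod ysm \<tau>] ysm by (cases "i = 0") (simp_all add: \<theta>_def[abs_def])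
  have \<theta>0: "\<epsilon> (\<theta> 0 v) = \<zero>\<^bsub>ideal_module R I\<^esub>" if v: "v \<in> carrier (?F 0)" for v
  proof -
    have "\<epsilon> (\<theta> 0 v) = \<epsilon> (y \<odot>\<^bsub>?F 0\<^esub> v) \<ominus>\<^bsub>ideal_module R I\<^esub> \<epsilon> (\<epsilon> v \<odot>\<^bsub>?F 0\<^esub> u)"
      unfolding \<theta>_def using mod_hom_minus[OF mod IM \<epsilon> mod_homD(1)[OF ysm v] mod_homD(1)[OF \<tau> v]] by simp
    also have "\<epsilon> (y \<odot>\<^bsub>?F 0\<^esub> v) = \<epsilon> (\<epsilon> v \<odot>\<^bsub>?F 0\<^esub> u)"
      using mod_homD(3)[OF \<epsilon> yR v] mod_homD(3)[OF \<epsilon> \<epsilon>R[OF v] u(1)] u(2) m_comm[OF yR \<epsilon>R[OF v]] by simp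
    also have "\<epsilon> (\<epsilon> v \<odot>\<^bsub>?F 0\<^esub> u) \<ominus>\<^bsub>ideal_module R I\<^esub> \<epsilon> (\<epsilon> v \<odot>\<^bsub>?F 0\<^esub> u) = \<zero>\<^bsub>ideal_module R I\<^esub>"
      unfolding a_minus_def
      by (rule abelian_group.r_neg[OF module.axioms(2)[OF IM]]) (rule mod_homD(1)[OF \<epsilon> mod_homD(1)[OF \<tau> v]])
    finally show ?thesis .
  qed
  have \<theta>S: "\<delta> i (\<theta> (Suc i) v) = \<theta> i (\<delta> i v)" if v: "v \<in> carrier (?F (Suc i))" for i v
  proof (cases i)
    case 0
    have "\<ominus>\<^bsub>?F 0\<^esub> \<zero>\<^bsub>?F 0\<^esub> = \<zero>\<^bsub>?F 0\<^esub>" by (rule F.M.minus_equality) auto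
    then show ?thesis
      using v mod_homD(1)[OF \<delta> v] mod_homD(3)[OF \<delta> yR v] free_resolutionD(4)[OF F] u(1) yR 0
      by (simp add: \<theta>_def a_minus_def)
  next
    case (Suc j)
    then show ?thesis using mod_homD(3)[OF \<delta> yR v] by (simp add: \<theta>_def)
  qed
  obtain s where s: "\<And>i. s i \<in> mod_hom R (?F i) (?F (Suc i))"
    "\<And>i v. v \<in> carrier (?F (Suc i)) \<Longrightarrow> \<theta> (Suc i) v = \<delta> (Suc i) (s (Suc i) v) \<oplus>\<^bsub>?F (Suc i)\<^esub> s i (\<delta> i v)"
    using chain_map_null_homotopic[OF IM F F \<theta> \<theta>0 \<theta>S] by metis
  \<comment> \<open>For the cocycle f the homotopy formula leaves yf = fs\<delta>, so fs is the
    primitive sought.\<close>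
  have "\<exists>k\<in>mod_hom R (?F i) M. \<forall>v\<in>carrier (?F (Suc i)). y \<odot>\<^bsub>M\<^esub> f v = k (\<delta> i v)"
  proof (rule bexI[where x = "\<lambda>v. f (s i v)"], rule ballI)
    show "(\<lambda>v. f (s i v)) \<in> mod_hom R (?F i) M" by (rule mod_hom_compose[OF s(1) f])
    fix v assume v: "v \<in> carrier (?F (Suc i))"
    note sv = mod_homD(1)[OF s(1) v] and sdv = mod_homD(1)[OF s(1) mod_homD(1)[OF \<delta> v]]
    have "y \<odot>\<^bsub>M\<^esub> f v = f (\<theta> (Suc i) v)" using mod_homD(3)[OF f yR v] by (simp add: \<theta>_def)
    also have "\<dots> = f (\<delta> (Suc i) (s (Suc i) v)) \<oplus>\<^bsub>M\<^esub> f (s i (\<delta> i v))"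
      unfolding s(2)[OF v] by (rule mod_homD(2)[OF f mod_homD(1)[OF \<delta> sv] sdv])
    also have "\<dots> = f (s i (\<delta> i v))" using f0[OF sv] mod_homD(1)[OF f sdv] by simp
    finally show "y \<odot>\<^bsub>M\<^esub> f v = f (s i (\<delta> i v))" .
  qed
  then show ?thesis unfolding is_coboundary_Suc .
qed

text \<open>Evaluation at a preimage of the nonzerodivisor \<open>x\<close> embeds \<open>Hom(I, R)\<close> into \<open>R\<close>.\<close>

lemma Ass_zeroth_cohomology_ideal:
  assumes I: "cring R" "ideal I R" and x: "x \<in> I" "nonzerodivisor R x"
    and F: "free_resolution R (ideal_module R I) B \<delta> \<epsilon>"
  shows "Ass R (cohomology_module R (ring_module R) B \<delta> 0) \<subseteq> Ass R (ring_module R)"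
proof
  interpret cring R by fact
  interpret I: ideal I R by fact
  note mod = free_module_is_module[OF is_cring]
  note IM = ideal_module_is_module[OF I] and RM = ring_module_is_module[OF is_cring]
  let ?F = "\<lambda>i. free_module R (B i)"
  interpret F: module R "?F j" for j by (rule mod)
  note \<delta> = free_resolutionD(3)[OF F] and \<epsilon> = free_resolutionD(1)[OF F]
  have xR: "x \<in> carrier R" using x I.Icarr by blast
  obtain u where u: "u \<in> carrier (?F 0)" "\<epsilon> u = x" using free_resolutionD(2)[OF F, of x] x by auto
  have \<epsilon>R: "\<epsilon> v \<in> carrier R" if "v \<in> carrier (?F 0)" for v
    using mod_homD(1)[OF \<epsilon> that] I.Icarr by simp
  fix P assume "P \<in> Ass R (cohomology_module R (ring_module R) B \<delta> 0)"
  then have P: "primeideal P R" by (simp add: Ass_def)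
  from \<open>P \<in> _\<close> have "\<exists>f\<in>mod_hom R (?F 0) (ring_module R). (\<forall>y\<in>carrier (?F (Suc 0)). f (\<delta> 0 y) = \<zero>\<^bsub>ring_module R\<^esub>) \<and>
      P = {r \<in> carrier R. is_coboundary R (ring_module R) B \<delta> 0 (\<lambda>y. r \<odot>\<^bsub>ring_module R\<^esub> f y)}"
    unfolding Ass_cohomology_module[OF RM F] by (elim CollectE conjE)
  then obtain f where f: "f \<in> mod_hom R (?F 0) (ring_module R)"
    and f': "(\<forall>y\<in>carrier (?F (Suc 0)). f (\<delta> 0 y) = \<zero>\<^bsub>ring_module R\<^esub>) \<and>
      P = {r \<in> carrier R. is_coboundary R (ring_module R) B \<delta> 0 (\<lambda>y. r \<odot>\<^bsub>ring_module R\<^esub> f y)}" by (rule bexE)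
  note f0' = conjunct1[OF f'] and Pf = conjunct2[OF f']
  have f0: "f (\<delta> 0 y) = \<zero>\<^bsub>R\<^esub>" if "y \<in> carrier (?F (Suc 0))" for y using f0' that by simp
  have fR: "f v \<in> carrier R" if "v \<in> carrier (?F 0)" for v using mod_homD(1)[OF f that] by simp
  \<comment> \<open>The element xv - \<epsilon>(v)u is in the kernel of \<epsilon>, hence a boundary
    and killed by f. So x f(v) = \<epsilon>(v) f(u), and as x can be cancelled, whatever annihilates
    f(u) annihilates all values of f.\<close>
  have "r \<otimes>\<^bsub>R\<^esub> f v = \<zero>\<^bsub>R\<^esub>" if r: "r \<in> carrier R" "r \<otimes>\<^bsub>R\<^esub> f u = \<zero>\<^bsub>R\<^esub>" and v: "v \<in> carrier (?F 0)" for r v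
  proof -
    let ?w = "x \<odot>\<^bsub>?F 0\<^esub> v \<ominus>\<^bsub>?F 0\<^esub> \<epsilon> v \<odot>\<^bsub>?F 0\<^esub> u"
    have c: "x \<odot>\<^bsub>?F 0\<^esub> v \<in> carrier (?F 0)" "\<epsilon> v \<odot>\<^bsub>?F 0\<^esub> u \<in> carrier (?F 0)" using xR v u \<epsilon>R by auto
    have "\<epsilon> (x \<odot>\<^bsub>?F 0\<^esub> v) = \<epsilon> (\<epsilon> v \<odot>\<^bsub>?F 0\<^esub> u)"
      using mod_homD(3)[OF \<epsilon> xR v] mod_homD(3)[OF \<epsilon> \<epsilon>R[OF v] u(1)] u(2) m_comm[OF xR \<epsilon>R[OF v]] by simp
    then have "\<epsilon> ?w = \<epsilon> (\<epsilon> v \<odot>\<^bsub>?F 0\<^esub> u) \<ominus>\<^bsub>ideal_module R I\<^esub> \<epsilon> (\<epsilon> v \<odot>\<^bsub>?F 0\<^esub> u)"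
      using mod_hom_minus[OF mod IM \<epsilon> c] by simp
    also have "\<dots> = \<zero>\<^bsub>ideal_module R I\<^esub>"
      unfolding a_minus_def by (rule abelian_group.r_neg[OF module.axioms(2)[OF IM] mod_homD(1)[OF \<epsilon> c(2)]])
    finally have "\<epsilon> ?w = \<zero>\<^bsub>ideal_module R I\<^esub>" .
    moreover have w: "?w \<in> carrier (?F 0)" using c by simp
    ultimately obtain z where z: "z \<in> carrier (?F (Suc 0))" "?w = \<delta> 0 z"
      using free_resolutionD(6)[OF F] by blast
    have "x \<odot>\<^bsub>?F 0\<^esub> v = ?w \<oplus>\<^bsub>?F 0\<^esub> \<epsilon> v \<odot>\<^bsub>?F 0\<^esub> u"
      using c by (simp add: a_minus_def F.M.a_assoc F.M.l_neg)
    then have "f (x \<odot>\<^bsub>?F 0\<^esub> v) = f (\<epsilon> v \<odot>\<^bsub>?F 0\<^esub> u)"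
      using mod_homD(2)[OF f w c(2)] f0[OF z(1), folded z(2)] fR[OF c(2)] by simp
    then have "x \<otimes>\<^bsub>R\<^esub> f v = \<epsilon> v \<otimes>\<^bsub>R\<^esub> f u" using mod_homD(3)[OF f xR v] mod_homD(3)[OF f \<epsilon>R[OF v] u(1)] by simp
    then have "x \<otimes>\<^bsub>R\<^esub> (r \<otimes>\<^bsub>R\<^esub> f v) = \<epsilon> v \<otimes>\<^bsub>R\<^esub> (r \<otimes>\<^bsub>R\<^esub> f u)"
      using r(1) xR fR[OF v] fR[OF u(1)] \<epsilon>R[OF v] by (metis m_lcomm)
    then show ?thesis using r fR[OF v] \<epsilon>R[OF v] x(2) by (auto simp: nonzerodivisor_def)
  qed
  then have "P = annihilator R (ring_module R) (f u)"
    unfolding Pf annihilator_def is_coboundary_0 using u(1) by auto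
  then show "P \<in> Ass R (ring_module R)" using P fR[OF u(1)] by (auto simp: Ass_def)
qed


section \<open>The residue ring of a principal ideal\<close>

text \<open>A copy of \<open>R/xR\<close> on a set of representatives \<open>\<rho> a\<close> of the residue classes, since only
  rings with elements in \<open>'a\<close> are allowed as \<open>A\<close>.\<close>

definition reduction_ring :: "('a, 'c) ring_scheme \<Rightarrow> ('a \<Rightarrow> 'a) \<Rightarrow> 'a ring" where
  "reduction_ring R \<rho> = \<lparr>carrier = \<rho> ` carrier R, mult = (\<lambda>a b. \<rho> (a \<otimes>\<^bsub>R\<^esub> b)), one = \<rho> \<one>\<^bsub>R\<^esub>,
     zero = \<zero>\<^bsub>R\<^esub>, add = (\<lambda>a b. \<rho> (a \<oplus>\<^bsub>R\<^esub> b))\<rparr>"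

text \<open>\<rho> picks one member of each class modulo xR. Through \<open>rep_zero\<close> the
  zero of A is that of R; supports then mean the same over both rings, and vectors over A are
  literally vectors over R.\<close>

locale principal_reduction = cring +
  fixes x :: 'a and \<rho> :: "'a \<Rightarrow> 'a" and A :: "'a ring"
  assumes x_carrier [simp]: "x \<in> carrier R"
    and rep_closed [simp]: "a \<in> carrier R \<Longrightarrow> \<rho> a \<in> carrier R"
    and rep_exists: "a \<in> carrier R \<Longrightarrow> \<exists>c\<in>carrier R. \<rho> a = a \<oplus> x \<otimes> c"
    and rep_cong: "a \<in> carrier R \<Longrightarrow> c \<in> carrier R \<Longrightarrow> \<rho> (a \<oplus> x \<otimes> c) = \<rho> a"
    and rep_zero [simp]: "\<rho> \<zero> = \<zero>"
    and A_def: "A = reduction_ring R \<rho>"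

lemma (in cring) principal_reduction_exists:
  assumes x: "x \<in> carrier R"
  obtains \<rho> where "principal_reduction R x \<rho> (reduction_ring R \<rho>)"
proof -
  define C where "C a = {a \<oplus> x \<otimes> c |c. c \<in> carrier R}" for a
  \<comment> \<open>The value depends on the class alone, so congruent elements get the same
    representative; in the zero class it is forced to be 0.\<close>
  define \<rho> where "\<rho> a = (if \<zero> \<in> C a then \<zero> else SOME b. b \<in> C a)" for a
  have self: "a \<in> C a" if a: "a \<in> carrier R" for a
  proof -
    have "a = a \<oplus> x \<otimes> \<zero>" using a x by simp
    then show ?thesis unfolding C_def by (intro CollectI exI[of _ \<zero>]) simp
  qed
  have \<rho>C: "\<rho> a \<in> C a" if "a \<in> carrier R" for a
    using self[OF that] someI[of "\<lambda>b. b \<in> C a"] by (auto simp: \<rho>_def)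
  have Ceq: "C (a \<oplus> x \<otimes> c) = C a" if a: "a \<in> carrier R" and c: "c \<in> carrier R" for a c
  proof (intro equalityI subsetI)
    fix b assume "b \<in> C (a \<oplus> x \<otimes> c)"
    then obtain e where e: "e \<in> carrier R" "b = (a \<oplus> x \<otimes> c) \<oplus> x \<otimes> e" by (auto simp: C_def)
    then have "b = a \<oplus> x \<otimes> (c \<oplus> e)" using a c x by (simp add: r_distr a_assoc)
    then show "b \<in> C a" unfolding C_def by (intro CollectI exI[of _ "c \<oplus> e"]) (use c e in simp)
  next
    fix b assume "b \<in> C a"
    then obtain e where e: "e \<in> carrier R" "b = a \<oplus> x \<otimes> e" by (auto simp: C_def)
    have "b = (a \<oplus> x \<otimes> c) \<oplus> x \<otimes> (e \<ominus> c)" unfolding e(2) using a c x e(1) by algebra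
    then show "b \<in> C (a \<oplus> x \<otimes> c)" unfolding C_def
      by (intro CollectI exI[of _ "e \<ominus> c"]) (use c e in simp)
  qed
  have "principal_reduction R x \<rho> (reduction_ring R \<rho>)"
  proof (intro principal_reduction.intro principal_reduction_axioms.intro is_cring)
    fix a assume a: "a \<in> carrier R"
    show "\<exists>c\<in>carrier R. \<rho> a = a \<oplus> x \<otimes> c" using \<rho>C[OF a] by (auto simp: C_def)
    then show "\<rho> a \<in> carrier R" using a x by auto
    fix c assume c: "c \<in> carrier R"
    show "\<rho> (a \<oplus> x \<otimes> c) = \<rho> a" unfolding \<rho>_def Ceq[OF a c] ..
  next
    show "\<rho> \<zero> = \<zero>" using self[of \<zero>] by (simp add: \<rho>_def)
  qed (use x in auto)
  with that show ?thesis by blast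
qed

context principal_reduction
begin

lemma rep_eq_iff:
  assumes "a \<in> carrier R" "b \<in> carrier R"
  shows "\<rho> a = \<rho> b \<longleftrightarrow> (\<exists>c\<in>carrier R. a = b \<oplus> x \<otimes> c)"
proof
  assume eq: "\<rho> a = \<rho> b"
  obtain c e where c: "c \<in> carrier R" "\<rho> a = a \<oplus> x \<otimes> c" "e \<in> carrier R" "\<rho> b = b \<oplus> x \<otimes> e"
    using rep_exists assms by metis
  have "a = (a \<oplus> x \<otimes> c) \<ominus> x \<otimes> c" using assms c(1) x_carrier by algebra
  also have "\<dots> = (b \<oplus> x \<otimes> e) \<ominus> x \<otimes> c" using eq c by simp
  also have "\<dots> = b \<oplus> x \<otimes> (e \<ominus> c)" using assms c(1,3) x_carrier by algebra
  finally show "\<exists>c\<in>carrier R. a = b \<oplus> x \<otimes> c" using c by (intro bexI[of _ "e \<ominus> c"]) auto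
qed (use assms rep_cong in auto)

lemma rep_rep [simp]: "a \<in> carrier R \<Longrightarrow> \<rho> (\<rho> a) = \<rho> a"
  using rep_exists[of a] rep_cong[of a] by auto

lemma rep_add_left [simp]:
  assumes "a \<in> carrier R" "b \<in> carrier R"
  shows "\<rho> (\<rho> a \<oplus> b) = \<rho> (a \<oplus> b)"
proof -
  obtain c where c: "c \<in> carrier R" "\<rho> a = a \<oplus> x \<otimes> c" using rep_exists assms by blast
  have "\<rho> a \<oplus> b = (a \<oplus> b) \<oplus> x \<otimes> c" unfolding c(2) using assms c(1) x_carrier by algebra
  then show ?thesis using assms c rep_cong[of "a \<oplus> b" c] by simp
qed

lemma rep_add_right [simp]:
  assumes "a \<in> carrier R" "b \<in> carrier R"
  shows "\<rho> (a \<oplus> \<rho> b) = \<rho> (a \<oplus> b)"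
  using rep_add_left[OF assms(2,1)] assms by (simp add: a_comm)

lemma rep_mult_left [simp]:
  assumes "a \<in> carrier R" "b \<in> carrier R"
  shows "\<rho> (\<rho> a \<otimes> b) = \<rho> (a \<otimes> b)"
proof -
  obtain c where c: "c \<in> carrier R" "\<rho> a = a \<oplus> x \<otimes> c" using rep_exists assms by blast
  have "\<rho> a \<otimes> b = (a \<otimes> b) \<oplus> x \<otimes> (c \<otimes> b)" unfolding c(2) using assms c(1) x_carrier by algebra
  then show ?thesis using assms c rep_cong[of "a \<otimes> b" "c \<otimes> b"] by simp
qed

lemma rep_mult_right [simp]:
  assumes "a \<in> carrier R" "b \<in> carrier R"
  shows "\<rho> (a \<otimes> \<rho> b) = \<rho> (a \<otimes> b)"
  using rep_mult_left[OF assms(2,1)] assms by (simp add: m_comm)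

lemma A_simps [simp]:
  "carrier A = \<rho> ` carrier R" "a \<otimes>\<^bsub>A\<^esub> b = \<rho> (a \<otimes> b)" "a \<oplus>\<^bsub>A\<^esub> b = \<rho> (a \<oplus> b)"
  "\<one>\<^bsub>A\<^esub> = \<rho> \<one>" "\<zero>\<^bsub>A\<^esub> = \<zero>"
  by (simp_all add: A_def reduction_ring_def)

lemma A_closed: "a \<in> carrier A \<Longrightarrow> a \<in> carrier R"
  by auto

lemma A_rep: "a \<in> carrier A \<Longrightarrow> \<rho> a = a"
  by auto

lemma rep_in_A: "a \<in> carrier R \<Longrightarrow> \<rho> a \<in> carrier A"
  by simp

lemma cring_A: "cring A"
proof (rule cringI)
  show "abelian_group A"
  proof (rule abelian_groupI)
    fix a b c assume "a \<in> carrier A" "b \<in> carrier A" "c \<in> carrier A"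
    then have "a \<in> carrier R" "b \<in> carrier R" "c \<in> carrier R" by (auto intro: A_closed)
    then show "a \<oplus>\<^bsub>A\<^esub> b \<oplus>\<^bsub>A\<^esub> c = a \<oplus>\<^bsub>A\<^esub> (b \<oplus>\<^bsub>A\<^esub> c)" "a \<oplus>\<^bsub>A\<^esub> b = b \<oplus>\<^bsub>A\<^esub> a"
      by (simp_all add: a_assoc) (simp add: a_comm)
  next
    fix a assume "a \<in> carrier A"
    then obtain b where b: "b \<in> carrier R" "a = \<rho> b" by auto
    then show "\<exists>c\<in>carrier A. c \<oplus>\<^bsub>A\<^esub> a = \<zero>\<^bsub>A\<^esub>"
      by (intro bexI[of _ "\<rho> (\<ominus> b)"]) (auto simp: l_neg)
  qed (auto simp: image_iff intro: bexI[of _ \<zero>])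
  show "comm_monoid A"
  proof (rule comm_monoidI)
    fix a b c assume "a \<in> carrier A" "b \<in> carrier A" "c \<in> carrier A"
    then have "a \<in> carrier R" "b \<in> carrier R" "c \<in> carrier R" by (auto intro: A_closed)
    then show "a \<otimes>\<^bsub>A\<^esub> b \<otimes>\<^bsub>A\<^esub> c = a \<otimes>\<^bsub>A\<^esub> (b \<otimes>\<^bsub>A\<^esub> c)" "a \<otimes>\<^bsub>A\<^esub> b = b \<otimes>\<^bsub>A\<^esub> a"
      by (simp_all add: m_assoc) (simp add: m_comm)
  qed auto
  fix a b c assume "a \<in> carrier A" "b \<in> carrier A" "c \<in> carrier A"
  then have "a \<in> carrier R" "b \<in> carrier R" "c \<in> carrier R" by (auto intro: A_closed)
  then show "(a \<oplus>\<^bsub>A\<^esub> b) \<otimes>\<^bsub>A\<^esub> c = a \<otimes>\<^bsub>A\<^esub> c \<oplus>\<^bsub>A\<^esub> b \<otimes>\<^bsub>A\<^esub> c"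
    by (simp add: l_distr)
qed

section \<open>Correspondence of ideals between R and the residue ring\<close>

lemma preimage_ideal:
  assumes "ideal K A"
  shows "ideal {r \<in> carrier R. \<rho> r \<in> K} R"
proof -
  interpret K: ideal K A by fact
  show ?thesis
  proof (rule ideal_cringI)
    show "\<zero> \<in> {r \<in> carrier R. \<rho> r \<in> K}"
      using additive_subgroup.zero_closed[OF ideal.axioms(1)[OF assms]] by simp
  next
    fix a b assume "a \<in> {r \<in> carrier R. \<rho> r \<in> K}" "b \<in> {r \<in> carrier R. \<rho> r \<in> K}"
    then show "a \<oplus> b \<in> {r \<in> carrier R. \<rho> r \<in> K}" 
      using additive_subgroup.a_closed[OF ideal.axioms(1)[OF assms], of "\<rho> a" "\<rho> b"] by simp
  next
    fix a r assume "a \<in> {r \<in> carrier R. \<rho> r \<in> K}" "r \<in> carrier R"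
    then show "r \<otimes> a \<in> {r \<in> carrier R. \<rho> r \<in> K}" using K.I_l_closed[of "\<rho> a" "\<rho> r"] by simp
  qed auto
qed

lemma preimage_primeideal:
  assumes "primeideal K A"
  shows "primeideal {r \<in> carrier R. \<rho> r \<in> K} R"
proof -
  interpret K: primeideal K A by fact
  show ?thesis
  proof (rule primeidealI[OF preimage_ideal[OF K.is_ideal] is_cring])
    have "\<rho> \<one> \<notin> K" using K.I_notcarr K.one_imp_carrier by auto
    then show "carrier R \<noteq> {r \<in> carrier R. \<rho> r \<in> K}" using one_closed by blast
    fix a b assume "a \<in> carrier R" "b \<in> carrier R" "a \<otimes> b \<in> {r \<in> carrier R. \<rho> r \<in> K}"
    then show "a \<in> {r \<in> carrier R. \<rho> r \<in> K} \<or> b \<in> {r \<in> carrier R. \<rho> r \<in> K}"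
      using K.I_prime[of "\<rho> a" "\<rho> b"] by auto
  qed
qed

lemma x_in_preimage:
  assumes "ideal K A"
  shows "x \<in> {r \<in> carrier R. \<rho> r \<in> K}"
proof -
  have "\<rho> x = \<zero>" using rep_cong[of \<zero> \<one>] by simp
  then show ?thesis using additive_subgroup.zero_closed[OF ideal.axioms(1)[OF assms]] by simp
qed

text \<open>\<rho> r and r differ by a multiple of x, which lies in P. Hence P \<inter> A is the
  image of P in R/xR, and P can be recovered from it as a preimage.\<close>

lemma rep_mem_iff:
  assumes "ideal P R" "x \<in> P" "r \<in> carrier R"
  shows "\<rho> r \<in> P \<longleftrightarrow> r \<in> P"
proof -
  interpret P: ideal P R by fact
  obtain c where c: "c \<in> carrier R" "\<rho> r = r \<oplus> x \<otimes> c" using rep_exists assms by blast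
  then have xc: "x \<otimes> c \<in> P" using assms P.I_r_closed by blast
  have "r = \<rho> r \<ominus> x \<otimes> c" unfolding c(2) using c(1) assms(3) x_carrier by algebra
  then show ?thesis using xc P.a_closed[of r "x \<otimes> c"] ideal_minus_closed[OF assms(1), of "\<rho> r" "x \<otimes> c"] c(2) by auto
qed

lemma image_ideal:
  assumes P: "ideal P R" "x \<in> P"
  shows "ideal (P \<inter> carrier A) A"
proof -
  interpret P: ideal P R by fact
  interpret A: cring A by (rule cring_A)
  have mem: "\<rho> r \<in> P \<inter> carrier A" if "r \<in> P" for r
    using that rep_mem_iff[OF P] P.Icarr[OF that] by simp
  show ?thesis
  proof (rule A.ideal_cringI)
    show "\<zero>\<^bsub>A\<^esub> \<in> P \<inter> carrier A" using A.zero_closed P.zero_closed by simp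
  next
    fix a b assume "a \<in> P \<inter> carrier A" "b \<in> P \<inter> carrier A"
    then show "a \<oplus>\<^bsub>A\<^esub> b \<in> P \<inter> carrier A" using mem[of "a \<oplus> b"] by simp
  next
    fix a r assume "a \<in> P \<inter> carrier A" "r \<in> carrier A"
    then show "r \<otimes>\<^bsub>A\<^esub> a \<in> P \<inter> carrier A" using mem[of "r \<otimes> a"] P.I_l_closed[of a r] A_closed[of r] by simp
  qed auto
qed

lemma image_primeideal:
  assumes P: "primeideal P R" "x \<in> P"
  shows "primeideal (P \<inter> carrier A) A"
proof -
  interpret P: primeideal P R by fact
  have "\<one> \<notin> P" using P.I_notcarr P.one_imp_carrier by blast
  then have one: "\<rho> \<one> \<notin> P" using rep_mem_iff[OF P.is_ideal P(2)] by simp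
  show ?thesis
  proof (rule primeidealI[OF image_ideal[OF P.is_ideal P(2)] cring_A])
    show "carrier A \<noteq> P \<inter> carrier A" using one by auto
    fix a b assume ab: "a \<in> carrier A" "b \<in> carrier A" "a \<otimes>\<^bsub>A\<^esub> b \<in> P \<inter> carrier A"
    then have "a \<otimes> b \<in> P" using rep_mem_iff[OF P.is_ideal P(2), of "a \<otimes> b"] A_closed by simp
    then show "a \<in> P \<inter> carrier A \<or> b \<in> P \<inter> carrier A"
      using ab P.I_prime A_closed by blast
  qed
qed

text \<open>Representatives of generators of the preimage of K generate K.\<close>

lemma noetherian_A:
  assumes "noetherian_ring R"
  shows "noetherian_ring A"
proof -
  interpret N: noetherian_ring R by fact
  interpret A: cring A by (rule cring_A)
  show ?thesis
  proof (rule A.noetherian_ringI)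
    fix K assume K: "ideal K A"
    interpret K: ideal K A by fact
    obtain S where S: "S \<subseteq> carrier R" "finite S" "{r \<in> carrier R. \<rho> r \<in> K} = Idl S"
      using N.finetely_gen[OF preimage_ideal[OF K]] by blast
    have SK: "\<rho> ` S \<subseteq> K" using genideal_self[OF S(1)] S(3) by blast
    have "K = Idl\<^bsub>A\<^esub> (\<rho> ` S)"
    proof
      show "Idl\<^bsub>A\<^esub> (\<rho> ` S) \<subseteq> K" by (rule A.genideal_minimal[OF K SK])
      show "K \<subseteq> Idl\<^bsub>A\<^esub> (\<rho> ` S)"
      proof
        fix k assume k: "k \<in> K"
        have SA: "\<rho> ` S \<subseteq> carrier A" using S(1) by auto
        have "Idl S \<subseteq> {r \<in> carrier R. \<rho> r \<in> Idl\<^bsub>A\<^esub> (\<rho> ` S)}"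
          by (rule genideal_minimal[OF preimage_ideal[OF A.genideal_ideal[OF SA]]])
            (use S(1) A.genideal_self[OF SA] in auto)
        moreover have "k \<in> carrier A" using k K.Icarr by blast
        then have kk: "\<rho> k = k" "k \<in> carrier R" using A_rep A_closed by blast+
        have "k \<in> {r \<in> carrier R. \<rho> r \<in> K}" using k kk by simp
        then have "k \<in> Idl S" unfolding S(3) .
        ultimately have "k \<in> {r \<in> carrier R. \<rho> r \<in> Idl\<^bsub>A\<^esub> (\<rho> ` S)}" by (rule subsetD)
        then show "k \<in> Idl\<^bsub>A\<^esub> (\<rho> ` S)" using kk by simp
      qed
    qed
    then show "\<exists>S\<subseteq>carrier A. finite S \<and> K = Idl\<^bsub>A\<^esub> S"
      using S(1,2) by (intro exI[of _ "\<rho> ` S"]) auto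
  qed
qed

end

section \<open>Locality and Krull dimension of the residue ring\<close>

lemma noetherian_local_ringD:
  assumes "noetherian_local_ring R"
  obtains m where "noetherian_cring R" "maximalideal m R" "primeideal m R"
    "\<And>I. ideal I R \<Longrightarrow> I \<noteq> carrier R \<Longrightarrow> I \<subseteq> m"
proof -
  have R: "cring R" "noetherian_ring R" "\<exists>!P. maximalideal P R"
    using assms by (auto simp: noetherian_local_ring_def)
  interpret noetherian_cring R by (intro noetherian_cring.intro R)
  obtain m where m: "maximalideal m R" "\<And>M. maximalideal M R \<Longrightarrow> M = m" using R(3) by blast
  have "I \<subseteq> m" if I: "ideal I R" "I \<noteq> carrier R" for I
    using maximalideal_above[OF I] m(2) by metis
  with m maximalideal_prime[OF m(1)] that show ?thesis using noetherian_cring_axioms by blast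
qed

definition prime_chain :: "('a, 'c) ring_scheme \<Rightarrow> nat \<Rightarrow> (nat \<Rightarrow> 'a set) \<Rightarrow> bool" where
  "prime_chain R n P \<longleftrightarrow> (\<forall>i\<le>n. primeideal (P i) R) \<and> (\<forall>i<n. P i \<subset> P (Suc i))"

lemma krull_dim_eqI:
  assumes "prime_chain R n P" "\<And>k P. prime_chain R k P \<Longrightarrow> k \<le> n"
  shows "krull_dim R = enat n"
  unfolding krull_dim_def prime_chain_def[symmetric]
  by (rule Sup_eqI) (use assms in auto)

text \<open>The lengths of chains form a subset of the finite set {0..d}, nonempty by the given
  chain, so the supremum is a maximum. The empty set would have supremum 0 without attaining
  it.\<close>

lemma krull_dim_eqD:
  assumes "krull_dim R = enat d" "prime_chain R n0 P0"
  obtains P where "prime_chain R d P" "\<And>k P. prime_chain R k P \<Longrightarrow> k \<le> d"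
proof -
  let ?S = "{enat n |n. \<exists>P. prime_chain R n P}"
  have S: "Sup ?S = enat d" using assms(1) by (simp add: krull_dim_def prime_chain_def)
  have le: "k \<le> d" if "prime_chain R k P" for k P
    using Sup_upper[of "enat k" ?S] that S by auto
  have "?S \<subseteq> enat ` {..d}" using le by auto
  then have "finite ?S" by (rule finite_subset) simp
  moreover have "?S \<noteq> {}" using assms(2) by blast
  ultimately have "Sup ?S \<in> ?S" using Max_in[of ?S] Max_Sup[of ?S] by metis
  then show ?thesis using that le S by auto
qed

text \<open>A proper ideal of A has a proper preimage, which lies in m; so m \<inter> A is the
  largest proper ideal of A.\<close>

lemma (in principal_reduction) noetherian_local_A:
  assumes R: "noetherian_local_ring R" and m: "maximalideal m R" "x \<in> m"
  shows "noetherian_local_ring A"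
proof -
  obtain m' where m': "noetherian_cring R" "maximalideal m' R"
    "\<And>I. ideal I R \<Longrightarrow> I \<noteq> carrier R \<Longrightarrow> I \<subseteq> m'"
    using noetherian_local_ringD[OF R] by metis
  have [simp]: "m' = m"
    using R m(1) m'(2) by (auto simp: noetherian_local_ring_def)
  interpret noetherian_cring R by fact
  interpret M: maximalideal m R by fact
  interpret A: cring A by (rule cring_A)
  have one: "\<one> \<notin> m" using M.I_notcarr M.one_imp_carrier by blast
  have I: "ideal (m \<inter> carrier A) A" by (rule image_ideal[OF M.is_ideal m(2)])
  have ne: "m \<inter> carrier A \<noteq> carrier A"
    using one rep_mem_iff[OF M.is_ideal m(2), of \<one>] by auto
  have above: "K \<subseteq> m \<inter> carrier A" if K: "ideal K A" "K \<noteq> carrier A" for K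
  proof -
    interpret K: ideal K A by fact
    have "\<rho> \<one> \<notin> K" using K.one_imp_carrier K(2) by auto
    then have "{r \<in> carrier R. \<rho> r \<in> K} \<noteq> carrier R" using one_closed by blast
    then have "{r \<in> carrier R. \<rho> r \<in> K} \<subseteq> m" using m'(3)[OF preimage_ideal[OF K(1)]] by simp
    moreover have "k \<in> {r \<in> carrier R. \<rho> r \<in> K} \<and> k \<in> carrier A" if "k \<in> K" for k
      using K.Icarr[OF that] that by auto
    ultimately show ?thesis by blast
  qed
  have "maximalideal (m \<inter> carrier A) A"
  proof (rule maximalidealI[OF I])
    show "carrier A \<noteq> m \<inter> carrier A" using ne by metis
    fix K assume "ideal K A" "m \<inter> carrier A \<subseteq> K" "K \<subseteq> carrier A"
    then show "K = m \<inter> carrier A \<or> K = carrier A" using above by blast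
  qed
  moreover have "K = m \<inter> carrier A" if K: "maximalideal K A" for K
  proof -
    interpret K: maximalideal K A by fact
    have "K \<subseteq> m \<inter> carrier A" using above[OF K.is_ideal] K.I_notcarr by metis
    then show ?thesis using K.I_maximal[OF I] ne by blast
  qed
  ultimately have "\<exists>!P. maximalideal P A" by blast
  then show ?thesis
    using cring_A noetherian_A noetherian_ring_axioms by (auto simp: noetherian_local_ring_def)
qed

lemma (in principal_reduction) krull_dim_A:
  assumes R: "noetherian_local_ring R" and m: "maximalideal m R" "x \<in> m"
    and x: "nonzerodivisor R x" and d: "krull_dim R = enat d"
  shows "krull_dim A + 1 = enat d"
proof -
  obtain m' where m': "noetherian_cring R" "maximalideal m' R"
    "\<And>I. ideal I R \<Longrightarrow> I \<noteq> carrier R \<Longrightarrow> I \<subseteq> m'"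
    using noetherian_local_ringD[OF R] by metis
  have [simp]: "m' = m"
    using R m(1) m'(2) by (auto simp: noetherian_local_ring_def)
  interpret noetherian_cring R by fact
  have mp: "primeideal m R" by (rule maximalideal_prime[OF m(1)])
  have "prime_chain R 0 (\<lambda>_. m)" using mp by (simp add: prime_chain_def)
  then obtain P where P: "prime_chain R d P" and max: "\<And>k P. prime_chain R k P \<Longrightarrow> k \<le> d"
    using krull_dim_eqD[OF d] by blast
  have up: "Suc k \<le> d" if K: "prime_chain A k K" for k K
  proof -
    let ?Q = "\<lambda>i. {r \<in> carrier R. \<rho> r \<in> K i}"
    have K': "primeideal (K i) A" if "i \<le> k" for i using K that by (simp add: prime_chain_def)
    have Q: "primeideal (?Q i) R" if "i \<le> k" for i by (rule preimage_primeideal[OF K'[OF that]])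
    have lt: "?Q i \<subset> ?Q (Suc i)" if i: "i < k" for i
    proof -
      have "K i \<subset> K (Suc i)" using K i by (simp add: prime_chain_def)
      then obtain a where a: "a \<in> K (Suc i)" "a \<notin> K i" by blast
      have "a \<in> carrier A" using ideal.Icarr[OF primeideal.axioms(1)[OF K'] a(1)] i by simp
      then have "\<rho> a = a" "a \<in> carrier R" using A_rep A_closed by blast+
      then have "a \<in> ?Q (Suc i)" "a \<notin> ?Q i" using a by simp_all
      then show ?thesis using \<open>K i \<subset> K (Suc i)\<close> by blast
    qed
    \<comment> \<open>The smallest prime of the pulled-back chain contains the nonzerodivisor x and
      is therefore not minimal: one more prime fits below, whence the \<open>Suc\<close>.\<close>
    obtain Z where Z: "primeideal Z R" "Z \<subset> ?Q 0"
      by (rule prime_below_nonzerodivisor[OF Q[OF le0] x x_in_preimage[OF primeideal.axioms(1)[OF K'[OF le0]]]])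
        (rule that)
    have "prime_chain R (Suc k) (\<lambda>i. case i of 0 \<Rightarrow> Z | Suc j \<Rightarrow> ?Q j)"
      unfolding prime_chain_def
    proof (intro conjI allI impI)
      fix i assume "i \<le> Suc k"
      then show "primeideal (case i of 0 \<Rightarrow> Z | Suc j \<Rightarrow> ?Q j) R"
        using Z(1) Q by (cases i) auto
    next
      fix i assume "i < Suc k"
      then show "(case i of 0 \<Rightarrow> Z | Suc j \<Rightarrow> ?Q j) \<subset> (case Suc i of 0 \<Rightarrow> Z | Suc j \<Rightarrow> ?Q j)"
        using Z(2) lt by (cases i) simp_all
    qed
    then show ?thesis by (rule max)
  qed
  have "primeideal (m \<inter> carrier A) A" by (rule image_primeideal[OF mp m(2)])
  then have "prime_chain A 0 (\<lambda>_. m \<inter> carrier A)" by (simp add: prime_chain_def)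
  \<comment> \<open>A has at least one prime, so the bound just proved gives d \<ge> 1.\<close>
  from up[OF this] obtain n where n: "d = Suc n" by (cases d) auto
  \<comment> \<open>The top of a longest chain may miss x. It lies in m, so replacing it by m keeps
    the chain strict and puts x into the top member.\<close>
  let ?P = "P(Suc n := m)"
  have Pi: "primeideal (P i) R" if "i \<le> Suc n" for i using P that n by (simp add: prime_chain_def)
  have Plt: "P i \<subset> P (Suc i)" if "i < Suc n" for i using P that n by (simp add: prime_chain_def)
  have "P (Suc n) \<subseteq> m"
    using m'(3)[OF primeideal.axioms(1)[OF Pi]] primeideal.I_notcarr[OF Pi, of "Suc n"] by auto
  then have Plt': "?P i \<subset> ?P (Suc i)" if "i < Suc n" for i
    using Plt[OF that] that by (cases "i = n") auto
  have Pi': "primeideal (?P i) R" if "i \<le> Suc n" for i using Pi mp that by simp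
  have "x \<in> ?P (Suc n)" using m(2) by simp
  then obtain Q where Q: "\<And>i. i \<le> n \<Longrightarrow> primeideal (Q i) R" "\<And>i. i < n \<Longrightarrow> Q i \<subset> Q (Suc i)" "x \<in> Q 0"
    using prime_chain_through[where n = n and P = ?P and x = x, OF Pi' Plt'] by metis
  have xQ: "x \<in> Q i" if "i \<le> n" for i
    using that
  proof (induction i)
    case (Suc i)
    then show ?case using Q(2)[of i] by auto
  qed (use Q in auto)
  have "prime_chain A n (\<lambda>i. Q i \<inter> carrier A)"
    unfolding prime_chain_def
  proof (intro conjI allI impI)
    fix i assume "i \<le> n"
    then show "primeideal (Q i \<inter> carrier A) A" using image_primeideal Q(1) xQ by blast
  next
    fix i assume i: "i < n"
    then obtain r where r: "r \<in> Q (Suc i)" "r \<notin> Q i" using Q(2) by blast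
    have iS: "i \<le> n" "Suc i \<le> n" using i by auto
    note idl = primeideal.axioms(1)[OF Q(1)]
    have rR: "r \<in> carrier R" using ideal.Icarr[OF idl[OF iS(2)] r(1)] .
    have "\<rho> r \<in> Q (Suc i) \<inter> carrier A" "\<rho> r \<notin> Q i"
      using rep_mem_iff[OF idl[OF iS(1)] xQ[OF iS(1)] rR] rep_mem_iff[OF idl[OF iS(2)] xQ[OF iS(2)] rR] r rR by auto
    then show "Q i \<inter> carrier A \<subset> Q (Suc i) \<inter> carrier A" using Q(2)[OF i] by blast
  qed
  then have "krull_dim A = enat n"
    by (rule krull_dim_eqI) (use up n in auto)
  then show ?thesis using n by (simp add: one_enat_def)
qed


section \<open>Reducing resolutions modulo a nonzerodivisor\<close>

context principal_reduction
begin

definition reduce :: "('i \<Rightarrow> 'a) \<Rightarrow> 'i \<Rightarrow> 'a" where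
  "reduce v = (\<lambda>b. \<rho> (v b))"

lemma rep_x: "\<rho> x = \<zero>"
  using rep_cong[of \<zero> \<one>] by simp

lemma free_module_coeff_closed: "v \<in> carrier (free_module R B) \<Longrightarrow> v b \<in> carrier R"
  by (cases "b \<in> B") (auto simp: free_module_def)

lemma free_module_A_closed:
  assumes "y \<in> carrier (free_module A B)"
  shows "y \<in> carrier (free_module R B)" "reduce y = y"
proof -
  have yb: "y b \<in> carrier A" if "b \<in> B" for b using assms that by (auto simp: free_module_def)
  have y0: "y b = \<zero>" if "b \<notin> B" for b using assms that by (simp add: free_module_def)
  have fin: "finite {b \<in> B. y b \<noteq> \<zero>}" using assms by (simp add: free_module_def)
  show "y \<in> carrier (free_module R B)"
    unfolding free_module_def using A_closed[OF yb] y0 fin by simp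
  have "\<rho> (y b) = y b" for b using A_rep[OF yb] y0 by (cases "b \<in> B") auto
  then show "reduce y = y" by (simp add: reduce_def)
qed

lemma reduce_closed:
  assumes v: "v \<in> carrier (free_module R B)"
  shows "reduce v \<in> carrier (free_module A B)"
proof -
  have "{b \<in> B. \<rho> (v b) \<noteq> \<zero>} \<subseteq> {b \<in> B. v b \<noteq> \<zero>}" by auto
  moreover have "finite {b \<in> B. v b \<noteq> \<zero>}" "\<And>b. b \<notin> B \<Longrightarrow> v b = \<zero>" using v by (auto simp: free_module_def)
  ultimately show ?thesis
    using free_module_coeff_closed[OF v] by (auto simp: free_module_def reduce_def intro: finite_subset)
qed

lemma free_module_A_add: "y \<oplus>\<^bsub>free_module A B\<^esub> z = reduce (y \<oplus>\<^bsub>free_module R B\<^esub> z)"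
  by (simp add: free_module_def reduce_def)

lemma free_module_A_smult: "a \<odot>\<^bsub>free_module A B\<^esub> y = reduce (a \<odot>\<^bsub>free_module R B\<^esub> y)"
  by (simp add: free_module_def reduce_def)

lemma reduce_add:
  assumes "u \<in> carrier (free_module R B)" "v \<in> carrier (free_module R B)"
  shows "reduce (u \<oplus>\<^bsub>free_module R B\<^esub> v) = reduce u \<oplus>\<^bsub>free_module A B\<^esub> reduce v"
  using free_module_coeff_closed[OF assms(1)] free_module_coeff_closed[OF assms(2)]
  by (simp add: free_module_def reduce_def)

lemma reduce_smult:
  assumes "r \<in> carrier R" "v \<in> carrier (free_module R B)"
  shows "reduce (r \<odot>\<^bsub>free_module R B\<^esub> v) = \<rho> r \<odot>\<^bsub>free_module A B\<^esub> reduce v"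
  using assms(1) free_module_coeff_closed[OF assms(2)]
  by (simp add: free_module_def reduce_def)

lemma reduce_eq_iff:
  assumes u: "u \<in> carrier (free_module R B)" and v: "v \<in> carrier (free_module R B)"
  shows "reduce u = reduce v \<longleftrightarrow>
    (\<exists>z\<in>carrier (free_module R B). u = v \<oplus>\<^bsub>free_module R B\<^esub> x \<odot>\<^bsub>free_module R B\<^esub> z)"
proof
  assume eq: "reduce u = reduce v"
  have "\<exists>c\<in>carrier R. u b = v b \<oplus> x \<otimes> c" for b
    using rep_eq_iff[OF free_module_coeff_closed[OF u] free_module_coeff_closed[OF v]] fun_cong[OF eq]
    by (simp add: reduce_def)
  then obtain c where c: "\<And>b. c b \<in> carrier R" "\<And>b. u b = v b \<oplus> x \<otimes> c b" by metis
  \<comment> \<open>The quotients c b may be nonzero even where u and v agree; setting them to 0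
    there keeps the support of z finite.\<close>
  define z where "z b = (if u b = v b then \<zero> else c b)" for b
  have "{b \<in> B. z b \<noteq> \<zero>} \<subseteq> {b \<in> B. u b \<noteq> \<zero>} \<union> {b \<in> B. v b \<noteq> \<zero>}" by (auto simp: z_def)
  moreover have "finite ({b \<in> B. u b \<noteq> \<zero>} \<union> {b \<in> B. v b \<noteq> \<zero>})" using u v by (simp add: free_module_def)
  ultimately have "finite {b \<in> B. z b \<noteq> \<zero>}" by (rule finite_subset)
  moreover have "z b = \<zero>" if "b \<notin> B" for b using that u v by (simp add: free_module_def z_def)
  ultimately have "z \<in> carrier (free_module R B)" using c(1) by (simp add: free_module_def z_def)
  moreover have "u b = v b \<oplus> x \<otimes> z b" for b
    using c(2)[of b] free_module_coeff_closed[OF v] by (simp add: z_def)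
  then have "u = v \<oplus>\<^bsub>free_module R B\<^esub> x \<odot>\<^bsub>free_module R B\<^esub> z" by (auto simp: free_module_def)
  ultimately show "\<exists>z\<in>carrier (free_module R B). u = v \<oplus>\<^bsub>free_module R B\<^esub> x \<odot>\<^bsub>free_module R B\<^esub> z" by blast
next
  assume "\<exists>z\<in>carrier (free_module R B). u = v \<oplus>\<^bsub>free_module R B\<^esub> x \<odot>\<^bsub>free_module R B\<^esub> z"
  then obtain z where z: "z \<in> carrier (free_module R B)"
    "u = v \<oplus>\<^bsub>free_module R B\<^esub> x \<odot>\<^bsub>free_module R B\<^esub> z" by blast
  have "\<rho> (v b \<oplus> x \<otimes> z b) = \<rho> (v b)" for b
    using rep_cong free_module_coeff_closed[OF v] free_module_coeff_closed[OF z(1)] by blast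
  then show "reduce u = reduce v" unfolding z(2) by (simp add: free_module_def reduce_def)
qed

text \<open>Being additive and linear along \<rho>, the map t kills xM; therefore tg is constant on
  classes modulo xF and can be evaluated directly on vectors over A. In the applications t is the
  projection of I onto I/xI, the map \<open>reduce\<close>, or \<rho> itself.\<close>

lemma reduction_hom:
  assumes M: "module R M" and L: "module A L" and g: "g \<in> mod_hom R (free_module R B) M"
    and t: "\<And>m. m \<in> carrier M \<Longrightarrow> t m \<in> carrier L"
      "\<And>m n. m \<in> carrier M \<Longrightarrow> n \<in> carrier M \<Longrightarrow> t (m \<oplus>\<^bsub>M\<^esub> n) = t m \<oplus>\<^bsub>L\<^esub> t n"
      "\<And>r m. r \<in> carrier R \<Longrightarrow> m \<in> carrier M \<Longrightarrow> t (r \<odot>\<^bsub>M\<^esub> m) = \<rho> r \<odot>\<^bsub>L\<^esub> t m"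
  shows "(\<lambda>y. t (g y)) \<in> mod_hom A (free_module A B) L"
    and "v \<in> carrier (free_module R B) \<Longrightarrow> t (g (reduce v)) = t (g v)"
proof -
  interpret M: module R M by fact
  interpret L: module A L by fact
  interpret F: module R "free_module R B" by (rule free_module_is_module[OF is_cring])
  have red: "t (g (reduce v)) = t (g v)" if v: "v \<in> carrier (free_module R B)" for v
  proof -
    note rv = free_module_A_closed[OF reduce_closed[OF v]]
    obtain z where z: "z \<in> carrier (free_module R B)"
      "reduce v = v \<oplus>\<^bsub>free_module R B\<^esub> x \<odot>\<^bsub>free_module R B\<^esub> z"
      using reduce_eq_iff[OF rv(1) v] rv(2) by blast
    have gz: "g z \<in> carrier M" and gv: "g v \<in> carrier M" using mod_homD(1)[OF g] z v by auto
    have "g (reduce v) = g v \<oplus>\<^bsub>M\<^esub> x \<odot>\<^bsub>M\<^esub> g z"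
      unfolding z(2) using v z(1) by (simp add: mod_homD[OF g])
    also have "t \<dots> = t (g v) \<oplus>\<^bsub>L\<^esub> \<zero> \<odot>\<^bsub>L\<^esub> t (g z)" using gz gv by (simp add: t rep_x)
    also have "\<zero> \<odot>\<^bsub>L\<^esub> t (g z) = \<zero>\<^bsub>L\<^esub>" using L.smult_l_null[OF t(1)[OF gz]] by simp
    finally show ?thesis using t(1)[OF gv] by simp
  qed
  then show "v \<in> carrier (free_module R B) \<Longrightarrow> t (g (reduce v)) = t (g v)" .
  show "(\<lambda>y. t (g y)) \<in> mod_hom A (free_module A B) L"
  proof (rule mod_homI)
    fix y assume y: "y \<in> carrier (free_module A B)"
    note yR = free_module_A_closed(1)[OF y]
    show "t (g y) \<in> carrier L" using t(1) mod_homD(1)[OF g yR] by blast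
    show "t (g (y \<oplus>\<^bsub>free_module A B\<^esub> z)) = t (g y) \<oplus>\<^bsub>L\<^esub> t (g z)" if z: "z \<in> carrier (free_module A B)" for z
      unfolding free_module_A_add
      using yR free_module_A_closed(1)[OF z] by (simp add: red mod_homD[OF g] t)
    show "t (g (a \<odot>\<^bsub>free_module A B\<^esub> y)) = a \<odot>\<^bsub>L\<^esub> t (g y)" if a: "a \<in> carrier A" for a
      unfolding free_module_A_smult
      using yR A_closed[OF a] A_rep[OF a] by (simp add: red mod_homD[OF g] t)
  qed
qed

text \<open>N with \<tau> is a model of I/xI. The kernel is xI, which may be smaller than I \<inter>
  xR. Later proofs rely on these properties only, not on a particular carrier.\<close>

definition residue_module :: "'a set \<Rightarrow> ('a, 'n) module \<Rightarrow> ('a \<Rightarrow> 'n) \<Rightarrow> bool" where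
  "residue_module I N \<tau> \<longleftrightarrow> module A N \<and> carrier N = \<tau> ` I \<and>
     (\<forall>a\<in>I. \<forall>b\<in>I. \<tau> (a \<oplus> b) = \<tau> a \<oplus>\<^bsub>N\<^esub> \<tau> b) \<and>
     (\<forall>r\<in>carrier R. \<forall>a\<in>I. \<tau> (r \<otimes> a) = \<rho> r \<odot>\<^bsub>N\<^esub> \<tau> a) \<and>
     (\<forall>a\<in>I. \<tau> a = \<zero>\<^bsub>N\<^esub> \<longleftrightarrow> (\<exists>c\<in>I. a = x \<otimes> c))"

lemma residue_moduleD:
  assumes "residue_module I N \<tau>"
  shows "module A N" "carrier N = \<tau> ` I"
    "a \<in> I \<Longrightarrow> b \<in> I \<Longrightarrow> \<tau> (a \<oplus> b) = \<tau> a \<oplus>\<^bsub>N\<^esub> \<tau> b"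
    "r \<in> carrier R \<Longrightarrow> a \<in> I \<Longrightarrow> \<tau> (r \<otimes> a) = \<rho> r \<odot>\<^bsub>N\<^esub> \<tau> a"
    "a \<in> I \<Longrightarrow> \<tau> a = \<zero>\<^bsub>N\<^esub> \<longleftrightarrow> (\<exists>c\<in>I. a = x \<otimes> c)"
  using assms unfolding residue_module_def by blast+

text \<open>The carrier type is the one that the hypothesis of the theorem admits for modules.
  Operations go through a choice \<sigma> of representatives, and congruence modulo xI makes them
  independent of it.\<close>

lemma residue_module_exists:
  assumes I: "ideal I R"
  obtains N :: "('a, (nat \<Rightarrow> 'a) set) module" and \<tau> where "residue_module I N \<tau>"
proof -
  interpret I: ideal I R by fact
  note IR = I.Icarr
  \<comment> \<open>Cosets of \<open>xI\<close>, with \<open>'a\<close> embedded into \<open>nat \<Rightarrow> 'a\<close> by constant functions.\<close>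
  define \<tau> :: "'a \<Rightarrow> (nat \<Rightarrow> 'a) set" where "\<tau> a = {\<lambda>_. a \<oplus> x \<otimes> c |c. c \<in> I}" for a
  have \<tau>_iff: "\<tau> a = \<tau> b \<longleftrightarrow> (\<exists>c\<in>I. a = b \<oplus> x \<otimes> c)" if a: "a \<in> I" and b: "b \<in> I" for a b
  proof
    assume "\<tau> a = \<tau> b"
    have "a = a \<oplus> x \<otimes> \<zero>" using IR[OF a] by simp
    then have "(\<lambda>_. a) \<in> \<tau> a" unfolding \<tau>_def by (intro CollectI exI[of _ \<zero>]) (simp add: I.zero_closed)
    with \<open>\<tau> a = \<tau> b\<close> show "\<exists>c\<in>I. a = b \<oplus> x \<otimes> c" unfolding \<tau>_def by (auto dest: fun_cong)
  next
    have sub: "\<tau> a \<subseteq> \<tau> b" if "a \<in> I" "b \<in> I" "c \<in> I" "a = b \<oplus> x \<otimes> c" for a b c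
    proof
      fix f assume "f \<in> \<tau> a"
      then obtain e where e: "e \<in> I" "f = (\<lambda>_. a \<oplus> x \<otimes> e)" by (auto simp: \<tau>_def)
      have "a \<oplus> x \<otimes> e = b \<oplus> x \<otimes> (c \<oplus> e)"
        unfolding that(4) using IR[OF that(2)] IR[OF that(3)] IR[OF e(1)] by (simp add: r_distr a_assoc)
      then show "f \<in> \<tau> b" unfolding \<tau>_def e(2)
        by (intro CollectI exI[of _ "c \<oplus> e"]) (simp add: I.a_closed[OF that(3) e(1)])
    qed
    assume "\<exists>c\<in>I. a = b \<oplus> x \<otimes> c"
    then obtain c where c: "c \<in> I" "a = b \<oplus> x \<otimes> c" by blast
    have "b = a \<oplus> x \<otimes> (\<ominus> c)" unfolding c(2) using IR[OF b] IR[OF c(1)] x_carrier by algebra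
    then show "\<tau> a = \<tau> b" using sub[OF a b c] sub[OF b a I.a_inv_closed[OF c(1)]] by blast
  qed
  define \<sigma> where "\<sigma> X = (SOME a. a \<in> I \<and> \<tau> a = X)" for X
  have \<sigma>: "\<sigma> (\<tau> a) \<in> I" "\<tau> (\<sigma> (\<tau> a)) = \<tau> a" if "a \<in> I" for a
    using someI[of "\<lambda>b. b \<in> I \<and> \<tau> b = \<tau> a" a] that by (auto simp: \<sigma>_def)
  define N :: "('a, (nat \<Rightarrow> 'a) set) module" where
    "N = \<lparr>carrier = \<tau> ` I, mult = undefined, one = undefined, zero = \<tau> \<zero>,
      add = (\<lambda>X Y. \<tau> (\<sigma> X \<oplus> \<sigma> Y)), smult = (\<lambda>a X. \<tau> (a \<otimes> \<sigma> X))\<rparr>"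
  have carr: "carrier N = \<tau> ` I" and zero: "\<zero>\<^bsub>N\<^esub> = \<tau> \<zero>" by (simp_all add: N_def)
  have rep: "\<exists>c\<in>I. \<sigma> (\<tau> a) = a \<oplus> x \<otimes> c" if "a \<in> I" for a
    using \<tau>_iff[OF \<sigma>(1)[OF that] that] \<sigma>(2)[OF that] by blast
  have add: "\<tau> a \<oplus>\<^bsub>N\<^esub> \<tau> b = \<tau> (a \<oplus> b)" if a: "a \<in> I" and b: "b \<in> I" for a b
  proof -
    obtain c where c: "c \<in> I" "\<sigma> (\<tau> a) = a \<oplus> x \<otimes> c" using rep[OF a] by blast
    obtain e where e: "e \<in> I" "\<sigma> (\<tau> b) = b \<oplus> x \<otimes> e" using rep[OF b] by blast
    have "\<sigma> (\<tau> a) \<oplus> \<sigma> (\<tau> b) = (a \<oplus> b) \<oplus> x \<otimes> (c \<oplus> e)"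
      unfolding c(2) e(2) using IR[OF a] IR[OF b] IR[OF c(1)] IR[OF e(1)] x_carrier by algebra
    then have "\<tau> (\<sigma> (\<tau> a) \<oplus> \<sigma> (\<tau> b)) = \<tau> (a \<oplus> b)"
      using \<tau>_iff[OF I.a_closed[OF \<sigma>(1)[OF a] \<sigma>(1)[OF b]] I.a_closed[OF a b]] I.a_closed[OF c(1) e(1)] by blast
    then show ?thesis by (simp add: N_def)
  qed
  have smult: "\<rho> r \<odot>\<^bsub>N\<^esub> \<tau> a = \<tau> (r \<otimes> a)" if r: "r \<in> carrier R" and a: "a \<in> I" for r a
  proof -
    obtain c where c: "c \<in> I" "\<sigma> (\<tau> a) = a \<oplus> x \<otimes> c" using rep[OF a] by blast
    obtain e where e: "e \<in> carrier R" "\<rho> r = r \<oplus> x \<otimes> e" using rep_exists[OF r] by blast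
    \<comment> \<open>Replacing r by \<rho> r changes ra by x(ea). Since a \<in> I, this error lies
      in xI and not merely in xR, which is why A acts on the classes.\<close>
    have eq: "\<rho> r \<otimes> \<sigma> (\<tau> a) = r \<otimes> a \<oplus> x \<otimes> (e \<otimes> a \<oplus> \<rho> r \<otimes> c)"
    proof -
      have "\<rho> r \<otimes> \<sigma> (\<tau> a) = \<rho> r \<otimes> a \<oplus> x \<otimes> (\<rho> r \<otimes> c)"
        unfolding c(2) using IR[OF a] IR[OF c(1)] rep_closed[OF r] x_carrier by algebra
      also have "\<rho> r \<otimes> a = r \<otimes> a \<oplus> x \<otimes> (e \<otimes> a)"
        unfolding e(2) using IR[OF a] r e(1) x_carrier by algebra
      finally show ?thesis using IR[OF a] IR[OF c(1)] r e(1) by (simp add: r_distr a_assoc)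
    qed
    have "e \<otimes> a \<oplus> \<rho> r \<otimes> c \<in> I" by (intro I.a_closed I.I_l_closed a c e rep_closed r)
    then have "\<tau> (\<rho> r \<otimes> \<sigma> (\<tau> a)) = \<tau> (r \<otimes> a)"
      using \<tau>_iff[OF I.I_l_closed[OF \<sigma>(1)[OF a] rep_closed[OF r]] I.I_l_closed[OF a r]] eq by blast
    then show ?thesis by (simp add: N_def)
  qed
  have "module A N"
  proof (rule moduleI[OF cring_A], rule abelian_groupI)
    fix X assume "X \<in> carrier N"
    then obtain a where a: "a \<in> I" "X = \<tau> a" by (auto simp: carr)
    have "\<tau> (\<ominus> a) \<oplus>\<^bsub>N\<^esub> X = \<zero>\<^bsub>N\<^esub>"
      unfolding a(2) zero add[OF I.a_inv_closed[OF a(1)] a(1)] using IR[OF a(1)] by (simp add: l_neg)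
    then show "\<exists>Y\<in>carrier N. Y \<oplus>\<^bsub>N\<^esub> X = \<zero>\<^bsub>N\<^esub>"
      using I.a_inv_closed[OF a(1)] by (auto simp: carr)
  next
    fix X Y Z assume "X \<in> carrier N" "Y \<in> carrier N" "Z \<in> carrier N"
    then obtain a b c where abc: "a \<in> I" "X = \<tau> a" "b \<in> I" "Y = \<tau> b" "c \<in> I" "Z = \<tau> c" by (auto simp: carr)
    show "X \<oplus>\<^bsub>N\<^esub> Y \<oplus>\<^bsub>N\<^esub> Z = X \<oplus>\<^bsub>N\<^esub> (Y \<oplus>\<^bsub>N\<^esub> Z)"
      unfolding abc using abc by (simp add: add I.a_closed a_assoc IR)
  next
    fix X Y assume "X \<in> carrier N" "Y \<in> carrier N"
    then obtain a b where ab: "a \<in> I" "X = \<tau> a" "b \<in> I" "Y = \<tau> b" by (auto simp: carr)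
    show "X \<oplus>\<^bsub>N\<^esub> Y \<in> carrier N" unfolding ab using ab by (simp add: add I.a_closed carr)
    show "X \<oplus>\<^bsub>N\<^esub> Y = Y \<oplus>\<^bsub>N\<^esub> X" unfolding ab using ab by (simp add: add a_comm IR)
    fix r assume "r \<in> carrier A"
    then obtain s where s: "s \<in> carrier R" "r = \<rho> s" by auto
    show "r \<odot>\<^bsub>N\<^esub> (X \<oplus>\<^bsub>N\<^esub> Y) = r \<odot>\<^bsub>N\<^esub> X \<oplus>\<^bsub>N\<^esub> r \<odot>\<^bsub>N\<^esub> Y"
      unfolding ab s(2) using ab s by (simp add: add smult I.a_closed I.I_l_closed r_distr IR)
  next
    fix r X assume "r \<in> carrier A" "X \<in> carrier N"
    then obtain s a where s: "s \<in> carrier R" "r = \<rho> s" and a: "a \<in> I" "X = \<tau> a" by (auto simp: carr)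
    show "r \<odot>\<^bsub>N\<^esub> X \<in> carrier N" unfolding s(2) a(2) using s(1) a(1) by (simp add: smult I.I_l_closed carr)
    fix q assume "q \<in> carrier A"
    then obtain t where t: "t \<in> carrier R" "q = \<rho> t" by auto
    show "(r \<oplus>\<^bsub>A\<^esub> q) \<odot>\<^bsub>N\<^esub> X = r \<odot>\<^bsub>N\<^esub> X \<oplus>\<^bsub>N\<^esub> q \<odot>\<^bsub>N\<^esub> X"
      unfolding s(2) a(2) t(2) using s(1) a(1) t(1) by (simp add: smult add I.I_l_closed l_distr IR)
    show "(r \<otimes>\<^bsub>A\<^esub> q) \<odot>\<^bsub>N\<^esub> X = r \<odot>\<^bsub>N\<^esub> (q \<odot>\<^bsub>N\<^esub> X)"
      unfolding s(2) a(2) t(2) using s(1) a(1) t(1) by (simp add: smult add I.I_l_closed m_assoc IR)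
  next
    fix X assume "X \<in> carrier N"
    then obtain a where a: "a \<in> I" "X = \<tau> a" by (auto simp: carr)
    show "\<one>\<^bsub>A\<^esub> \<odot>\<^bsub>N\<^esub> X = X" "\<zero>\<^bsub>N\<^esub> \<oplus>\<^bsub>N\<^esub> X = X"
      unfolding a(2) zero using a(1) by (simp_all add: smult add IR)
  qed (simp add: carr zero)
  moreover have "\<tau> a = \<zero>\<^bsub>N\<^esub> \<longleftrightarrow> (\<exists>c\<in>I. a = x \<otimes> c)" if a: "a \<in> I" for a
  proof -
    have "\<zero> \<oplus> x \<otimes> c = x \<otimes> c" if "c \<in> I" for c using IR[OF that] by simp
    then have "(\<exists>c\<in>I. a = \<zero> \<oplus> x \<otimes> c) \<longleftrightarrow> (\<exists>c\<in>I. a = x \<otimes> c)" by simp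
    then show ?thesis
      unfolding zero \<tau>_iff[OF a I.zero_closed] .
  qed
  ultimately have "residue_module I N \<tau>"
    unfolding residue_module_def using carr add smult by simp
  then show ?thesis by (rule that)
qed

end

text \<open>Generation in the sense of submodules yields generation by linear combinations: the
  combinations of S are the image of the free module on S, a submodule containing S.\<close>

lemma fin_gen_moduleI:
  assumes M: "module R M" and S: "finite S" "S \<subseteq> carrier M"
    and gen: "\<And>H. submodule H R M \<Longrightarrow> S \<subseteq> H \<Longrightarrow> carrier M \<subseteq> H"
  shows "fin_gen_module R M"
proof -
  interpret M: module R M by fact
  let ?F = "free_module R S"
  interpret F: module R ?F by (rule free_module_is_module[OF M.R.is_cring])
  obtain \<phi> where \<phi>: "\<phi> \<in> mod_hom R ?F M" "\<And>s. s \<in> S \<Longrightarrow> \<phi> (unit_vector R s) = s"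
    "\<And>f. f \<in> carrier ?F \<Longrightarrow> \<phi> f = (\<Oplus>\<^bsub>M\<^esub>s\<in>S. f s \<odot>\<^bsub>M\<^esub> s)"
  proof (rule free_module_universal[OF M, of S "\<lambda>s. s"])
    show "s \<in> carrier M" if "s \<in> S" for s using that S by blast
    fix \<phi> assume \<phi>: "\<phi> \<in> mod_hom R ?F M" "\<And>s. s \<in> S \<Longrightarrow> \<phi> (unit_vector R s) = s"
      "\<And>f T. f \<in> carrier ?F \<Longrightarrow> finite T \<Longrightarrow> T \<subseteq> S \<Longrightarrow> (\<And>b. b \<notin> T \<Longrightarrow> f b = \<zero>\<^bsub>R\<^esub>) \<Longrightarrow>
        \<phi> f = (\<Oplus>\<^bsub>M\<^esub>b\<in>T. f b \<odot>\<^bsub>M\<^esub> b)"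
    show thesis
    proof (rule that[OF \<phi>(1) \<phi>(2)])
      fix f assume f: "f \<in> carrier ?F"
      show "\<phi> f = (\<Oplus>\<^bsub>M\<^esub>s\<in>S. f s \<odot>\<^bsub>M\<^esub> s)"
        by (rule \<phi>(3)[OF f S(1) subset_refl]) (use f in \<open>simp add: free_module_def\<close>)
    qed
  qed
  have sub: "submodule (\<phi> ` carrier ?F) R M"
  proof (rule M.submoduleI)
    show "\<phi> ` carrier ?F \<subseteq> carrier M" using mod_homD(1)[OF \<phi>(1)] by blast
    show "\<zero>\<^bsub>M\<^esub> \<in> \<phi> ` carrier ?F"
      using mod_hom_zero[OF F.module_axioms M \<phi>(1)] F.M.zero_closed by (metis imageI)
    show "a \<oplus>\<^bsub>M\<^esub> b \<in> \<phi> ` carrier ?F" if "a \<in> \<phi> ` carrier ?F" "b \<in> \<phi> ` carrier ?F" for a b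
    proof -
      from that obtain f g where fg: "f \<in> carrier ?F" "a = \<phi> f" "g \<in> carrier ?F" "b = \<phi> g" by blast
      have "a \<oplus>\<^bsub>M\<^esub> b = \<phi> (f \<oplus>\<^bsub>?F\<^esub> g)" unfolding fg(2,4) by (rule mod_homD(2)[OF \<phi>(1) fg(1,3), symmetric])
      then show ?thesis by (rule image_eqI[where f = \<phi>]) (rule F.M.a_closed[OF fg(1,3)])
    qed
    show sm: "r \<odot>\<^bsub>M\<^esub> a \<in> \<phi> ` carrier ?F" if "r \<in> carrier R" "a \<in> \<phi> ` carrier ?F" for r a
    proof -
      from that obtain f where f: "f \<in> carrier ?F" "a = \<phi> f" by blast
      have "r \<odot>\<^bsub>M\<^esub> a = \<phi> (r \<odot>\<^bsub>?F\<^esub> f)" unfolding f(2) by (rule mod_homD(3)[OF \<phi>(1) that(1) f(1), symmetric])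
      then show ?thesis by (rule image_eqI[where f = \<phi>]) (rule F.smult_closed[OF that(1) f(1)])
    qed
    show "\<ominus>\<^bsub>M\<^esub> a \<in> \<phi> ` carrier ?F" if a: "a \<in> \<phi> ` carrier ?F" for a
    proof -
      have "(\<ominus>\<^bsub>R\<^esub> \<one>\<^bsub>R\<^esub>) \<odot>\<^bsub>M\<^esub> a \<in> \<phi> ` carrier ?F" by (rule sm[OF _ a]) simp
      moreover have "a \<in> carrier M" using a mod_homD(1)[OF \<phi>(1)] by blast
      ultimately show ?thesis by (simp add: M.smult_l_minus)
    qed
  qed
  have SF: "S \<subseteq> \<phi> ` carrier ?F"
    using \<phi>(2) M.R.unit_vector_closed by (metis imageI subsetI)
  show ?thesis unfolding fin_gen_module_def
  proof (intro exI[of _ S] conjI ballI S)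
    fix m assume "m \<in> carrier M"
    then obtain f where f: "f \<in> carrier ?F" "m = \<phi> f" using gen[OF sub SF] by blast
    show "\<exists>c\<in>S \<rightarrow> carrier R. m = (\<Oplus>\<^bsub>M\<^esub>s\<in>S. c s \<odot>\<^bsub>M\<^esub> s)"
      by (rule bexI[of _ f]) (use f \<phi>(3)[OF f(1)] in \<open>auto simp: free_module_def\<close>)
  qed
qed


text \<open>Division by a nonzerodivisor is unique, so the pointwise chosen quotient is
  automatically linear: both sides of each law agree after multiplication by x.\<close>

lemma divide_hom_by_nonzerodivisor:
  assumes R: "cring R" and M: "module R M" and g: "g \<in> mod_hom R M (ring_module R)"
    and x: "nonzerodivisor R x" and div: "\<And>v. v \<in> carrier M \<Longrightarrow> \<exists>c\<in>carrier R. g v = x \<otimes>\<^bsub>R\<^esub> c"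
  obtains h where "h \<in> mod_hom R M (ring_module R)" "\<And>v. v \<in> carrier M \<Longrightarrow> g v = x \<otimes>\<^bsub>R\<^esub> h v"
proof -
  interpret cring R by fact
  interpret M: module R M by fact
  have xR: "x \<in> carrier R" using x by (simp add: nonzerodivisor_def)
  have cancel: "a = b" if "a \<in> carrier R" "b \<in> carrier R" "x \<otimes>\<^bsub>R\<^esub> a = x \<otimes>\<^bsub>R\<^esub> b" for a b
  proof -
    have "x \<otimes>\<^bsub>R\<^esub> (a \<ominus>\<^bsub>R\<^esub> b) = \<zero>\<^bsub>R\<^esub>" using that xR by (simp add: r_distr a_minus_def r_minus r_neg)
    then have "a \<ominus>\<^bsub>R\<^esub> b = \<zero>\<^bsub>R\<^esub>" using x that by (simp add: nonzerodivisor_def)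
    then show ?thesis using that by simp
  qed
  obtain h where h: "\<And>v. v \<in> carrier M \<Longrightarrow> h v \<in> carrier R" "\<And>v. v \<in> carrier M \<Longrightarrow> g v = x \<otimes>\<^bsub>R\<^esub> h v"
    using div by metis
  have "h \<in> mod_hom R M (ring_module R)"
  proof (rule mod_homI)
    fix v assume v: "v \<in> carrier M"
    show "h v \<in> carrier (ring_module R)" using h(1)[OF v] by simp
    show "h (v \<oplus>\<^bsub>M\<^esub> w) = h v \<oplus>\<^bsub>ring_module R\<^esub> h w" if w: "w \<in> carrier M" for w
    proof -
      have "x \<otimes>\<^bsub>R\<^esub> h (v \<oplus>\<^bsub>M\<^esub> w) = x \<otimes>\<^bsub>R\<^esub> (h v \<oplus>\<^bsub>R\<^esub> h w)"
        using mod_homD(2)[OF g v w] h v w xR by (simp add: r_distr)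
      then show ?thesis using cancel h(1) v w by simp
    qed
    show "h (a \<odot>\<^bsub>M\<^esub> v) = a \<odot>\<^bsub>ring_module R\<^esub> h v" if a: "a \<in> carrier R" for a
    proof -
      have "x \<otimes>\<^bsub>R\<^esub> h (a \<odot>\<^bsub>M\<^esub> v) = x \<otimes>\<^bsub>R\<^esub> (a \<otimes>\<^bsub>R\<^esub> h v)"
        using mod_homD(3)[OF g a v] h v a xR by (simp add: m_lcomm)
      then show ?thesis using cancel h(1) v a by simp
    qed
  qed
  with h(2) that show ?thesis by blast
qed

lemma free_module_nonzerodivisor:
  assumes R: "cring R" and x: "nonzerodivisor R x" and v: "v \<in> carrier (free_module R B)"
    and 0: "x \<odot>\<^bsub>free_module R B\<^esub> v = \<zero>\<^bsub>free_module R B\<^esub>"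
  shows "v = \<zero>\<^bsub>free_module R B\<^esub>"
proof -
  interpret cring R by fact
  have "v b = \<zero>\<^bsub>R\<^esub>" for b
  proof -
    have "v b \<in> carrier R" using v by (cases "b \<in> B") (auto simp: free_module_def)
    moreover have "x \<otimes>\<^bsub>R\<^esub> v b = \<zero>\<^bsub>R\<^esub>" using fun_cong[OF 0, of b] by (simp add: free_module_def)
    ultimately show ?thesis using x by (simp add: nonzerodivisor_def)
  qed
  then show ?thesis by (auto simp: free_module_def)
qed

section \<open>Resolution and cohomology of I/xI over the residue ring\<close>

context principal_reduction
begin

text \<open>For a submodule H of N the elements of I mapped into H form an ideal of R; once H
  contains the images of generators of I, this ideal is I.\<close>

lemma residue_module_fin_gen:
  assumes R: "noetherian_ring R" and I: "ideal I R" and N: "residue_module I N \<tau>"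
  shows "fin_gen_module A N"
proof -
  interpret I: ideal I R by fact
  note NM = residue_moduleD(1)[OF N]
  obtain S where S: "S \<subseteq> carrier R" "finite S" "I = Idl S"
    using noetherian_ring.finetely_gen[OF R I] by blast
  have SI: "S \<subseteq> I" using genideal_self[OF S(1)] S(3) by simp
  show ?thesis
  proof (rule fin_gen_moduleI[OF NM])
    show "finite (\<tau> ` S)" "\<tau> ` S \<subseteq> carrier N" using S(2) SI residue_moduleD(2)[OF N] by auto
    fix H assume H: "submodule H A N" "\<tau> ` S \<subseteq> H"
    note HE = module.submoduleE[OF NM H(1)]
    have "ideal {a \<in> I. \<tau> a \<in> H} R"
    proof (rule ideal_cringI)
      show "{a \<in> I. \<tau> a \<in> H} \<subseteq> carrier R" using I.Icarr by blast
      have "\<zero>\<^bsub>N\<^esub> \<in> H"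
        using subgroup.one_closed[OF submodule.axioms(1)[OF H(1)]] by simp
      moreover have "\<tau> \<zero> = \<zero>\<^bsub>N\<^esub>"
        unfolding residue_moduleD(5)[OF N I.zero_closed] by (rule bexI[of _ \<zero>]) (simp_all add: I.zero_closed)
      ultimately show "\<zero> \<in> {a \<in> I. \<tau> a \<in> H}" using I.zero_closed by simp
      show "a \<oplus> b \<in> {a \<in> I. \<tau> a \<in> H}" if "a \<in> {a \<in> I. \<tau> a \<in> H}" "b \<in> {a \<in> I. \<tau> a \<in> H}" for a b
        using that residue_moduleD(3)[OF N, of a b] HE(5)[of "\<tau> a" "\<tau> b"] I.a_closed[of a b] by simp
      show "r \<otimes> a \<in> {a \<in> I. \<tau> a \<in> H}" if "a \<in> {a \<in> I. \<tau> a \<in> H}" "r \<in> carrier R" for a r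
        using that residue_moduleD(4)[OF N, of r a] HE(4)[OF rep_in_A[of r], of "\<tau> a"] I.I_l_closed[of a r] by simp
    qed
    moreover have "S \<subseteq> {a \<in> I. \<tau> a \<in> H}" using SI H(2) by blast
    ultimately have "Idl S \<subseteq> {a \<in> I. \<tau> a \<in> H}" by (rule genideal_minimal)
    then have "I \<subseteq> {a \<in> I. \<tau> a \<in> H}" unfolding S(3)[symmetric] .
    then show "carrier N \<subseteq> H" unfolding residue_moduleD(2)[OF N] by blast
  qed
qed

text \<open>Since \<open>x\<close> is a nonzerodivisor on \<open>R\<close> and on \<open>I\<close>, the complex \<open>F/xF\<close> resolves \<open>I/xI\<close>.\<close>

lemma reduced_resolution:
  fixes N :: "('a, 'n) module"
  assumes x: "nonzerodivisor R x" and I: "ideal I R" and F: "free_resolution R (ideal_module R I) B \<delta> \<epsilon>"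
    and N: "residue_module I N \<tau>"
  shows "free_resolution A N B (\<lambda>i y. reduce (\<delta> i y)) (\<lambda>y. \<tau> (\<epsilon> y))"
proof -
  interpret I: ideal I R by fact
  note carr = residue_moduleD(2)[OF N] and add = residue_moduleD(3)[OF N]
    and smult = residue_moduleD(4)[OF N] and zero = residue_moduleD(5)[OF N]
  note mod = free_module_is_module[OF is_cring] and modA = free_module_is_module[OF cring_A]
  note IM = ideal_module_is_module[OF is_cring I]
  let ?F = "\<lambda>i. free_module R (B i)" and ?G = "\<lambda>i. free_module A (B i)"
  interpret F: module R "?F j" for j by (rule mod)
  note \<delta> = free_resolutionD(3)[OF F] and \<epsilon> = free_resolutionD(1)[OF F]
  have \<epsilon>I: "\<epsilon> v \<in> I" if "v \<in> carrier (?F 0)" for v using mod_homD(1)[OF \<epsilon> that] by simp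
  have \<epsilon>': "(\<lambda>y. \<tau> (\<epsilon> y)) \<in> mod_hom A (?G 0) N"
    "\<And>v. v \<in> carrier (?F 0) \<Longrightarrow> \<tau> (\<epsilon> (reduce v)) = \<tau> (\<epsilon> v)"
    by (rule reduction_hom[OF IM residue_moduleD(1)[OF N] \<epsilon>]; simp add: carr add smult)+
  have \<delta>': "(\<lambda>y. reduce (\<delta> i y)) \<in> mod_hom A (?G (Suc i)) (?G i)"
    "\<And>v. v \<in> carrier (?F (Suc i)) \<Longrightarrow> reduce (\<delta> i (reduce v)) = reduce (\<delta> i v)" for i
    by (rule reduction_hom[OF mod modA \<delta>]; simp add: reduce_closed reduce_add reduce_smult)+
  have reduce_zero: "reduce \<zero>\<^bsub>?F i\<^esub> = \<zero>\<^bsub>?G i\<^esub>" for i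
    by (simp add: reduce_def free_module_def)
  have xnz: "a = \<zero>" if "a \<in> carrier R" "x \<otimes> a = \<zero>" for a using x that by (simp add: nonzerodivisor_def)
  show ?thesis unfolding free_resolution_def
  proof (intro conjI allI)
    show "(\<lambda>y. \<tau> (\<epsilon> y)) \<in> mod_hom A (?G 0) N" by (rule \<epsilon>'(1))
    show "(\<lambda>y. reduce (\<delta> i y)) \<in> mod_hom A (?G (Suc i)) (?G i)" for i by (rule \<delta>'(1))
    show "(\<lambda>y. \<tau> (\<epsilon> y)) ` carrier (?G 0) = carrier N"
    proof
      show "(\<lambda>y. \<tau> (\<epsilon> y)) ` carrier (?G 0) \<subseteq> carrier N" using mod_homD(1)[OF \<epsilon>'(1)] by blast
      show "carrier N \<subseteq> (\<lambda>y. \<tau> (\<epsilon> y)) ` carrier (?G 0)"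
      proof
        fix n assume "n \<in> carrier N"
        then obtain a where a: "a \<in> I" "n = \<tau> a" by (auto simp: carr)
        obtain v where v: "v \<in> carrier (?F 0)" "\<epsilon> v = a" using free_resolutionD(2)[OF F, of a] a(1) by auto
        then have "n = \<tau> (\<epsilon> (reduce v))" using \<epsilon>'(2)[OF v(1)] a(2) by simp
        then show "n \<in> (\<lambda>y. \<tau> (\<epsilon> y)) ` carrier (?G 0)" using reduce_closed[OF v(1)] by (rule image_eqI)
      qed
    qed
    show "(\<lambda>y. reduce (\<delta> 0 y)) ` carrier (?G (Suc 0)) = {y \<in> carrier (?G 0). \<tau> (\<epsilon> y) = \<zero>\<^bsub>N\<^esub>}"
    proof (intro equalityI subsetI)
      fix y assume "y \<in> (\<lambda>y. reduce (\<delta> 0 y)) ` carrier (?G (Suc 0))"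
      then obtain w where w: "w \<in> carrier (?G (Suc 0))" "y = reduce (\<delta> 0 w)" by blast
      note wR = free_module_A_closed(1)[OF w(1)]
      have "\<tau> (\<epsilon> y) = \<tau> \<zero>"
        unfolding w(2) \<epsilon>'(2)[OF mod_homD(1)[OF \<delta> wR]] using free_resolutionD(4)[OF F wR] by simp
      also have "\<dots> = \<zero>\<^bsub>N\<^esub>" unfolding zero[OF I.zero_closed] by (rule bexI[of _ \<zero>]) (simp_all add: I.zero_closed)
      finally show "y \<in> {y \<in> carrier (?G 0). \<tau> (\<epsilon> y) = \<zero>\<^bsub>N\<^esub>}"
        using mod_homD(1)[OF \<delta>'(1) w(1)] w(2) by simp
    next
      fix y assume "y \<in> {y \<in> carrier (?G 0). \<tau> (\<epsilon> y) = \<zero>\<^bsub>N\<^esub>}"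
      then have y: "y \<in> carrier (?G 0)" "\<tau> (\<epsilon> y) = \<zero>\<^bsub>N\<^esub>" by auto
      note yR = free_module_A_closed[OF y(1)]
      \<comment> \<open>Vanishing of \<tau>(\<epsilon> y) means \<epsilon> y = xc with c \<in> I;
        lifting c to w makes y - xw a cycle over R with the same reduction as y.\<close>
      obtain c where c: "c \<in> I" "\<epsilon> y = x \<otimes> c" using zero[OF \<epsilon>I[OF yR(1)]] y(2) by blast
      obtain w where w: "w \<in> carrier (?F 0)" "\<epsilon> w = c" using free_resolutionD(2)[OF F, of c] c(1) by auto
      have xw: "x \<odot>\<^bsub>?F 0\<^esub> w \<in> carrier (?F 0)" using w by simp
      let ?u = "y \<ominus>\<^bsub>?F 0\<^esub> x \<odot>\<^bsub>?F 0\<^esub> w"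
      have u: "?u \<in> carrier (?F 0)" using yR(1) xw by simp
      have "\<epsilon> (x \<odot>\<^bsub>?F 0\<^esub> w) = \<epsilon> y" using mod_homD(3)[OF \<epsilon> x_carrier w(1)] c w by simp
      then have "\<epsilon> ?u = \<epsilon> y \<ominus>\<^bsub>ideal_module R I\<^esub> \<epsilon> y" using mod_hom_minus[OF mod IM \<epsilon> yR(1) xw] by simp
      also have "\<dots> = \<zero>\<^bsub>ideal_module R I\<^esub>" unfolding a_minus_def
        by (rule abelian_group.r_neg[OF module.axioms(2)[OF IM] mod_homD(1)[OF \<epsilon> yR(1)]])
      finally obtain v where v: "v \<in> carrier (?F (Suc 0))" "?u = \<delta> 0 v"
        using free_resolutionD(6)[OF F u] by blast
      have "y = ?u \<oplus>\<^bsub>?F 0\<^esub> x \<odot>\<^bsub>?F 0\<^esub> w"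
        using yR(1) xw by (simp add: a_minus_def F.M.a_assoc F.M.l_neg)
      then have "reduce y = reduce (\<delta> 0 v)"
        using reduce_eq_iff[OF yR(1) u] w(1) v(2) by metis
      then have "y = reduce (\<delta> 0 (reduce v))" using yR(2) \<delta>'(2)[OF v(1)] by simp
      then show "y \<in> (\<lambda>y. reduce (\<delta> 0 y)) ` carrier (?G (Suc 0))" using reduce_closed[OF v(1)] by (rule image_eqI)
    qed
    show "(\<lambda>y. reduce (\<delta> (Suc i) y)) ` carrier (?G (Suc (Suc i))) =
      {y \<in> carrier (?G (Suc i)). reduce (\<delta> i y) = \<zero>\<^bsub>?G i\<^esub>}" for i
    proof (intro equalityI subsetI)
      fix y assume "y \<in> (\<lambda>y. reduce (\<delta> (Suc i) y)) ` carrier (?G (Suc (Suc i)))"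
      then obtain w where w: "w \<in> carrier (?G (Suc (Suc i)))" "y = reduce (\<delta> (Suc i) w)" by blast
      note wR = free_module_A_closed(1)[OF w(1)]
      have "reduce (\<delta> i y) = \<zero>\<^bsub>?G i\<^esub>"
        unfolding w(2) \<delta>'(2)[OF mod_homD(1)[OF \<delta> wR]] free_resolutionD(5)[OF F wR] by (rule reduce_zero)
      then show "y \<in> {y \<in> carrier (?G (Suc i)). reduce (\<delta> i y) = \<zero>\<^bsub>?G i\<^esub>}"
        using mod_homD(1)[OF \<delta>'(1) w(1)] w(2) by simp
    next
      fix y assume "y \<in> {y \<in> carrier (?G (Suc i)). reduce (\<delta> i y) = \<zero>\<^bsub>?G i\<^esub>}"
      then have y: "y \<in> carrier (?G (Suc i))" "reduce (\<delta> i y) = reduce \<zero>\<^bsub>?F i\<^esub>" by (auto simp: reduce_zero)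
      note yR = free_module_A_closed[OF y(1)]
      have dyc: "\<delta> i y \<in> carrier (?F i)" by (rule mod_homD(1)[OF \<delta> yR(1)])
      obtain z where z: "z \<in> carrier (?F i)" "\<delta> i y = \<zero>\<^bsub>?F i\<^esub> \<oplus>\<^bsub>?F i\<^esub> x \<odot>\<^bsub>?F i\<^esub> z"
        using reduce_eq_iff[OF dyc F.M.zero_closed] y(2) by blast
      then have dy: "\<delta> i y = x \<odot>\<^bsub>?F i\<^esub> z" by simp
      \<comment> \<open>Since xz = \<delta> y is a boundary, x annihilates the image of z one degree
        lower. As x is a nonzerodivisor on I and on free modules, z is itself a cycle, hence a
        boundary \<delta> w, and y - xw is a cycle with the same reduction as y.\<close>
      have "z \<in> \<delta> i ` carrier (?F (Suc i))"
      proof (cases i)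
        case 0
        have "x \<otimes> \<epsilon> z = \<epsilon> (\<delta> 0 y)" using mod_homD(3)[OF \<epsilon> x_carrier, of z] z(1) dy 0 by simp
        also have "\<dots> = \<zero>" using free_resolutionD(4)[OF F, of y] yR(1) 0 by simp
        finally have "\<epsilon> z = \<zero>" using xnz[of "\<epsilon> z"] \<epsilon>I[of z] z(1) 0 I.Icarr by simp
        then show ?thesis using free_resolutionD(6)[OF F, of z] z(1) 0 by simp
      next
        case (Suc j)
        have zS: "z \<in> carrier (?F (Suc j))" using z(1) Suc by simp
        have "x \<odot>\<^bsub>?F j\<^esub> \<delta> j z = \<delta> j (\<delta> (Suc j) y)" using mod_homD(3)[OF \<delta> x_carrier zS] dy Suc by simp
        also have "\<dots> = \<zero>\<^bsub>?F j\<^esub>" using free_resolutionD(5)[OF F, of y j] yR(1) Suc by simp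
        finally have "\<delta> j z = \<zero>\<^bsub>?F j\<^esub>"
          by (rule free_module_nonzerodivisor[OF is_cring x mod_homD(1)[OF \<delta> zS]])
        then show ?thesis using free_resolutionD(7)[OF F zS] Suc by simp
      qed
      then obtain w where w: "w \<in> carrier (?F (Suc i))" "z = \<delta> i w" by blast
      have xw: "x \<odot>\<^bsub>?F (Suc i)\<^esub> w \<in> carrier (?F (Suc i))" using w by simp
      let ?u = "y \<ominus>\<^bsub>?F (Suc i)\<^esub> x \<odot>\<^bsub>?F (Suc i)\<^esub> w"
      have u: "?u \<in> carrier (?F (Suc i))" using yR(1) xw by simp
      have "\<delta> i (x \<odot>\<^bsub>?F (Suc i)\<^esub> w) = \<delta> i y" using mod_homD(3)[OF \<delta> x_carrier w(1)] dy w(2) by simp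
      then have "\<delta> i ?u = \<delta> i y \<ominus>\<^bsub>?F i\<^esub> \<delta> i y" using mod_hom_minus[OF mod mod \<delta> yR(1) xw] by simp
      also have "\<dots> = \<zero>\<^bsub>?F i\<^esub>" unfolding a_minus_def by (rule F.M.r_neg[OF dyc])
      finally obtain v where v: "v \<in> carrier (?F (Suc (Suc i)))" "?u = \<delta> (Suc i) v"
        using free_resolutionD(7)[OF F u] by blast
      have "y = ?u \<oplus>\<^bsub>?F (Suc i)\<^esub> x \<odot>\<^bsub>?F (Suc i)\<^esub> w"
        using yR(1) xw by (simp add: a_minus_def F.M.a_assoc F.M.l_neg)
      then have "reduce y = reduce (\<delta> (Suc i) v)"
        using reduce_eq_iff[OF yR(1) u] w(1) v(2) by metis
      then have "y = reduce (\<delta> (Suc i) (reduce v))" using yR(2) \<delta>'(2)[OF v(1)] by simp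
      then show "y \<in> (\<lambda>y. reduce (\<delta> (Suc i) y)) ` carrier (?G (Suc (Suc i)))" using reduce_closed[OF v(1)] by (rule image_eqI)
    qed
  qed
qed

text \<open>The long exact sequence of \<open>0 \<rightarrow> R \<rightarrow> R \<rightarrow> R/xR \<rightarrow> 0\<close> with \<open>x\<close> acting as zero: a class in
  \<open>Ext\<^sub>R(I, R)\<close> and its image in \<open>Ext\<^sub>A(I/xI, A)\<close> have the same annihilator.\<close>

lemma Ass_reduced_cohomology:
  fixes B :: "nat \<Rightarrow> 'i set"
  assumes x: "nonzerodivisor R x" "x \<in> I" and I: "ideal I R"
    and F: "free_resolution R (ideal_module R I) B \<delta> \<epsilon>"
    and G: "free_resolution A N B (\<lambda>i y. reduce (\<delta> i y)) \<eta>"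
    and P: "P \<in> Ass R (cohomology_module R (ring_module R) B \<delta> (Suc i))"
  shows "x \<in> P \<and> P \<inter> carrier A \<in> Ass A (cohomology_module A (ring_module A) B (\<lambda>i y. reduce (\<delta> i y)) (Suc i))"
proof -
  note mod = free_module_is_module[OF is_cring] and modA = free_module_is_module[OF cring_A]
  note RM = ring_module_is_module[OF is_cring] and AM = ring_module_is_module[OF cring_A]
  let ?F = "\<lambda>i. free_module R (B i)" and ?G = "\<lambda>i. free_module A (B i)"
  let ?\<gamma> = "\<lambda>i y. reduce (\<delta> i y)"
  note \<delta> = free_resolutionD(3)[OF F] and \<gamma> = free_resolutionD(3)[OF G]
  from P have prime: "primeideal P R" by (simp add: Ass_def)
  from P have "\<exists>f\<in>mod_hom R (?F (Suc i)) (ring_module R).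
      (\<forall>y\<in>carrier (?F (Suc (Suc i))). f (\<delta> (Suc i) y) = \<zero>\<^bsub>ring_module R\<^esub>) \<and>
      P = {r \<in> carrier R. is_coboundary R (ring_module R) B \<delta> (Suc i) (\<lambda>y. r \<odot>\<^bsub>ring_module R\<^esub> f y)}"
    unfolding Ass_cohomology_module[OF RM F] by (elim CollectE conjE)
  then obtain f where f: "f \<in> mod_hom R (?F (Suc i)) (ring_module R)"
    and f': "(\<forall>y\<in>carrier (?F (Suc (Suc i))). f (\<delta> (Suc i) y) = \<zero>\<^bsub>ring_module R\<^esub>) \<and>
      P = {r \<in> carrier R. is_coboundary R (ring_module R) B \<delta> (Suc i) (\<lambda>y. r \<odot>\<^bsub>ring_module R\<^esub> f y)}" by (rule bexE)
  have f0: "f (\<delta> (Suc i) y) = \<zero>" if "y \<in> carrier (?F (Suc (Suc i)))" for y using f' that by simp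
  note Pf = conjunct2[OF f']
  have fR: "f v \<in> carrier R" if "v \<in> carrier (?F (Suc i))" for v using mod_homD(1)[OF f that] by simp
  \<comment> \<open>Every cocycle becomes a coboundary after multiplication by x \<in> I. This
    serves twice: for x \<in> P, and for the cocycle h obtained below by division by x.\<close>
  have killed: "is_coboundary R (ring_module R) B \<delta> (Suc i) (\<lambda>v. x \<odot>\<^bsub>ring_module R\<^esub> g v)"
    if "g \<in> mod_hom R (?F (Suc i)) (ring_module R)" "\<And>v. v \<in> carrier (?F (Suc (Suc i))) \<Longrightarrow> g (\<delta> (Suc i) v) = \<zero>" for g
    by (rule ideal_annihilates_higher_cohomology[OF is_cring I RM F x(2) that(1)]) (simp add: that(2))
  have xP: "x \<in> P" unfolding Pf using killed[OF f f0] by simp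
  have red: "(\<lambda>y. \<rho> (g y)) \<in> mod_hom A (free_module A C) (ring_module A)"
    "\<And>v. v \<in> carrier (free_module R C) \<Longrightarrow> \<rho> (g (reduce v)) = \<rho> (g v)"
    if g: "g \<in> mod_hom R (free_module R C) (ring_module R)" for g and C :: "'i set"
    by (rule reduction_hom[OF RM AM g]; simp)+
  have red\<delta>: "reduce (\<delta> j (reduce v)) = reduce (\<delta> j v)" if "v \<in> carrier (?F (Suc j))" for j v
    by (rule reduction_hom(2)[OF mod modA \<delta> _ _ _ that]) (simp_all add: reduce_closed reduce_add reduce_smult)
  let ?f = "\<lambda>y. \<rho> (f y)"
  have fA: "?f \<in> mod_hom A (?G (Suc i)) (ring_module A)" by (rule red(1)[OF f])
  have fA0: "?f (?\<gamma> (Suc i) y) = \<zero>\<^bsub>ring_module A\<^esub>" if y: "y \<in> carrier (?G (Suc (Suc i)))" for y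
    using red(2)[OF f mod_homD(1)[OF \<delta> free_module_A_closed(1)[OF y]]] f0[OF free_module_A_closed(1)[OF y]] by simp
  have iff: "is_coboundary R (ring_module R) B \<delta> (Suc i) (\<lambda>y. a \<odot>\<^bsub>ring_module R\<^esub> f y) \<longleftrightarrow>
      is_coboundary A (ring_module A) B ?\<gamma> (Suc i) (\<lambda>y. a \<odot>\<^bsub>ring_module A\<^esub> ?f y)" if a: "a \<in> carrier A" for a
  proof
    note aR = A_closed[OF a]
    assume "is_coboundary R (ring_module R) B \<delta> (Suc i) (\<lambda>y. a \<odot>\<^bsub>ring_module R\<^esub> f y)"
    then obtain k where k: "k \<in> mod_hom R (?F i) (ring_module R)"
      "\<And>y. y \<in> carrier (?F (Suc i)) \<Longrightarrow> a \<otimes> f y = k (\<delta> i y)" by (auto simp: is_coboundary_Suc)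
    show "is_coboundary A (ring_module A) B ?\<gamma> (Suc i) (\<lambda>y. a \<odot>\<^bsub>ring_module A\<^esub> ?f y)"
      unfolding is_coboundary_Suc
    proof (rule bexI[OF _ red(1)[OF k(1)]], rule ballI)
      fix y assume "y \<in> carrier (?G (Suc i))"
      note yR = free_module_A_closed(1)[OF this]
      show "a \<odot>\<^bsub>ring_module A\<^esub> \<rho> (f y) = \<rho> (k (reduce (\<delta> i y)))"
        using red(2)[OF k(1) mod_homD(1)[OF \<delta> yR]] k(2)[OF yR] fR[OF yR] aR by simp
    qed
  next
    note aR = A_closed[OF a]
    assume "is_coboundary A (ring_module A) B ?\<gamma> (Suc i) (\<lambda>y. a \<odot>\<^bsub>ring_module A\<^esub> ?f y)"
    then obtain l where l: "l \<in> mod_hom A (?G i) (ring_module A)"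
      "\<And>y. y \<in> carrier (?G (Suc i)) \<Longrightarrow> \<rho> (a \<otimes> \<rho> (f y)) = l (reduce (\<delta> i y))" by (auto simp: is_coboundary_Suc)
    have lA: "l y \<in> carrier A" if "y \<in> carrier (?G i)" for y using mod_homD(1)[OF l(1) that] by simp
    have unit: "unit_vector A b = reduce (unit_vector R b)" for b :: 'i
      by (auto simp: unit_vector_def reduce_def)
    interpret A: cring A by (rule cring_A)
    have uA: "unit_vector A b \<in> carrier (?G i)" if "b \<in> B i" for b by (rule A.unit_vector_closed[OF that])
    have "l (unit_vector A b) \<in> carrier (ring_module R)" if "b \<in> B i" for b
      using A_closed[OF lA[OF uA[OF that]]] by simp
    \<comment> \<open>Freeness lifts the primitive l over A to a homomorphism k over R: its values
      on the basis, elements of A, are read as elements of R.\<close>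
    then obtain k where k: "k \<in> mod_hom R (?F i) (ring_module R)"
      "\<And>b. b \<in> B i \<Longrightarrow> k (unit_vector R b) = l (unit_vector A b)"
      using free_module_universal[OF RM, of "B i" "\<lambda>b. l (unit_vector A b)"] by metis
    have kl: "\<rho> (k y) = l y" if y: "y \<in> carrier (?G i)" for y
    proof (rule free_module_hom_eq[OF AM red(1)[OF k(1)] l(1) _ y])
      fix b assume b: "b \<in> B i"
      have "\<rho> (k (unit_vector A b)) = \<rho> (k (unit_vector R b))"
        unfolding unit by (rule red(2)[OF k(1) unit_vector_closed[OF b]])
      also have "\<dots> = l (unit_vector A b)" using k(2)[OF b] A_rep[OF lA[OF uA[OF b]]] by simp
      finally show "\<rho> (k (unit_vector A b)) = l (unit_vector A b)" .
    qed
    note k\<delta> = mod_hom_compose[OF \<delta> k(1)]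
    \<comment> \<open>Since k reduces to l, the cocycle af - k\<delta> vanishes modulo x and equals
      xh for a cocycle h. As x kills the class of h, the sum af = xh + k\<delta> is a
      coboundary.\<close>
    let ?g = "\<lambda>v. a \<odot>\<^bsub>ring_module R\<^esub> f v \<ominus>\<^bsub>ring_module R\<^esub> k (\<delta> i v)"
    have g: "?g \<in> mod_hom R (?F (Suc i)) (ring_module R)"
      by (rule mod_hom_diff[OF RM mod_hom_smult[OF RM f aR] k\<delta>])
    have minus: "u \<ominus>\<^bsub>ring_module R\<^esub> w = u \<ominus> w" if "u \<in> carrier R" "w \<in> carrier R" for u w
    proof -
      interpret RM: module R "ring_module R" by (rule RM)
      have "\<ominus>\<^bsub>ring_module R\<^esub> w = \<ominus> w" by (rule RM.M.minus_equality) (use that in \<open>simp_all add: l_neg\<close>)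
      then show ?thesis by (simp add: a_minus_def)
    qed
    have kR: "k (\<delta> i v) \<in> carrier R" if "v \<in> carrier (?F (Suc i))" for v using mod_homD(1)[OF k\<delta> that] by simp
    have dec: "a \<otimes> f v = ?g v \<oplus> k (\<delta> i v)" if v: "v \<in> carrier (?F (Suc i))" for v
      using minus[OF m_closed[OF aR fR[OF v]] kR[OF v]] aR fR[OF v] kR[OF v]
      by (simp add: a_minus_def a_assoc l_neg)
    have "\<exists>c\<in>carrier R. ?g v = x \<otimes> c" if v: "v \<in> carrier (?F (Suc i))" for v
    proof -
      note rv = reduce_closed[OF v]
      have gv: "?g v \<in> carrier R" using mod_homD(1)[OF g v] by simp
      have "\<rho> (a \<otimes> f v) = \<rho> (a \<otimes> \<rho> (f (reduce v)))" using red(2)[OF f v] aR fR[OF v] by simp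
      also have "\<dots> = \<rho> (k (reduce (\<delta> i (reduce v))))"
        using l(2)[OF rv] kl[OF mod_homD(1)[OF \<gamma> rv]] by simp
      also have "\<dots> = \<rho> (k (\<delta> i v))"
        unfolding red\<delta>[OF v] by (rule red(2)[OF k(1) mod_homD(1)[OF \<delta> v]])
      finally obtain c where c: "c \<in> carrier R" "a \<otimes> f v = k (\<delta> i v) \<oplus> x \<otimes> c"
        using rep_eq_iff[OF m_closed[OF aR fR[OF v]] kR[OF v]] by blast
      have "?g v = x \<otimes> c"
        using minus[OF m_closed[OF aR fR[OF v]] kR[OF v]] c kR[OF v]
        by (simp add: a_minus_def a_ac r_neg)
      with c(1) show ?thesis by blast
    qed
    then obtain h where h: "h \<in> mod_hom R (?F (Suc i)) (ring_module R)"
      "\<And>v. v \<in> carrier (?F (Suc i)) \<Longrightarrow> ?g v = x \<otimes> h v"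
      using divide_hom_by_nonzerodivisor[OF is_cring mod g x(1)] by metis
    have "h (\<delta> (Suc i) v) = \<zero>" if v: "v \<in> carrier (?F (Suc (Suc i)))" for v
    proof -
      note dv = mod_homD(1)[OF \<delta> v]
      have "k (\<delta> i (\<delta> (Suc i) v)) = \<zero>"
        using free_resolutionD(5)[OF F v] mod_hom_zero[OF mod RM k(1)] by simp
      then have "?g (\<delta> (Suc i) v) = \<zero>" using f0[OF v] aR minus[of \<zero> \<zero>] by simp
      then have "x \<otimes> h (\<delta> (Suc i) v) = \<zero>" using h(2)[OF dv] by simp
      then show ?thesis using x(1) mod_homD(1)[OF h(1) dv] by (simp add: nonzerodivisor_def)
    qed
    then have xh: "is_coboundary R (ring_module R) B \<delta> (Suc i) (\<lambda>v. x \<odot>\<^bsub>ring_module R\<^esub> h v)"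
      by (rule killed[OF h(1)])
    have kd: "is_coboundary R (ring_module R) B \<delta> (Suc i) (\<lambda>v. k (\<delta> i v))"
      unfolding is_coboundary_Suc using k(1) by blast
    have eq: "a \<odot>\<^bsub>ring_module R\<^esub> f v = x \<odot>\<^bsub>ring_module R\<^esub> h v \<oplus>\<^bsub>ring_module R\<^esub> k (\<delta> i v)"
      if v: "v \<in> carrier (?F (Suc i))" for v
      using dec[OF v] h(2)[OF v] by simp
    show "is_coboundary R (ring_module R) B \<delta> (Suc i) (\<lambda>y. a \<odot>\<^bsub>ring_module R\<^esub> f y)"
      by (rule iffD2[OF is_coboundary_cong is_coboundary_add[OF RM xh kd]]) (rule eq)
  qed
  have PA: "P \<inter> carrier A = {a \<in> carrier A. is_coboundary A (ring_module A) B ?\<gamma> (Suc i) (\<lambda>y. a \<odot>\<^bsub>ring_module A\<^esub> ?f y)}"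
  proof (rule Set.set_eqI)
    fix a
    show "a \<in> P \<inter> carrier A \<longleftrightarrow>
      a \<in> {a \<in> carrier A. is_coboundary A (ring_module A) B ?\<gamma> (Suc i) (\<lambda>y. a \<odot>\<^bsub>ring_module A\<^esub> ?f y)}"
    proof (cases "a \<in> carrier A")
      case True
      have "a \<in> P \<longleftrightarrow> is_coboundary R (ring_module R) B \<delta> (Suc i) (\<lambda>y. a \<odot>\<^bsub>ring_module R\<^esub> f y)"
        unfolding Pf using A_closed[OF True] by blast
      then show ?thesis using iff[OF True] True by blast
    qed blast
  qed
  have "P \<inter> carrier A \<in> Ass A (cohomology_module A (ring_module A) B ?\<gamma> (Suc i))"
    unfolding Ass_cohomology_module[OF AM G]
    by (intro CollectI conjI image_primeideal[OF prime xP] bexI[OF _ fA] ballI fA0 PA) assumption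
  with xP show ?thesis by blast
qed

end

section \<open>Finiteness of the associated primes in all degrees together\<close>

theorem proposition5p8:
  fixes R :: "'a ring" and d :: nat
  assumes "noetherian_local_ring R"
    and "krull_dim R = enat d"
    and "\<And>(A :: 'a ring) (N :: ('a, (nat \<Rightarrow> 'a) set) module).
      \<lbrakk>noetherian_local_ring A; krull_dim A + 1 = enat d; module A N; fin_gen_module A N\<rbrakk>
      \<Longrightarrow> finite (\<Union>i. Ass A (Ext A i N (ring_module A)))"
  shows "\<forall>I. ideal I R \<and> positive_grade R I \<longrightarrow>
    finite (\<Union>i. Ass R (Ext R i (ideal_module R I) (ring_module R)))"
proof (intro allI impI, elim conjE)
  fix I assume I: "ideal I R" and "positive_grade R I"
  then obtain x where x: "x \<in> I" "nonzerodivisor R x" by (auto simp: positive_grade_def)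
  obtain m where R: "noetherian_cring R" and m: "maximalideal m R"
    and above: "\<And>J. ideal J R \<Longrightarrow> J \<noteq> carrier R \<Longrightarrow> J \<subseteq> m"
    using noetherian_local_ringD[OF assms(1)] by metis
  interpret noetherian_cring R by fact
  interpret I: ideal I R by fact
  note IM = ideal_module_is_module[OF is_cring I] and RM = ring_module_is_module[OF is_cring]
  \<comment> \<open>The resolution behind \<open>Ext\<close> over R is fixed once for all degrees;
    its reduction modulo x is the resolution used over A.\<close>
  obtain B \<delta> \<epsilon> where F: "free_resolution R (ideal_module R I) (B :: nat \<Rightarrow> ('a, 'a) label set) \<delta> \<epsilon>"
    and Ext: "\<And>i. Ext R i (ideal_module R I) (ring_module R) = cohomology_module R (ring_module R) B \<delta> i"
    using Ext_eq_cohomology[OF IM] by metis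
  let ?H = "\<lambda>i. Ass R (cohomology_module R (ring_module R) B \<delta> i)"
  have "finite (?H 0)"
    using Ass_zeroth_cohomology_ideal[OF is_cring I x F] finite_Ass_ring_module by (rule finite_subset)
  moreover have "finite (\<Union>i. ?H (Suc i))"
  \<comment> \<open>For I = R the element x may be a unit, and then R/xR is zero and not local; this
    case needs its own argument.\<close>
  proof (cases "I = carrier R")
    case True
    have "P \<notin> ?H (Suc i)" for P i
    proof
      assume P: "P \<in> ?H (Suc i)"
      then have prime: "primeideal P R" by (simp add: Ass_def)
      from P have "\<exists>f\<in>mod_hom R (free_module R (B (Suc i))) (ring_module R).
          (\<forall>y\<in>carrier (free_module R (B (Suc (Suc i)))). f (\<delta> (Suc i) y) = \<zero>\<^bsub>ring_module R\<^esub>) \<and>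
          P = {r \<in> carrier R. is_coboundary R (ring_module R) B \<delta> (Suc i) (\<lambda>y. r \<odot>\<^bsub>ring_module R\<^esub> f y)}"
        unfolding Ass_cohomology_module[OF RM F] by (elim CollectE conjE)
      then obtain f where f: "f \<in> mod_hom R (free_module R (B (Suc i))) (ring_module R)"
        and f': "(\<forall>y\<in>carrier (free_module R (B (Suc (Suc i)))). f (\<delta> (Suc i) y) = \<zero>\<^bsub>ring_module R\<^esub>) \<and>
          P = {r \<in> carrier R. is_coboundary R (ring_module R) B \<delta> (Suc i) (\<lambda>y. r \<odot>\<^bsub>ring_module R\<^esub> f y)}"
        by (rule bexE)
      have "is_coboundary R (ring_module R) B \<delta> (Suc i) (\<lambda>y. \<one>\<^bsub>R\<^esub> \<odot>\<^bsub>ring_module R\<^esub> f y)"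
        by (rule ideal_annihilates_higher_cohomology[OF is_cring I RM F _ f]) (use f' True in simp_all)
      then have "\<one>\<^bsub>R\<^esub> \<in> P" unfolding conjunct2[OF f'] by simp
      then show False
        using primeideal.I_notcarr[OF prime] ideal.one_imp_carrier[OF primeideal.axioms(1)[OF prime]] by metis
    qed
    then have "(\<Union>i. ?H (Suc i)) = {}" by blast
    then show ?thesis by simp
  next
    case False
    then have xm: "x \<in> m" using above[OF I] x(1) by blast
    have xR: "x \<in> carrier R" using x(1) I.Icarr by blast
    obtain \<rho> where "principal_reduction R x \<rho> (reduction_ring R \<rho>)" by (rule principal_reduction_exists[OF xR])
    then interpret red: principal_reduction R x \<rho> "reduction_ring R \<rho>" .
    let ?A = "reduction_ring R \<rho>"
    obtain N :: "('a, (nat \<Rightarrow> 'a) set) module" and \<tau> where N: "red.residue_module I N \<tau>"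
      by (rule red.residue_module_exists[OF I])
    note NM = red.residue_moduleD(1)[OF N] and fg = red.residue_module_fin_gen[OF noetherian_ring_axioms I N]
    have G: "free_resolution ?A N B (\<lambda>i y. red.reduce (\<delta> i y)) (\<lambda>y. \<tau> (\<epsilon> y))"
      by (rule red.reduced_resolution[OF x(2) I F N])
    let ?E = "\<Union>i. Ass ?A (Ext ?A i N (ring_module ?A))"
    have "finite ?E"
      by (rule assms(3)[OF red.noetherian_local_A[OF assms(1) m xm]
            red.krull_dim_A[OF assms(1) m xm x(2) assms(2)] NM fg])
    moreover have "P \<inter> carrier ?A \<in> ?E \<and> x \<in> P \<and> ideal P R" if P: "P \<in> (\<Union>i. ?H (Suc i))" for P
    proof -
      from P obtain i where Pi: "P \<in> ?H (Suc i)" by blast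
      then have "ideal P R" using primeideal.axioms(1) by (auto simp: Ass_def)
      \<comment> \<open>The reduced resolution need not be the one chosen by \<open>Ext\<close> over
        A; independence of the resolution bridges the gap.\<close>
      moreover note red.Ass_reduced_cohomology[OF x(2,1) I F G Pi]
        Ass_cohomology_subset_Ass_Ext[OF NM ring_module_is_module[OF red.cring_A] G, of "Suc i"]
      ultimately show ?thesis by blast
    qed
    then have E: "(\<lambda>P. P \<inter> carrier ?A) ` (\<Union>i. ?H (Suc i)) \<subseteq> ?E"
      and xP: "\<And>P. P \<in> (\<Union>i. ?H (Suc i)) \<Longrightarrow> x \<in> P \<and> ideal P R" by blast+
    \<comment> \<open>All members of the union contain x, so each is the preimage under \<rho> of
      its intersection with A.\<close>
    have "inj_on (\<lambda>P. P \<inter> carrier ?A) (\<Union>i. ?H (Suc i))"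
    proof (rule inj_on_inverseI)
      fix P assume "P \<in> (\<Union>i. ?H (Suc i))"
      then have P: "ideal P R" "x \<in> P" using xP by blast+
      show "{r \<in> carrier R. \<rho> r \<in> P \<inter> carrier ?A} = P"
        using red.rep_mem_iff[OF P] red.rep_in_A ideal.Icarr[OF P(1)] by blast
    qed
    ultimately show ?thesis using finite_imageD finite_subset[OF E] by blast
  qed
  moreover have "(\<Union>i. ?H i) = ?H 0 \<union> (\<Union>i. ?H (Suc i))"
  proof -
    have "(UNIV :: nat set) = insert 0 (range Suc)" by (rule UNIV_nat_eq)
    then have "(\<Union>i. ?H i) = (\<Union>i\<in>insert 0 (range Suc). ?H i)" by simp
    then show ?thesis by simp
  qed
  ultimately show "finite (\<Union>i. Ass R (Ext R i (ideal_module R I) (ring_module R)))"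
    unfolding Ext by simp
qed

end
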